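(* The Hopf constant $c_1$ satisfies $$c_1<\frac{2\pi^2}{27}\left(2+\sqrt{31}\right)\approx 5.53265.$$
   Context: Let $\mathbb{D}=\{(u,v)\in\mathbb{R}^2:u^2+v^2<1\}$. A minimal graph over $\mathbb{D}$ is the graph of a real function $\mathbf{f}$ on $\mathbb{D}$ solving the minimal surface equation $(1+\mathbf{f}_v^2)\mathbf{f}_{uu}-2\mathbf{f}_u\mathbf{f}_v\mathbf{f}_{uv}+(1+\mathbf{f}_u^2)\mathbf{f}_{vv}=0$. Put $W=\sqrt{1+\mathbf{f}_u^2+\mathbf{f}_v^2}$ and let $\mathcal{K}=\dfrac{\mathbf{f}_{uu}\mathbf{f}_{vv}-\mathbf{f}_{uv}^2}{W^4}$ be the Gaussian curvature. The Hopf constant $c_1$ is the best (smallest) constant such that $W^2|\mathcal{K}|\le c_1$ holds at the point above the origin $(u,v)=(0,0)$ for all minimal graphs over the unit disk; that is, $$c_1=\sup_{\mathbf{f}}\;W(0,0)^2\,|\mathcal{K}(0,0)|=\sup_{\mathbf{f}}\frac{|\mathbf{f}_{uu}\mathbf{f}_{vv}-\mathbf{f}_{uv}^2|}{1+\mathbf{f}_u^2+\mathbf{f}_v^2}\Big|_{(0,0)},$$ the supremum being over all minimal graphs over $\mathbb{D}$. *)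

theory Defs
  imports "HOL-Analysis.Analysis"
begin

definition unit_disk :: "(real \<times> real) set" where
  "unit_disk = {(u, v). u\<^sup>2 + v\<^sup>2 < 1}"

text \<open>Functions on a plane domain are total functions on pairs \<open>(u, v)\<close>; on an open domain the
  partial derivatives, and hence everything below, depend only on the values inside the domain.\<close>

definition partial_u :: "(real \<times> real \<Rightarrow> real) \<Rightarrow> real \<times> real \<Rightarrow> real" where
  "partial_u f = (\<lambda>(u, v). deriv (\<lambda>t. f (t, v)) u)"

definition partial_v :: "(real \<times> real \<Rightarrow> real) \<Rightarrow> real \<times> real \<Rightarrow> real" where
  "partial_v f = (\<lambda>(u, v). deriv (\<lambda>t. f (u, t)) v)"

definition C1_on :: "(real \<times> real) set \<Rightarrow> (real \<times> real \<Rightarrow> real) \<Rightarrow> bool" where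
  "C1_on S f \<longleftrightarrow>
     (\<forall>(u, v)\<in>S. (\<lambda>t. f (t, v)) differentiable (at u) \<and> (\<lambda>t. f (u, t)) differentiable (at v)) \<and>
     continuous_on S (partial_u f) \<and> continuous_on S (partial_v f)"

definition C2_on :: "(real \<times> real) set \<Rightarrow> (real \<times> real \<Rightarrow> real) \<Rightarrow> bool" where
  "C2_on S f \<longleftrightarrow> C1_on S f \<and> C1_on S (partial_u f) \<and> C1_on S (partial_v f)"

abbreviation partial_uu :: "(real \<times> real \<Rightarrow> real) \<Rightarrow> real \<times> real \<Rightarrow> real" where
  "partial_uu f \<equiv> partial_u (partial_u f)"

abbreviation partial_uv :: "(real \<times> real \<Rightarrow> real) \<Rightarrow> real \<times> real \<Rightarrow> real" where
  "partial_uv f \<equiv> partial_v (partial_u f)"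

abbreviation partial_vv :: "(real \<times> real \<Rightarrow> real) \<Rightarrow> real \<times> real \<Rightarrow> real" where
  "partial_vv f \<equiv> partial_v (partial_v f)"

text \<open>The graph of \<open>f\<close> over the open set \<open>S\<close> is minimal: \<open>f\<close> is a classical, i.e.\ twice
  continuously differentiable, solution of the minimal surface equation on \<open>S\<close>.\<close>

definition minimal_graph_over :: "(real \<times> real) set \<Rightarrow> (real \<times> real \<Rightarrow> real) \<Rightarrow> bool" where
  "minimal_graph_over S f \<longleftrightarrow> C2_on S f \<and>
     (\<forall>p\<in>S. (1 + (partial_v f p)\<^sup>2) * partial_uu f p
            - 2 * partial_u f p * partial_v f p * partial_uv f p
            + (1 + (partial_u f p)\<^sup>2) * partial_vv f p = 0)"

definition graph_W :: "(real \<times> real \<Rightarrow> real) \<Rightarrow> real \<times> real \<Rightarrow> real" where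
  "graph_W f p = sqrt (1 + (partial_u f p)\<^sup>2 + (partial_v f p)\<^sup>2)"

definition gauss_curvature :: "(real \<times> real \<Rightarrow> real) \<Rightarrow> real \<times> real \<Rightarrow> real" where
  "gauss_curvature f p =
     (partial_uu f p * partial_vv f p - (partial_uv f p)\<^sup>2) / graph_W f p ^ 4"

text \<open>The supremum is taken in the extended reals, where it always exists; its finiteness is not
  built into the definition.\<close>

definition hopf_constant :: ereal where
  "hopf_constant =
     (SUP f \<in> {f. minimal_graph_over unit_disk f}.
        ereal ((graph_W f (0, 0))\<^sup>2 * \<bar>gauss_curvature f (0, 0)\<bar>))"

end

theory Submission
  imports Defs "HOL-Complex_Analysis.Complex_Analysis"
begin

text \<open>A minimal graph over a disk has isothermal coordinates in which its projection is a harmonic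
  homeomorphism \<open>F = h + cnj g\<close> of the unit disk onto that disk, with \<open>g' = Q\<^sup>2 h'\<close> and \<open>|Q| < 1\<close>;
  one may take \<open>F 0 = 0\<close>. With \<open>p = |h'(0)|\<close> and \<open>y = |Q(0)|\<^sup>2\<close> the quantity \<open>W\<^sup>2|K|\<close> at the
  centre is \<open>4|Q'(0)|\<^sup>2 / (p\<^sup>2 (1 - y\<^sup>2)\<^sup>2)\<close>, which by Schwarz--Pick is at most \<open>4 / (p\<^sup>2 (1 + y)\<^sup>2)\<close>.

  To bound \<open>p\<close> from below, let \<open>e n\<close> be the squared moduli of the Fourier coefficients of the
  boundary values \<open>r exp (i\<theta>)\<close> of \<open>F\<close>, where \<open>\<theta>\<close> is monotone. If \<open>a (1 - cos D) + b sin D \<le> D\<close> for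
  all \<open>D \<ge> 0\<close>, then averaging with \<open>D = \<theta> (t + x) - \<theta> t\<close> over \<open>t\<close> gives
  \<open>(\<Sum>n. e n * (a (1 - cos n x) + b sin n x)) \<le> r\<^sup>2 x\<close>. Integrated against \<open>sin 2x\<close> over
  \<open>[0, \<pi>/2]\<close> this leaves an inequality between \<open>e 1\<close>, \<open>e (-1)\<close>, \<open>e 2\<close> and \<open>e (-2)\<close> only. Since
  \<open>g' = Q\<^sup>2 h'\<close> controls \<open>e (-1)\<close> and \<open>e (-2)\<close> by \<open>e 1\<close> and \<open>e 2\<close>, the choices
  \<open>(a, b) = (1, \<pi>/2 - 1)\<close> and \<open>(5/4, 0)\<close> give \<open>p\<^sup>2 (1 + y)\<^sup>2 \<ge> 0.73 r\<^sup>2\<close>, hence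
  \<open>W\<^sup>2|K| \<le> 400/73 < 5.48\<close>.\<close>

section \<open>A spectral inequality\<close>

text \<open>The weight sin 2x is nonnegative on [0, pi/2], and against it every frequency |n| \<ge>
  3 receives at least the mean weight; such terms can be discarded with the right sign. Two pairs
  (a, b) are needed because b > 0 lowers the coefficient of \<open>e 1\<close> but raises that of
  \<open>e (-1)\<close>, which is y^2 times as large as \<open>e 1\<close>. The first pair is good
  for y \<le> 1/2, the second for larger y; with these estimates each falls short of 0.73 at the
  other end. The constant 0.73 is a rounding of 2146/2939 from the first range. The main obstacle is
  the boundary: \<open>F\<close> is a homeomorphism of open disks with no continuous extension at
  hand. Its boundary values are radial limits, which exist almost everywhere because
  \<open>h\<close> is univalent with an image of finite area. That \<open>\<theta>\<close> is
  monotone is then pure topology of the lifted map. To have a bounded image, the graph is first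
  restricted to a disk of radius r < 1, and r tends to 1 at the end.\<close>

lemma one_minus_cos_plus_sin_le:
  fixes D :: real
  assumes "0 \<le> D"
  shows "1 - cos D + (pi / 2 - 1) * sin D \<le> D"
proof -
  define b where "b = pi / 2 - 1"
  define g where "g = (\<lambda>D::real. D - (1 - cos D) - b * sin D)"
  define g' where "g' = (\<lambda>D::real. 1 - sin D - b * cos D)"
  have b: "0 < b" "b < 1"
    using pi_gt3 pi_less_4 by (auto simp: b_def)
  have der: "(g has_real_derivative g' x) (at x)" for x
    unfolding g_def g'_def by (auto intro!: derivative_eq_intros)
  \<comment> \<open>The value of \<open>b\<close> is the one that gives \<open>g\<close> a second
    zero at pi/2.\<close>
  have g0: "g 0 = 0" and g1: "g (pi/2) = 0"
    by (auto simp: g_def b_def)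
  define k where "k = (\<lambda>x::real. cos x - b * (1 + sin x))"
  have kder: "(k has_real_derivative (- sin x - b * cos x)) (at x)" for x
    unfolding k_def by (auto intro!: derivative_eq_intros)
  \<comment> \<open>Apart from cos, the sign of \<open>g'\<close> on [0, pi/2] is that of the
    decreasing function \<open>k\<close>. So \<open>g\<close> rises and then falls, and its minimum
    is at an endpoint, where it vanishes.\<close>
  have fac: "(1 + sin x) * g' x = cos x * k x" for x
    unfolding g'_def k_def using sin_cos_squared_add[of x]
    by (simp add: algebra_simps power2_eq_square) 
  have kmono: "k y \<le> k x" if "0 \<le> x" "x \<le> y" "y \<le> pi/2" for x y
  proof (rule DERIV_nonpos_imp_nonincreasing[OF that(2)])
    fix u assume "x \<le> u" "u \<le> y"
    then have "0 \<le> sin u" "0 \<le> cos u"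
      using that pi_gt_zero by (auto intro!: sin_ge_zero cos_ge_zero)
    then show "\<exists>z. DERIV k u :> z \<and> z \<le> 0"
      using kder[of u] b mult_nonneg_nonneg[of b "cos u"]
      by (intro exI[of _ "- sin u - b * cos u"] conjI) linarith+
  qed
  have gpos: "0 \<le> g x" if x: "0 \<le> x" "x \<le> pi/2" for x
  proof (cases "0 \<le> k x")
    case True
    have "g 0 \<le> g x"
    proof (rule DERIV_nonneg_imp_nondecreasing[OF x(1)])
      fix u assume u: "0 \<le> u" "u \<le> x"
      have "0 \<le> sin u" "0 \<le> cos u" using u x by (auto intro!: sin_ge_zero cos_ge_zero)
      moreover have "0 \<le> k u" using kmono[of u x] u x True by auto
      ultimately have "0 \<le> (1 + sin u) * g' u" by (simp add: fac)
      then have "0 \<le> g' u" using \<open>0 \<le> sin u\<close> by (simp add: zero_le_mult_iff)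
      then show "\<exists>z. DERIV g u :> z \<and> z \<ge> 0" using der by blast
    qed
    then show ?thesis by (simp add: g0)
  next
    case False
    have "g (pi/2) \<le> g x"
    proof (rule DERIV_nonpos_imp_nonincreasing[OF x(2)])
      fix u assume u: "x \<le> u" "u \<le> pi/2"
      have "0 \<le> sin u" "0 \<le> cos u" using u x by (auto intro!: sin_ge_zero cos_ge_zero)
      moreover have "k u \<le> 0" using kmono[of x u] u x False by auto
      ultimately have "(1 + sin u) * g' u \<le> 0" by (simp add: fac mult_nonneg_nonpos)
      then have "g' u \<le> 0" using \<open>0 \<le> sin u\<close> by (simp add: mult_le_0_iff)
      then show "\<exists>z. DERIV g u :> z \<and> z \<le> 0" using der by blast
    qed
    then show ?thesis by (simp add: g1)
  qed
  \<comment> \<open>Between pi/2 and pi the cosine is nonpositive, so \<open>g\<close> increases;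
    beyond pi the left side is at most 2 + b < 3.\<close>
  consider "D \<le> pi/2" | "pi/2 \<le> D" "D \<le> pi" | "pi \<le> D" by linarith
  then have "0 \<le> g D"
  proof cases
    case 1
    then show ?thesis using gpos assms by auto
  next
    case 2
    have "g (pi/2) \<le> g D"
    proof (rule DERIV_nonneg_imp_nondecreasing[OF 2(1)])
      fix u assume u: "pi/2 \<le> u" "u \<le> D"
      have "cos u \<le> 0"
        using u 2 cos_monotone_0_pi_le[of "pi/2" u] by auto
      then have "0 \<le> g' u"
        using sin_le_one[of u] b mult_nonneg_nonpos[of b "cos u"] unfolding g'_def by linarith
      then show "\<exists>z. DERIV g u :> z \<and> z \<ge> 0" using der by blast
    qed
    then show ?thesis by (simp add: g1)
  next
    case 3
    have "b * sin D \<le> b * 1" using b by (intro mult_left_mono) auto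
    then show ?thesis using 3 b cos_ge_minus_one[of D] pi_gt3 unfolding g_def by linarith
  qed
  then show ?thesis by (simp add: g_def b_def)
qed

text \<open>Three bounds on 1 - cos D share the half-line: D^2/2, the tangent at pi/2, and 2. The
  cuts 8/5 and 5/2 are where the first and the last meet 4/5 * D.\<close>

lemma one_minus_cos_le:
  fixes D :: real
  assumes "0 \<le> D"
  shows "5 / 4 * (1 - cos D) \<le> D"
proof -
  have 1: "1 - cos D \<le> D^2/2"
  proof -
    have "(sin (D/2))\<^sup>2 \<le> (D/2)\<^sup>2"
      using abs_sin_x_le_abs_x[of "D/2"] by (metis abs_le_square_iff)
    moreover have "cos D = 1 - 2 * (sin (D/2))\<^sup>2" using cos_double_sin[of "D/2"] by simp
    ultimately show ?thesis by (simp add: power2_eq_square)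
  qed
  have two: "1 - cos D \<le> 1 + D - pi/2" if "pi/2 \<le> D"
    using sin_x_le_x[of "D - pi/2"] that by (simp add: sin_diff)
  consider "D \<le> 8/5" | "8/5 \<le> D" "D \<le> 5/2" | "5/2 \<le> D" by linarith
  then show ?thesis
  proof cases
    case 1
    then have "D * D \<le> D * (8/5)" using assms by (intro mult_left_mono) auto
    then show ?thesis using \<open>1 - cos D \<le> D^2/2\<close> by (simp add: power2_eq_square)
  next
    case 2
    have "pi/2 \<le> 8/5" "314/100 < pi" using pi_approx by simp_all
    then have "pi/2 \<le> D" using 2 by linarith
    then have "1 - cos D \<le> 1 + D - pi/2" by (rule two)
    also have "\<dots> \<le> 4/5 * D" using 2 \<open>314/100 < pi\<close> by linarith
    finally show ?thesis by (simp add: field_simps)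
  next
    case 3
    have "1 - cos D \<le> 2" using cos_ge_minus_one[of D] by simp
    also have "2 \<le> 4/5 * D" using 3 by simp
    finally show ?thesis by (simp add: field_simps)
  qed
qed

section \<open>Integrals against sin 2x on [0, pi/2]\<close>

lemma has_integral_FTC_real:
  fixes f :: "real \<Rightarrow> real"
  assumes "a \<le> b" "\<And>x. (f has_real_derivative f' x) (at x)"
  shows "(f' has_integral f b - f a) {a..b}"
  using assms
  by (intro fundamental_theorem_of_calculus)
     (auto simp: has_real_derivative_iff_has_vector_derivative intro: has_vector_derivative_at_within)

lemma sin2_integrals:
  "((\<lambda>x::real. sin (2*x)) has_integral 1) {0..pi/2}"
  "((\<lambda>x::real. sin (2*x) * x) has_integral pi/4) {0..pi/2}"
  "((\<lambda>x::real. sin (2*x) * cos (2*x)) has_integral 0) {0..pi/2}"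
  "((\<lambda>x::real. sin (2*x) * sin (2*x)) has_integral pi/4) {0..pi/2}"
proof -
  have e: "cos (2*(pi/2)) = (-1::real)" "sin (2*(pi/2)) = (0::real)" "0 \<le> pi/2" by simp_all
  have d1: "((\<lambda>x. - cos (2*x) / 2) has_real_derivative sin (2*x)) (at x)" for x :: real
    by (auto intro!: derivative_eq_intros)
  have d2: "((\<lambda>x. sin (2*x)/4 - x * cos (2*x) / 2) has_real_derivative sin (2*x) * x) (at x)" for x :: real
    by (auto intro!: derivative_eq_intros simp: field_simps)
  have d3: "((\<lambda>x. sin (2*x) ^ 2 / 4) has_real_derivative sin (2*x) * cos (2*x)) (at x)" for x :: real
    by (auto intro!: derivative_eq_intros simp: field_simps)
  have d4: "((\<lambda>x. x/2 - sin (2*x) * cos (2*x)/4) has_real_derivative sin (2*x) * sin (2*x)) (at x)" for x :: real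
  proof -
    have "cos (2*x) * cos (2*x) = 1 - sin (2*x) * sin (2*x)"
      using sin_cos_squared_add[of "2*x"] by (simp add: power2_eq_square)
    then show ?thesis
      by (auto intro!: derivative_eq_intros simp: algebra_simps diff_divide_distrib add_divide_distrib)
        (simp add: \<open>cos (2*x) * cos (2*x) = _\<close>[unfolded mult.commute[of 2 x]] field_simps)
  qed
  show "((\<lambda>x::real. sin (2*x)) has_integral 1) {0..pi/2}"
    using has_integral_FTC_real[OF e(3) d1] by (simp add: e)
  show "((\<lambda>x::real. sin (2*x) * x) has_integral pi/4) {0..pi/2}"
    using has_integral_FTC_real[OF e(3) d2] by (simp add: e)
  show "((\<lambda>x::real. sin (2*x) * cos (2*x)) has_integral 0) {0..pi/2}"
    using has_integral_FTC_real[OF e(3) d3] by (simp add: e)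
  show "((\<lambda>x::real. sin (2*x) * sin (2*x)) has_integral pi/4) {0..pi/2}"
    using has_integral_FTC_real[OF e(3) d4] by (simp add: e)
qed

lemma sin2_cos_sin_integrals:
  fixes n :: real
  assumes "n\<^sup>2 \<noteq> 4"
  shows "((\<lambda>x. sin (2*x) * cos (n*x)) has_integral 2 * (1 + cos (n*pi/2)) / (4 - n\<^sup>2)) {0..pi/2}"
    and "((\<lambda>x. sin (2*x) * sin (n*x)) has_integral 2 * sin (n*pi/2) / (4 - n\<^sup>2)) {0..pi/2}"
proof -
  have e: "cos (2*(pi/2)) = (-1::real)" "sin (2*(pi/2)) = (0::real)" "0 \<le> pi/2" by simp_all
  have nz: "n\<^sup>2 - 4 \<noteq> 0" using assms by simp
  have d1: "((\<lambda>x. (n * sin (2*x) * sin (n*x) + 2 * cos (2*x) * cos (n*x)) / (n\<^sup>2 - 4)) has_real_derivative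
      sin (2*x) * cos (n*x)) (at x)" for x
  proof -
    have "((\<lambda>x. n * sin (2*x) * sin (n*x) + 2 * cos (2*x) * cos (n*x)) has_real_derivative
      sin (2*x) * cos (n*x) * (n\<^sup>2 - 4)) (at x)"
      by (auto intro!: derivative_eq_intros simp: algebra_simps power2_eq_square)
    from DERIV_cdivide[OF this, of "n\<^sup>2 - 4"] show ?thesis using nz by simp
  qed
  have d2: "((\<lambda>x. (2 * cos (2*x) * sin (n*x) - n * sin (2*x) * cos (n*x)) / (n\<^sup>2 - 4)) has_real_derivative
      sin (2*x) * sin (n*x)) (at x)" for x
  proof -
    have "((\<lambda>x. 2 * cos (2*x) * sin (n*x) - n * sin (2*x) * cos (n*x)) has_real_derivative
      sin (2*x) * sin (n*x) * (n\<^sup>2 - 4)) (at x)"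
      by (auto intro!: derivative_eq_intros simp: algebra_simps power2_eq_square)
    from DERIV_cdivide[OF this, of "n\<^sup>2 - 4"] show ?thesis using nz by simp
  qed
  have flip: "c / (4 - n\<^sup>2) = - c / (n\<^sup>2 - 4)" for c
    using minus_divide_divide[of c "4 - n\<^sup>2"] by simp
  show "((\<lambda>x. sin (2*x) * cos (n*x)) has_integral 2 * (1 + cos (n*pi/2)) / (4 - n\<^sup>2)) {0..pi/2}"
    using has_integral_FTC_real[OF e(3) d1]
    by (rule has_integral_eq_rhs) (simp add: e flip diff_divide_distrib add_divide_distrib)
  show "((\<lambda>x. sin (2*x) * sin (n*x)) has_integral 2 * sin (n*pi/2) / (4 - n\<^sup>2)) {0..pi/2}"
    using has_integral_FTC_real[OF e(3) d2]
    by (rule has_integral_eq_rhs) (simp add: e flip)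
qed

text \<open>Replacing sin by 1 + sin makes the integrand nonnegative for nonnegative
  \<open>a\<close> and \<open>b\<close>, so that truncating a sum over n can only decrease it. The
  mass added in this way is removed again by Parseval.\<close>

definition spectral_weight :: "real \<Rightarrow> real \<Rightarrow> int \<Rightarrow> real" where
  "spectral_weight a b n =
     integral {0..pi/2} (\<lambda>x. sin (2*x) * (a * (1 - cos (n*x)) + b * (1 + sin (n*x))))"

lemma spectral_weight_eq:
  assumes "n \<noteq> 2" "n \<noteq> -2"
  shows "spectral_weight a b n =
    a + b - 2 * (a * (1 + cos (n*pi/2)) - b * sin (n*pi/2)) / (4 - (real_of_int n)\<^sup>2)"
proof -
  have n4: "(real_of_int n)\<^sup>2 \<noteq> 4"
  proof
    assume "(real_of_int n)\<^sup>2 = 4"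
    then have "real_of_int (n\<^sup>2) = real_of_int (2\<^sup>2)" by simp
    then have "n\<^sup>2 = 2\<^sup>2" by (simp only: of_int_eq_iff)
    then show False using assms power2_eq_iff[of n 2] by auto
  qed
  have "((\<lambda>x. a * (sin (2*x)) - a * (sin (2*x) * cos (n*x)) + (b * sin (2*x) + b * (sin (2*x) * sin (n*x))))
     has_integral (a * 1 - a * (2 * (1 + cos (n*pi/2)) / (4 - (real_of_int n)\<^sup>2)) + (b * 1 + b * (2 * sin (n*pi/2) / (4 - (real_of_int n)\<^sup>2))))) {0..pi/2}"
    by (intro has_integral_add has_integral_diff has_integral_mult_right sin2_integrals sin2_cos_sin_integrals n4)
  then have "((\<lambda>x. sin (2*x) * (a * (1 - cos (n*x)) + b * (1 + sin (n*x)))) has_integral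
     (a * 1 - a * (2 * (1 + cos (n*pi/2)) / (4 - (real_of_int n)\<^sup>2)) + (b * 1 + b * (2 * sin (n*pi/2) / (4 - (real_of_int n)\<^sup>2))))) {0..pi/2}"
    by (simp add: algebra_simps)
  then have "spectral_weight a b n = (a * 1 - a * (2 * (1 + cos (n*pi/2)) / (4 - (real_of_int n)\<^sup>2)) + (b * 1 + b * (2 * sin (n*pi/2) / (4 - (real_of_int n)\<^sup>2))))"
    unfolding spectral_weight_def by (rule integral_unique)
  also have "\<dots> = a + b - 2 * (a * (1 + cos (n*pi/2)) - b * sin (n*pi/2)) / (4 - (real_of_int n)\<^sup>2)"
    by (simp add: algebra_simps diff_divide_distrib add_divide_distrib)
  finally show ?thesis .
qed

lemma spectral_weight_two:
  "spectral_weight a b 2 = a + b + b * pi / 4" "spectral_weight a b (-2) = a + b - b * pi / 4"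
proof -
  have "((\<lambda>x. a * (sin (2*x)) - a * (sin (2*x) * cos (2*x)) + (b * sin (2*x) + b * (sin (2*x) * sin (2*x))))
     has_integral (a * 1 - a * 0 + (b * 1 + b * (pi/4)))) {0..pi/2}"
    by (intro has_integral_add has_integral_diff has_integral_mult_right sin2_integrals)
  then have "((\<lambda>x. sin (2*x) * (a * (1 - cos (real_of_int 2*x)) + b * (1 + sin (real_of_int 2*x))))
     has_integral (a * 1 - a * 0 + (b * 1 + b * (pi/4)))) {0..pi/2}"
    by (simp add: algebra_simps)
  from integral_unique[OF this] show "spectral_weight a b 2 = a + b + b * pi / 4"
    by (simp add: spectral_weight_def)
  have "((\<lambda>x. a * (sin (2*x)) - a * (sin (2*x) * cos (2*x)) + (b * sin (2*x) - b * (sin (2*x) * sin (2*x))))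
     has_integral (a * 1 - a * 0 + (b * 1 - b * (pi/4)))) {0..pi/2}"
    by (intro has_integral_add has_integral_diff has_integral_mult_right sin2_integrals)
  then have "((\<lambda>x. sin (2*x) * (a * (1 - cos (real_of_int (-2)*x)) + b * (1 + sin (real_of_int (-2)*x))))
     has_integral (a * 1 - a * 0 + (b * 1 - b * (pi/4)))) {0..pi/2}"
    by (simp add: algebra_simps)
  from integral_unique[OF this] show "spectral_weight a b (-2) = a + b - b * pi / 4"
    by (simp add: spectral_weight_def)
qed

lemma spectral_weight_one:
  "spectral_weight a b 1 = a + b - 2/3 * (a - b)" "spectral_weight a b (-1) = a + b - 2/3 * (a + b)"
  by (simp_all add: spectral_weight_eq field_simps)

text \<open>Here 4 - n^2 < 0, so only the sign of the numerator matters. For even n the sine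
  vanishes; for odd n the cosine does, and a - b sin is nonnegative because b \<le> a.\<close>

lemma spectral_weight_ge:
  assumes ab: "0 \<le> b" "b \<le> a" and n: "\<bar>n\<bar> \<ge> 3"
  shows "a + b \<le> spectral_weight a b n"
proof -
  have nn: "n \<noteq> 2" "n \<noteq> -2" using n by auto
  have "3^2 \<le> \<bar>n\<bar>^2" using n by (intro power_mono) auto
  then have "9 \<le> n\<^sup>2" by simp
  then have "9 \<le> (real_of_int n)\<^sup>2" by (metis of_int_le_iff of_int_numeral of_int_power)
  then have neg: "4 - (real_of_int n)\<^sup>2 < 0" by simp
  have "0 \<le> a * (1 + cos (n*pi/2)) - b * sin (n*pi/2)"
  proof (cases "even n")
    case True
    then obtain m where "n = 2 * m" by blast
    then have "sin (n*pi/2) = 0"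
      using sin_zero_iff_int2[of "n*pi/2"] by auto
    moreover have "0 \<le> a * (1 + cos (n*pi/2))"
      using ab cos_ge_minus_one[of "n*pi/2"] by (intro mult_nonneg_nonneg) linarith+
    ultimately show ?thesis by simp
  next
    case False
    then have "cos (n*pi/2) = 0"
      using cos_zero_iff_int[of "n*pi/2"] by auto
    moreover have "b * sin (n*pi/2) \<le> b * 1" using ab by (intro mult_left_mono) auto
    ultimately show ?thesis using ab by simp
  qed
  then have "2 * (a * (1 + cos (n*pi/2)) - b * sin (n*pi/2)) / (4 - (real_of_int n)\<^sup>2) \<le> 0"
    using neg by (simp add: divide_nonneg_neg)
  then show ?thesis by (simp add: spectral_weight_eq[OF nn])
qed

text \<open>After integration of \<open>test\<close>, all weights are compared with
  \<open>a + b\<close>. Frequency 0 carries no mass, |n| \<ge> 3 only helps, and the four deviations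
  at n = 1, -1, 2, -2 make up the right side. The term pi/4 is the integral of x sin 2x.\<close>

lemma spectral_inequality:
  fixes e :: "int \<Rightarrow> real"
  assumes e: "\<And>n. 0 \<le> e n" "e 0 = 0" and ab: "0 \<le> b" "b \<le> a"
    and test: "\<And>(K::nat) (x::real). 0 \<le> x \<Longrightarrow> x \<le> pi/2 \<Longrightarrow>
      (\<Sum>n\<in>{-int K..int K}. e n * (a * (1 - cos (n*x)) + b * (1 + sin (n*x)))) \<le> R * x + b * R"
    and total: "(\<lambda>K. \<Sum>n\<in>{-int K..int K}. e n) \<longlonglongrightarrow> R"
  shows "R * (a - pi/4) \<le> 2/3 * (a - b) * e 1 + 2/3 * (a + b) * e (-1) + b * pi/4 * (e (-2) - e 2)"
    (is "_ \<le> ?rhs")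
proof -
  have bd: "(\<Sum>n\<in>{-int K..int K}. e n * spectral_weight a b n) \<le> R * (pi/4) + b * R" for K
  proof -
    have i1: "((\<lambda>x. \<Sum>n\<in>{-int K..int K}. e n * (sin (2*x) * (a * (1 - cos (n*x)) + b * (1 + sin (n*x)))))
       has_integral (\<Sum>n\<in>{-int K..int K}. e n * spectral_weight a b n)) {0..pi/2}"
      unfolding spectral_weight_def
      by (intro has_integral_sum has_integral_mult_right integrable_integral integrable_continuous_real
          continuous_intros) auto
    have i2: "((\<lambda>x. R * (sin (2*x) * x) + b * R * sin (2*x)) has_integral (R * (pi/4) + b * R * 1)) {0..pi/2}"
      by (intro has_integral_add has_integral_mult_right sin2_integrals)
    have "(\<Sum>n\<in>{-int K..int K}. e n * spectral_weight a b n) \<le> R * (pi/4) + b * R * 1"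
    proof (rule has_integral_le[OF i1 i2])
      fix x :: real assume x: "x \<in> {0..pi/2}"
      then have s: "0 \<le> sin (2*x)" by (intro sin_ge_zero) auto
      have t: "(\<Sum>n\<in>{-int K..int K}. e n * (a * (1 - cos (n*x)) + b * (1 + sin (n*x)))) \<le> R * x + b * R"
        using test[of x K] x by auto
      have "(\<Sum>n\<in>{-int K..int K}. e n * (sin (2*x) * (a * (1 - cos (n*x)) + b * (1 + sin (n*x)))))
         = sin (2*x) * (\<Sum>n\<in>{-int K..int K}. e n * (a * (1 - cos (n*x)) + b * (1 + sin (n*x))))"
        by (simp add: sum_distrib_left mult_ac)
      also have "\<dots> \<le> sin (2*x) * (R * x + b * R)"
        by (rule mult_left_mono[OF t s])
      finally show "(\<Sum>n\<in>{-int K..int K}. e n * (sin (2*x) * (a * (1 - cos (n*x)) + b * (1 + sin (n*x)))))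
         \<le> R * (sin (2*x) * x) + b * R * sin (2*x)" by (simp add: algebra_simps)
    qed
    then show ?thesis by simp
  qed
  have step: "(a + b) * (\<Sum>n\<in>{-int K..int K}. e n) - ?rhs \<le> R * (pi/4) + b * R" if K: "K \<ge> 2" for K
  proof -
    define A where "A = {-2,-1,1,2::int}"
    define S where "S = {-int K..int K}"
    have AS: "A \<subseteq> S" "finite S" using K by (auto simp: A_def S_def)
    have "(\<Sum>n\<in>S. (a + b - spectral_weight a b n) * e n) \<le> (\<Sum>n\<in>A. (a + b - spectral_weight a b n) * e n)"
    proof -
      have "(\<Sum>n\<in>S. (a + b - spectral_weight a b n) * e n) = (\<Sum>n\<in>S - A. (a + b - spectral_weight a b n) * e n)
         + (\<Sum>n\<in>A. (a + b - spectral_weight a b n) * e n)"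
        using AS by (metis sum.subset_diff)
      moreover have "(\<Sum>n\<in>S - A. (a + b - spectral_weight a b n) * e n) \<le> 0"
      proof (rule sum_nonpos)
        fix n assume "n \<in> S - A"
        then have "n = 0 \<or> \<bar>n\<bar> \<ge> 3" by (auto simp: A_def)
        then show "(a + b - spectral_weight a b n) * e n \<le> 0"
          using e spectral_weight_ge[OF ab, of n] by (elim disjE) (auto intro!: mult_nonpos_nonneg)
      qed
      ultimately show ?thesis by simp
    qed
    also have "(\<Sum>n\<in>A. (a + b - spectral_weight a b n) * e n) = ?rhs"
      unfolding A_def by (simp add: spectral_weight_one spectral_weight_two algebra_simps)
    finally have "(a + b) * (\<Sum>n\<in>S. e n) - (\<Sum>n\<in>S. e n * spectral_weight a b n) \<le> ?rhs"
      by (simp add: sum_distrib_left sum_subtractf algebra_simps)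
    then show ?thesis using bd[of K] by (simp add: S_def)
  qed
  have "(a + b) * R - ?rhs \<le> R * (pi/4) + b * R"
  proof (rule LIMSEQ_le_const2)
    show "(\<lambda>K. (a + b) * (\<Sum>n\<in>{-int K..int K}. e n) - ?rhs) \<longlonglongrightarrow> (a + b) * R - ?rhs"
      by (intro tendsto_intros total)
    show "\<exists>N. \<forall>n\<ge>N. (a + b) * (\<Sum>n\<in>{-int n..int n}. e n) - ?rhs \<le> R * (pi/4) + b * R"
      using step by blast
  qed
  then show ?thesis by (simp add: algebra_simps)
qed

text \<open>This eliminates the unknown second coefficients. With y = s^2 and m = s (1 - y) p, the
  expression (y u + m)^2 - u^2 is a concave parabola in u with maximum m^2 / (1 - y^2).\<close>

lemma difference_of_squares_le:
  fixes u v s p :: real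
  assumes "0 \<le> s" "s < 1" "0 \<le> p" "0 \<le> u" "0 \<le> v" "v \<le> s\<^sup>2 * u + s * (1 - s\<^sup>2) * p"
  shows "v\<^sup>2 - u\<^sup>2 \<le> s\<^sup>2 * (1 - s\<^sup>2) * p\<^sup>2"
proof -
  have s1: "s\<^sup>2 < 1" using assms by (simp add: abs_square_less_1)
  define y where "y = s\<^sup>2"
  define m where "m = s * (1 - y) * p"
  have y: "0 \<le> y" "y < 1" using s1 by (auto simp: y_def)
  have "v\<^sup>2 \<le> (y * u + m)\<^sup>2"
    using assms by (intro power_mono) (auto simp: y_def m_def)
  moreover have "(1 - y\<^sup>2) * ((y * u + m)\<^sup>2 - u\<^sup>2) \<le> m\<^sup>2"
  proof -
    have "m\<^sup>2 - (1 - y\<^sup>2) * ((y * u + m)\<^sup>2 - u\<^sup>2) = (y * m - (1 - y\<^sup>2) * u)\<^sup>2"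
      by (simp add: power2_eq_square algebra_simps)
    then show ?thesis by (metis diff_ge_0_iff_ge zero_le_power2)
  qed
  moreover have pos: "0 < 1 - y\<^sup>2" using y by (simp add: abs_square_less_1)
  ultimately have "v\<^sup>2 - u\<^sup>2 \<le> m\<^sup>2 / (1 - y\<^sup>2)"
    by (smt (verit, best) pos_le_divide_eq mult.commute)
  also have "m\<^sup>2 = (1 - y\<^sup>2) * (y * (1 - y) * p\<^sup>2 / (1 + y))"
  proof -
    have "(1 - y\<^sup>2) / (1 + y) = 1 - y"
      using y by (simp add: field_simps power2_eq_square)
    moreover have "m\<^sup>2 = y * (1 - y) * (1 - y) * p\<^sup>2"
      by (simp add: m_def power_mult_distrib y_def[symmetric]) (simp add: power2_eq_square)
    ultimately show ?thesis by (metis (no_types, lifting) mult.assoc mult.commute times_divide_eq_right)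
  qed
  also have "\<dots> / (1 - y\<^sup>2) = y * (1 - y) * p\<^sup>2 / (1 + y)"
    using pos by simp
  \<comment> \<open>Giving up the factor 1 / (1 + y) keeps the final estimate polynomial in
    y.\<close>
  also have "\<dots> \<le> y * (1 - y) * p\<^sup>2 / 1"
    using y by (intro divide_left_mono mult_nonneg_nonneg) auto
  finally show ?thesis by (simp add: y_def)
qed

text \<open>In the application \<open>p\<close> and \<open>s\<close> are |h'(0)| and |Q(0)|,
  \<open>u\<close> and \<open>v\<close> are the moduli of the second Taylor coefficients of h and g,
  and \<open>R\<close> is r^2.\<close>

lemma coefficient_bound:
  fixes p s u v :: real
  assumes s: "0 \<le> s" "s < 1" and p: "0 \<le> p" and uv: "0 \<le> u" "0 \<le> v"
    and v: "v \<le> s\<^sup>2 * u + s * (1 - s\<^sup>2) * p"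
    and main: "\<And>a b. 0 \<le> b \<Longrightarrow> b \<le> a \<Longrightarrow> (\<And>D. 0 \<le> D \<Longrightarrow> a * (1 - cos D) + b * sin D \<le> D) \<Longrightarrow>
      R * (a - pi/4) \<le> 2/3 * (a - b) * p\<^sup>2 + 2/3 * (a + b) * (s\<^sup>2 * p)\<^sup>2 + b * pi/4 * (v\<^sup>2 - u\<^sup>2)"
    and R: "0 \<le> R"
  shows "73/100 * R \<le> p\<^sup>2 * (1 + s\<^sup>2)\<^sup>2"
proof -
  define y where "y = s\<^sup>2"
  define P where "P = p\<^sup>2"
  have y: "0 \<le> y" "y < 1" using s by (auto simp: y_def abs_square_less_1)
  have P: "0 \<le> P" by (simp add: P_def)
  have pi: "31415/10000 < pi" "pi < 31416/10000" using pi_approx by simp_all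
  have yy: "(s\<^sup>2 * p)\<^sup>2 = y\<^sup>2 * P" by (simp add: y_def P_def power_mult_distrib)
  show ?thesis
  proof (cases "y \<le> 1/2")
    case True
    define b where "b = pi/2 - 1"
    have b: "57075/100000 < b" "b < 5708/10000" using pi by (auto simp: b_def)
    have "R * (1 - pi/4) \<le> 2/3 * (1 - b) * P + 2/3 * (1 + b) * (y\<^sup>2 * P) + b * pi/4 * (v\<^sup>2 - u\<^sup>2)"
      using main[of b 1] one_minus_cos_plus_sin_le b unfolding yy P_def by (simp add: b_def)
    also have "\<dots> \<le> 2/3 * (1 - b) * P + 2/3 * (1 + b) * (y\<^sup>2 * P) + b * pi/4 * (y * (1 - y) * P)"
      using difference_of_squares_le[OF s p uv v] b pi
      by (intro add_left_mono mult_left_mono) (auto simp: y_def P_def)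
    also have "\<dots> = P * (2/3 * (1 - b) + 2/3 * (1 + b) * y\<^sup>2 + b * pi/4 * (y * (1 - y)))"
      by (simp only: distrib_left distrib_right mult.assoc mult.commute mult.left_commute)
    also have "\<dots> \<le> P * (28617/100000 + 10472/10000 * y\<^sup>2 + 44833/100000 * (y * (1 - y)))"
    proof (intro mult_left_mono add_mono mult_right_mono P)
      have "b * pi \<le> 5708/10000 * (31416/10000)"
        using b pi by (intro mult_mono) auto
      then show "b * pi / 4 \<le> 44833/100000" by linarith
    qed (use b y in auto)
    also have "\<dots> \<le> P * (2939/10000 * (1 + y)\<^sup>2)"
    proof (intro mult_left_mono P)
      have "0 \<le> y * (1/2 - y)" using True y by (intro mult_nonneg_nonneg) auto
      \<comment> \<open>The difference of the two quadratics below is convex in y, so the chord of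
        y^2 over [0, 1/2] reduces the claim to the endpoints. It is nearly sharp at y = 1/2, which
        fixes 2939/10000.\<close>
      then have "y\<^sup>2 \<le> y / 2" by (simp add: power2_eq_square algebra_simps)
      then show "28617/100000 + 10472/10000 * y\<^sup>2 + 44833/100000 * (y * (1 - y)) \<le> 2939/10000 * (1 + y)\<^sup>2"
        using y True unfolding power2_sum right_diff_distrib by (simp add: power2_eq_square)
    qed
    finally have 1: "R * (1 - pi/4) \<le> 2939/10000 * (P * (1 + y)\<^sup>2)" by simp
    have "R * (2146/10000) \<le> R * (1 - pi/4)" using pi R by (intro mult_left_mono) auto
    with 1 have "R * 2146/10000 \<le> 2939/10000 * (P * (1 + y)\<^sup>2)" by simp
    moreover have "0 \<le> P * (1 + y)\<^sup>2" using P by simp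
    ultimately show ?thesis using R unfolding P_def y_def by linarith
  next
    case False
    have "R * (5/4 - pi/4) \<le> 2/3 * (5/4) * P + 2/3 * (5/4) * (y\<^sup>2 * P)"
      using main[of 0 "5/4"] one_minus_cos_le unfolding yy P_def by simp
    also have "\<dots> = 5/6 * P * (1 + y\<^sup>2)" by (simp add: algebra_simps)
    also have "\<dots> \<le> 5/6 * P * (5/9 * (1 + y)\<^sup>2)"
    proof (intro mult_left_mono)
      \<comment> \<open>The factor 5/9 gives equality in 1 + y^2 \<le> 5/9 (1 + y)^2 at y = 1/2, the
        left end of this range.\<close>
      have "0 \<le> (2 - y) * (2 * y - 1)" using False y by (intro mult_nonneg_nonneg) auto
      then have "2 * y\<^sup>2 - 5 * y + 2 \<le> 0" by (simp add: power2_eq_square algebra_simps)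
      moreover have "(1 + y)\<^sup>2 = 1 + 2 * y + y\<^sup>2" by (simp add: power2_sum)
      ultimately show "1 + y\<^sup>2 \<le> 5/9 * (1 + y)\<^sup>2" by simp
    qed (use P in auto)
    finally have 1: "R * (5/4 - pi/4) \<le> 25/54 * (P * (1 + y)\<^sup>2)" by simp
    have "R * (46/100) \<le> R * (5/4 - pi/4)" using pi R by (intro mult_left_mono) auto
    with 1 have "R * 46/100 \<le> 25/54 * (P * (1 + y)\<^sup>2)" by simp
    moreover have "0 \<le> P * (1 + y)\<^sup>2" using P by simp
    ultimately show ?thesis using R unfolding P_def y_def by linarith
  qed
qed

section \<open>Correlations of the boundary values\<close>

lemma sum_symmetric_int:
  fixes f :: "int \<Rightarrow> 'a::comm_monoid_add"
  shows "(\<Sum>n\<in>{-int K..int K}. f n) = f 0 + (\<Sum>n=1..K. f (int n) + f (- int n))"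
proof (induction K)
  case (Suc K)
  have "{-int (Suc K)..int (Suc K)} = insert (int (Suc K)) (insert (- int (Suc K)) {-int K..int K})"
    by auto
  then have "(\<Sum>n\<in>{-int (Suc K)..int (Suc K)}. f n)
     = f (int (Suc K)) + (f (- int (Suc K)) + (\<Sum>n\<in>{-int K..int K}. f n))"
    by (simp only:) (simp del: of_nat_Suc)
  also have "\<dots> = f 0 + ((\<Sum>n=1..K. f (int n) + f (- int n)) + (f (int (Suc K)) + f (- int (Suc K))))"
    by (simp add: Suc.IH add_ac del: of_nat_Suc)
  finally show ?case by (simp del: of_nat_Suc)
qed simp

lemma cis_diff_eq: "cis (a - b) = cis a * cnj (cis b)"
  by (simp add: cis_cnj cis_mult)

lemma integral_cis_int:
  fixes n :: int
  shows "((\<lambda>t. cis (n * t)) has_integral (if n = 0 then 2 * pi else 0)) {0..2*pi}"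
proof (cases "n = 0")
  case True
  then show ?thesis using has_integral_const_real[of "1::complex" 0 "2*pi"]
    by (simp add: scaleR_conv_of_real)
next
  case False
  have "((\<lambda>t. cis (n * t) / (\<i> * n)) has_vector_derivative cis (n * t)) (at t within {0..2*pi})" for t :: real
  proof -
    have "((\<lambda>z. exp (\<i> * n * z) / (\<i> * n)) has_field_derivative exp (\<i> * n * of_real t)) (at (of_real t))"
      using False by (auto intro!: derivative_eq_intros)
    from has_vector_derivative_real_field[OF this]
    show ?thesis by (simp add: cis_conv_exp mult_ac)
  qed
  then have "((\<lambda>t. cis (n * t)) has_integral (cis (n * (2*pi)) / (\<i> * n) - cis (n * (0::real)) / (\<i> * n))) {0..2*pi}"
    by (intro fundamental_theorem_of_calculus) auto
  moreover have "cis (n * (2*pi)) = 1"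
    using cis_multiple_2pi[of "of_int n"] by (simp add: mult_ac)
  ultimately show ?thesis using False by simp
qed

definition taylor_coeff :: "(complex \<Rightarrow> complex) \<Rightarrow> nat \<Rightarrow> complex" where
  "taylor_coeff h n = (deriv ^^ n) h 0 / fact n"

lemma holomorphic_uniform_sums:
  assumes h: "h holomorphic_on ball 0 1" and \<rho>: "0 \<le> \<rho>" "\<rho> < 1"
  shows "uniform_limit UNIV (\<lambda>K t. \<Sum>n\<le>K. taylor_coeff h n * (of_real \<rho> * cis t) ^ n)
           (\<lambda>t. h (of_real \<rho> * cis t)) sequentially"
proof -
  have sums: "(\<lambda>n. taylor_coeff h n * z ^ n) sums h z" if "norm z < 1" for z
    using holomorphic_power_series[OF h, of z] that by (simp add: taylor_coeff_def)
  obtain \<sigma> where \<sigma>: "\<rho> < \<sigma>" "\<sigma> < 1" using \<rho>(2) dense by blast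
  have "summable (\<lambda>n. norm (taylor_coeff h n * of_real \<rho> ^ n))"
    by (rule powser_insidea[OF sums_summable[OF sums, of "of_real \<sigma>"]]) (use \<rho> \<sigma> in auto)
  then have *: "summable (\<lambda>n. norm (taylor_coeff h n) * \<rho> ^ n)"
    using \<rho> by (simp add: norm_mult norm_power)
  have "uniform_limit UNIV (\<lambda>K t. \<Sum>n<K. taylor_coeff h n * (of_real \<rho> * cis t) ^ n)
           (\<lambda>t. \<Sum>n. taylor_coeff h n * (of_real \<rho> * cis t) ^ n) sequentially"
    by (rule Weierstrass_m_test[OF _ *]) (use \<rho> in \<open>auto simp: norm_mult norm_power\<close>)
  moreover have "(\<Sum>n. taylor_coeff h n * (of_real \<rho> * cis t) ^ n) = h (of_real \<rho> * cis t)" for t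
    using sums[of "of_real \<rho> * cis t"] \<rho> by (simp add: norm_mult sums_iff)
  ultimately have "uniform_limit UNIV (\<lambda>K t. \<Sum>n<K. taylor_coeff h n * (of_real \<rho> * cis t) ^ n)
           (\<lambda>t. h (of_real \<rho> * cis t)) sequentially" by simp
  then have "uniform_limit UNIV (\<lambda>K t. \<Sum>n<Suc K. taylor_coeff h n * (of_real \<rho> * cis t) ^ n)
           (\<lambda>t. h (of_real \<rho> * cis t)) sequentially"
    unfolding uniform_limit_iff eventually_sequentially by (meson le_Suc_eq)
  then show ?thesis by (simp add: lessThan_Suc_atMost)
qed

text \<open>These are the coefficients of \<open>h + cnj g\<close> on circles, with the power of the
  radius stripped off. The value 0 at n = 0 is the correct constant term because \<open>h\<close>
  and \<open>g\<close> are later normalised to vanish at 0.\<close>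

definition fourier_coeff :: "(complex \<Rightarrow> complex) \<Rightarrow> (complex \<Rightarrow> complex) \<Rightarrow> int \<Rightarrow> complex" where
  "fourier_coeff h g n = (if n > 0 then taylor_coeff h (nat n)
     else if n < 0 then cnj (taylor_coeff g (nat (-n))) else 0)"

lemma trig_sum_eq:
  fixes t :: real
  assumes "h 0 = 0" "g 0 = 0"
  shows "(\<Sum>n\<in>{-int K..int K}. fourier_coeff h g n * of_real \<rho> ^ nat \<bar>n\<bar> * cis (n * t))
    = (\<Sum>n\<le>K. taylor_coeff h n * (of_real \<rho> * cis t) ^ n) + cnj (\<Sum>n\<le>K. taylor_coeff g n * (of_real \<rho> * cis t) ^ n)"
proof -
  have z: "(\<Sum>n\<le>K. taylor_coeff f n * z ^ n) = (\<Sum>n=1..K. taylor_coeff f n * z ^ n)" if "f 0 = 0" for f z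
  proof -
    have "{..K} = insert 0 {1..K}" by auto
    then show ?thesis using that by (simp add: taylor_coeff_def)
  qed
  have "(\<Sum>n\<in>{-int K..int K}. fourier_coeff h g n * of_real \<rho> ^ nat \<bar>n\<bar> * cis (n * t))
    = (\<Sum>n=1..K. taylor_coeff h n * (of_real \<rho> * cis t) ^ n + cnj (taylor_coeff g n * (of_real \<rho> * cis t) ^ n))"
    unfolding sum_symmetric_int
    by (auto simp: fourier_coeff_def power_mult_distrib Complex.DeMoivre cis_cnj intro!: sum.cong)
  then show ?thesis by (simp add: z assms sum.distrib)
qed

definition circle_correlation :: "(complex \<Rightarrow> complex) \<Rightarrow> real \<Rightarrow> real \<Rightarrow> complex" where
  "circle_correlation F \<rho> x =
     integral {0..2*pi} (\<lambda>t. F (of_real \<rho> * cis (t + x)) * cnj (F (of_real \<rho> * cis t))) / (2 * pi)"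

text \<open>Orthogonality leaves the diagonal terms, and the shift by x turns into a phase. A
  correlation thus sees only the squared moduli of the coefficients.\<close>

lemma trig_correlation:
  fixes d :: "int \<Rightarrow> complex" and x :: real
  assumes "finite S"
  shows "integral {0..2*pi} (\<lambda>t. (\<Sum>n\<in>S. d n * cis (n * (t + x))) * cnj (\<Sum>n\<in>S. d n * cis (n * t)))
    = 2 * pi * (\<Sum>n\<in>S. of_real ((norm (d n))\<^sup>2) * cis (n * x))"
proof (rule integral_unique)
  have "((\<lambda>t. \<Sum>n\<in>S. \<Sum>m\<in>S. (d n * cnj (d m) * cis (n * x)) * cis (of_int (n - m) * t)) has_integral
     (\<Sum>n\<in>S. \<Sum>m\<in>S. (d n * cnj (d m) * cis (n * x)) * of_real (if n - m = 0 then 2 * pi else 0))) {0..2*pi}"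
    by (intro has_integral_sum assms has_integral_mult_right integral_cis_int)
  moreover have "(\<Sum>n\<in>S. \<Sum>m\<in>S. (d n * cnj (d m) * cis (n * x)) * of_real (if n - m = 0 then 2 * pi else 0))
     = 2 * pi * (\<Sum>n\<in>S. of_real ((norm (d n))\<^sup>2) * cis (n * x))"
  proof -
    have "(\<Sum>m\<in>S. (d n * cnj (d m) * cis (n * x)) * of_real (if n - m = 0 then 2 * pi else 0))
        = 2 * pi * (of_real ((norm (d n))\<^sup>2) * cis (n * x))" if "n \<in> S" for n
    proof -
      have "(\<Sum>m\<in>S. (d n * cnj (d m) * cis (n * x)) * of_real (if n - m = 0 then 2 * pi else 0))
        = (\<Sum>m\<in>S. if n = m then d n * cnj (d m) * cis (n * x) * (2 * pi) else 0)"
        by (intro sum.cong) auto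
      also have "\<dots> = d n * cnj (d n) * cis (n * x) * (2 * pi)" using that assms by simp
      also have "\<dots> = 2 * pi * (of_real ((norm (d n))\<^sup>2) * cis (n * x))"
        unfolding complex_norm_square by (simp only: mult_ac)
      finally show ?thesis .
    qed
    then show ?thesis by (simp add: sum_distrib_left)
  qed
  moreover have "\<And>t::real. (\<Sum>n\<in>S. d n * cis (n * (t + x))) * cnj (\<Sum>n\<in>S. d n * cis (n * t)) =
     (\<Sum>n\<in>S. \<Sum>m\<in>S. (d n * cnj (d m) * cis (n * x)) * cis (of_int (n - m) * t))"
    unfolding cnj_sum sum_product
  proof (intro sum.cong refl)
    fix n m and t :: real
    have "cis (n * (t + x)) * cnj (cis (m * t)) = cis (n * x) * cis (of_int (n - m) * t)"
      by (simp add: cis_cnj cis_mult algebra_simps)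
    then show "d n * cis (n * (t + x)) * cnj (d m * cis (m * t)) = d n * cnj (d m) * cis (n * x) * cis (of_int (n - m) * t)"
      by (simp only: complex_cnj_mult) (metis (no_types, lifting) mult.assoc mult.left_commute)
  qed
  ultimately show "((\<lambda>t. (\<Sum>n\<in>S. d n * cis (n * (t + x))) * cnj (\<Sum>n\<in>S. d n * cis (n * t))) has_integral
     2 * pi * (\<Sum>n\<in>S. of_real ((norm (d n))\<^sup>2) * cis (n * x))) {0..2*pi}" by simp
qed

text \<open>Boundary values are radial limits outside a null set, and \<open>\<theta>\<close> may
  jump: no continuity up to the circle is assumed. The degree of the boundary map is encoded in
  \<open>period\<close>.\<close>

locale circle_boundary_map =
  fixes h g :: "complex \<Rightarrow> complex" and r :: real and \<theta> :: "real \<Rightarrow> real" and N :: "real set"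
  assumes hol: "h holomorphic_on ball 0 1" "g holomorphic_on ball 0 1" and zero: "h 0 = 0" "g 0 = 0"
    and r: "0 < r"
    and bounded: "\<And>z. norm z < 1 \<Longrightarrow> norm (h z + cnj (g z)) \<le> r"
    and mono: "mono \<theta>" and period: "\<And>t. \<theta> (t + 2*pi) = \<theta> t + 2*pi"
    and null: "negligible N"
    and limit: "\<And>t. t \<notin> N \<Longrightarrow>
       ((\<lambda>\<rho>. h (of_real \<rho> * cis t) + cnj (g (of_real \<rho> * cis t))) \<longlongrightarrow> of_real r * cis (\<theta> t)) (at_left 1)"
begin

definition F where "F z = h z + cnj (g z)"
definition e where "e n = (norm (fourier_coeff h g n))\<^sup>2"

lemma continuous_F: "continuous_on UNIV (\<lambda>t. F (of_real \<rho> * cis (t + x)))" if "0 \<le> \<rho>" "\<rho> < 1"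
  unfolding F_def
  by (intro continuous_intros continuous_on_compose2[OF holomorphic_on_imp_continuous_on[OF hol(1)]]
     continuous_on_compose2[OF holomorphic_on_imp_continuous_on[OF hol(2)]])
    (use that in \<open>auto simp: norm_mult\<close>)

text \<open>On a circle of radius below 1 the Fourier series converges uniformly, so the correlation
  can be computed term by term; the boundary circle itself is reached only by a limit.\<close>

lemma correlation_sums:
  fixes x :: real
  assumes \<rho>: "0 \<le> \<rho>" "\<rho> < 1"
  shows "(\<lambda>K. \<Sum>n\<in>{-int K..int K}. of_real (e n * \<rho> ^ (2 * nat \<bar>n\<bar>)) * cis (n * x))
     \<longlonglongrightarrow> circle_correlation F \<rho> x"
proof -
  define d where "d n = fourier_coeff h g n * of_real \<rho> ^ nat \<bar>n\<bar>" for n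
  define P where "P K t = (\<Sum>n\<in>{-int K..int K}. d n * cis (n * t))" for K and t :: real
  have u: "uniform_limit UNIV P (\<lambda>t. F (of_real \<rho> * cis t)) sequentially"
    unfolding P_def d_def trig_sum_eq[of h g, OF zero] F_def
    by (intro uniform_limit_add holomorphic_uniform_sums hol \<rho>
        bounded_linear.uniform_limit[OF bounded_linear_cnj])
  have u1: "uniform_limit {0..2*pi} (\<lambda>K t. P K (t + x)) (\<lambda>t. F (of_real \<rho> * cis (t + x))) sequentially"
    using u unfolding uniform_limit_iff by (auto elim!: eventually_mono)
  have u2: "uniform_limit {0..2*pi} (\<lambda>K t. cnj (P K t)) (\<lambda>t. cnj (F (of_real \<rho> * cis t))) sequentially"
    by (intro bounded_linear.uniform_limit[OF bounded_linear_cnj] uniform_limit_on_subset[OF u]) auto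
  have b: "bounded ((\<lambda>t. F (of_real \<rho> * cis (t + y))) ` {0..2*pi})" for y
    using bounded \<rho> unfolding bounded_iff F_def by (intro exI[of _ r]) (auto simp: norm_mult)
  have "uniform_limit {0..2*pi} (\<lambda>K t. P K (t + x) * cnj (P K t))
       (\<lambda>t. F (of_real \<rho> * cis (t + x)) * cnj (F (of_real \<rho> * cis t))) sequentially"
    using b[of x] b[of 0] by (intro uniform_lim_mult u1 u2) (auto simp: bounded_iff)
  then obtain I J where IJ: "\<And>K. ((\<lambda>t. P K (t + x) * cnj (P K t)) has_integral I K) {0..2*pi}"
     "((\<lambda>t. F (of_real \<rho> * cis (t + x)) * cnj (F (of_real \<rho> * cis t))) has_integral J) {0..2*pi}" "I \<longlonglongrightarrow> J"
    by (rule uniform_limit_integral) (auto simp: P_def intro!: continuous_intros)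
  have I: "I K = 2 * pi * (\<Sum>n\<in>{-int K..int K}. of_real ((norm (d n))\<^sup>2) * cis (n * x))" for K
    using integral_unique[OF IJ(1)] trig_correlation[of "{-int K..int K}" d x] by (simp add: P_def)
  have dn: "(norm (d n))\<^sup>2 = e n * \<rho> ^ (2 * nat \<bar>n\<bar>)" for n
    using \<rho> by (simp add: d_def e_def norm_mult norm_power power_mult_distrib power_mult[symmetric] mult.commute)
  have "(\<lambda>K. I K / (2 * pi)) \<longlonglongrightarrow> J / (2 * pi)"
    by (intro tendsto_intros IJ) auto
  then show ?thesis
    using integral_unique[OF IJ(2)] by (simp add: I dn circle_correlation_def)
qed

definition boundary_correlation :: "real \<Rightarrow> complex" where
  "boundary_correlation x = integral {0..2*pi} (\<lambda>t. of_real (r\<^sup>2) * cis (\<theta> (t + x) - \<theta> t)) / (2 * pi)"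

lemma correlation_limit:
  defines "\<rho> \<equiv> \<lambda>k. 1 - 1 / real (k + 2)"
  shows "(\<lambda>t. of_real (r\<^sup>2) * cis (\<theta> (t + x) - \<theta> t)) integrable_on {0..2*pi}" (is ?i)
    and "(\<lambda>k. circle_correlation F (\<rho> k) x) \<longlonglongrightarrow> boundary_correlation x" (is ?l)
proof -
  have \<rho>: "0 \<le> \<rho> k" "\<rho> k < 1" for k by (auto simp: \<rho>_def)
  have "\<rho> \<longlonglongrightarrow> 1" unfolding \<rho>_def by real_asymp
  then have \<rho>lim: "filterlim \<rho> (at_left 1) sequentially"
    using \<rho> by (intro tendsto_imp_filterlim_at_left) auto
  \<comment> \<open>Both t and t + x must be good angles, hence the translate of
    \<open>N\<close>.\<close>
  define N' where "N' = N \<union> ((+) (- x)) ` N"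
  have N': "negligible N'"
    using null negligible_translation[OF null, of "-x"] unfolding N'_def by (auto intro!: negligible_Un)
  define S where "S = {0..2*pi} - N'"
  define f where "f k t = F (of_real (\<rho> k) * cis (t + x)) * cnj (F (of_real (\<rho> k) * cis t))" for k t
  define l where "l t = of_real (r\<^sup>2) * cis (\<theta> (t + x) - \<theta> t)" for t
  have fint0: "f k integrable_on {0..2*pi}" for k
  proof -
    have "continuous_on {0..2*pi} (\<lambda>t. F (of_real (\<rho> k) * cis (t + y)))" for y
      by (rule continuous_on_subset[OF continuous_F[OF \<rho>]]) simp
    from this[of x] this[of 0] show ?thesis
      unfolding f_def by (intro integrable_continuous_real continuous_on_mult continuous_on_cnj) simp_all
  qed
  have spike: "(u integrable_on {0..2*pi}) = (u integrable_on S)" "integral {0..2*pi} u = integral S u" for u :: "real \<Rightarrow> complex"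
  proof -
    have "(u has_integral y) {0..2*pi} \<longleftrightarrow> (u has_integral y) S" for y
      by (intro has_integral_spike_set_eq negligible_subset[OF N']) (auto simp: S_def)
    then show "(u integrable_on {0..2*pi}) = (u integrable_on S)" "integral {0..2*pi} u = integral S u"
      by (auto simp: integrable_on_def integral_def)
  qed
  have spikeR: "(\<lambda>t. r\<^sup>2) integrable_on S"
    by (rule integrable_spike_set[of _ "{0..2*pi}"]; (rule negligible_subset[OF N'])?)
      (auto simp: S_def)
  have conv: "(\<lambda>k. f k t) \<longlonglongrightarrow> l t" if "t \<in> S" for t
  proof -
    have "t \<notin> N" "t + x \<notin> N" using that by (force simp: S_def N'_def image_iff)+
    from limit[OF this(1)] limit[OF this(2)]
    have "(\<lambda>k. F (of_real (\<rho> k) * cis (t + x)) * cnj (F (of_real (\<rho> k) * cis t))) \<longlonglongrightarrow>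
      (of_real r * cis (\<theta> (t + x))) * cnj (of_real r * cis (\<theta> t))"
      unfolding F_def by (intro tendsto_mult tendsto_cnj) (auto intro: filterlim_compose[OF _ \<rho>lim])
    then show ?thesis
      using cis_diff_eq[of "\<theta> (t + x)" "\<theta> t"] by (simp add: f_def l_def power2_eq_square mult_ac)
  qed
  have dom: "norm (f k t) \<le> r\<^sup>2" for k t
    unfolding f_def norm_mult power2_eq_square complex_mod_cnj F_def
    using \<rho>[of k] r by (intro mult_mono bounded) (auto simp: norm_mult)
  have "l integrable_on S \<and> (\<lambda>k. integral S (f k)) \<longlonglongrightarrow> integral S l"
    using dominated_convergence[of f S "\<lambda>_. r\<^sup>2" l] fint0 spike(1) spikeR dom conv by auto
  then have "l integrable_on {0..2*pi}" "(\<lambda>k. integral {0..2*pi} (f k)) \<longlonglongrightarrow> integral {0..2*pi} l"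
    using spike by auto
  then show ?i ?l
    unfolding l_def f_def boundary_correlation_def circle_correlation_def by (auto intro!: tendsto_intros)
qed

lemma \<theta>_integrable: "(\<lambda>t. \<theta> (t + x)) integrable_on {a..b}"
  by (rule integrable_on_mono_on) (use mono in \<open>auto simp: mono_on_def mono_def\<close>)

text \<open>Shifting the period by x replaces the block over [0, x] by its copy one period later,
  and there \<open>\<theta>\<close> is larger by 2 pi.\<close>

lemma mean_increment:
  assumes x: "0 \<le> x" "x \<le> 2 * pi"
  shows "((\<lambda>t. \<theta> (t + x) - \<theta> t) has_integral 2 * pi * x) {0..2*pi}"
proof -
  have i: "\<theta> integrable_on {a..b}" for a b using \<theta>_integrable[of 0] by simp
  have shift: "integral {a..b} (\<lambda>t. \<theta> (t + c)) = integral {a+c..b+c} \<theta>" if "a \<le> b" for a b c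
    using integral_shift_real_ivl[of "a+c" c "b+c" \<theta>] by simp
  have 1: "integral {0..2*pi} (\<lambda>t. \<theta> (t + x)) = integral {x..2*pi} \<theta> + integral {2*pi..2*pi+x} \<theta>"
    using shift[of 0 "2*pi" x] Henstock_Kurzweil_Integration.integral_combine[of x "2*pi" "2*pi+x" \<theta>] x i by simp
  have "integral {2*pi..2*pi+x} \<theta> = integral {0..x} (\<lambda>t. \<theta> (t + 2*pi))"
    using shift[of 0 x "2*pi"] x by (simp add: add.commute)
  also have "\<dots> = integral {0..x} (\<lambda>t. \<theta> t + 2 * pi)" by (simp add: period)
  also have "\<dots> = integral {0..x} \<theta> + 2 * pi * x"
    using x i by (subst integral_add) auto
  finally have 2: "integral {2*pi..2*pi+x} \<theta> = integral {0..x} \<theta> + 2 * pi * x" .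
  have 3: "integral {0..2*pi} \<theta> = integral {0..x} \<theta> + integral {x..2*pi} \<theta>"
    using Henstock_Kurzweil_Integration.integral_combine[of 0 x "2*pi" \<theta>] x i by simp
  have "integral {0..2*pi} (\<lambda>t. \<theta> (t + x) - \<theta> t) = 2 * pi * x"
    using 1 2 3 \<theta>_integrable i by (subst integral_diff) auto
  then show ?thesis
    using integrable_integral[OF integrable_diff[OF \<theta>_integrable i], of x 0 "2*pi"] by simp
qed

lemma boundary_correlation_zero: "boundary_correlation 0 = of_real (r\<^sup>2)"
  by (simp add: boundary_correlation_def scaleR_conv_of_real del: of_real_power)

text \<open>The majorant has to be linear in D: the mean of D is known exactly, whatever the
  monotone function \<open>\<theta>\<close> is.\<close>

lemma boundary_correlation_bound:
  assumes x: "0 \<le> x" "x \<le> 2 * pi" and ab: "\<And>D. 0 \<le> D \<Longrightarrow> a * (1 - cos D) + b * sin D \<le> D"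
  shows "a * (r\<^sup>2 - Re (boundary_correlation x)) + b * Im (boundary_correlation x) \<le> r\<^sup>2 * x"
proof -
  define l where "l t = of_real (r\<^sup>2) * cis (\<theta> (t + x) - \<theta> t)" for t
  define I where "I = integral {0..2*pi} l"
  have I: "(l has_integral I) {0..2*pi}"
    unfolding I_def l_def by (rule integrable_integral[OF correlation_limit(1)])
  have re: "((\<lambda>t. r\<^sup>2 * cos (\<theta> (t + x) - \<theta> t)) has_integral Re I) {0..2*pi}"
    using has_integral_linear[OF I bounded_linear_Re] by (simp add: o_def l_def del: of_real_power)
  have im: "((\<lambda>t. r\<^sup>2 * sin (\<theta> (t + x) - \<theta> t)) has_integral Im I) {0..2*pi}"
    using has_integral_linear[OF I bounded_linear_Im] by (simp add: o_def l_def del: of_real_power)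
  have c: "((\<lambda>t. r\<^sup>2) has_integral (r\<^sup>2 * (2 * pi))) {0..2*pi}"
    using has_integral_const_real[of "r\<^sup>2" 0 "2*pi"] by (simp add: mult.commute)
  have "((\<lambda>t. a * (r\<^sup>2 - r\<^sup>2 * cos (\<theta> (t + x) - \<theta> t)) + b * (r\<^sup>2 * sin (\<theta> (t + x) - \<theta> t))) has_integral
     a * (r\<^sup>2 * (2 * pi) - Re I) + b * Im I) {0..2*pi}"
    by (intro has_integral_add has_integral_mult_right has_integral_diff re im c)
  moreover have "((\<lambda>t. r\<^sup>2 * (\<theta> (t + x) - \<theta> t)) has_integral r\<^sup>2 * (2 * pi * x)) {0..2*pi}"
    by (intro has_integral_mult_right mean_increment x)
  ultimately have "a * (r\<^sup>2 * (2 * pi) - Re I) + b * Im I \<le> r\<^sup>2 * (2 * pi * x)"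
  proof (rule has_integral_le)
    fix t
    have "0 \<le> \<theta> (t + x) - \<theta> t" using mono x by (simp add: mono_def)
    from mult_left_mono[OF ab[OF this], of "r\<^sup>2"]
    show "a * (r\<^sup>2 - r\<^sup>2 * cos (\<theta> (t + x) - \<theta> t)) + b * (r\<^sup>2 * sin (\<theta> (t + x) - \<theta> t)) \<le> r\<^sup>2 * (\<theta> (t + x) - \<theta> t)"
      by (simp add: algebra_simps)
  qed
  moreover have "Re I = 2 * pi * Re (boundary_correlation x)" "Im I = 2 * pi * Im (boundary_correlation x)"
    by (simp_all add: boundary_correlation_def I_def l_def[abs_def] Re_divide Im_divide power2_eq_square del: integral_mult_right)
  ultimately have "2 * pi * (a * (r\<^sup>2 - Re (boundary_correlation x)) + b * Im (boundary_correlation x)) \<le> 2 * pi * (r\<^sup>2 * x)"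
    by (simp add: algebra_simps)
  then show ?thesis by simp
qed

text \<open>The order of the limits matters. At a fixed radius below 1 the whole series equals a
  correlation, and nonnegative weights allow it to be cut at \<open>K\<close>; then the radius tends
  to 1 with \<open>K\<close> fixed. No convergence of the sum of \<open>e n\<close> is
  presupposed.\<close>

lemma spectral_test:
  fixes x :: real
  assumes x: "0 \<le> x" "x \<le> 2 * pi" and a: "0 \<le> a" and b: "0 \<le> b"
  shows "(\<Sum>n\<in>{-int K..int K}. e n * (a * (1 - cos (n*x)) + b * (1 + sin (n*x))))
     \<le> a * (r\<^sup>2 - Re (boundary_correlation x)) + b * (r\<^sup>2 + Im (boundary_correlation x))"
proof -
  define \<rho> where "\<rho> k = 1 - 1 / real (k + 2)" for k
  have \<rho>: "0 \<le> \<rho> k" "\<rho> k < 1" for k by (auto simp: \<rho>_def)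
  define A where "A k y = circle_correlation F (\<rho> k) y" for k y
  define w where "w n = a * (1 - cos (of_int n*x)) + b * (1 + sin (of_int n*x))" for n :: int
  have w: "0 \<le> w n" for n
  proof -
    have "0 \<le> 1 - cos (of_int n * x)" "0 \<le> 1 + sin (of_int n * x)"
      using cos_le_one[of "of_int n * x"] sin_ge_minus_one[of "of_int n * x"] by linarith+
    then show ?thesis unfolding w_def using a b by (simp del: diff_ge_0_iff_ge cos_le_one)
  qed
  have e: "0 \<le> e n" for n by (simp add: e_def)
  have step: "(\<Sum>n\<in>{-int K..int K}. e n * \<rho> k ^ (2 * nat \<bar>n\<bar>) * w n)
     \<le> a * (Re (A k 0) - Re (A k x)) + b * (Re (A k 0) + Im (A k x))" for k
  proof (rule LIMSEQ_le_const)
    define s where "s M y = (\<Sum>n\<in>{-int M..int M}. of_real (e n * \<rho> k ^ (2 * nat \<bar>n\<bar>)) * cis (n * y))" for M and y :: real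
    have "(\<lambda>M. s M y) \<longlonglongrightarrow> A k y" for y
      unfolding s_def A_def by (rule correlation_sums[OF \<rho>])
    then show "(\<lambda>M. a * (Re (s M 0) - Re (s M x)) + b * (Re (s M 0) + Im (s M x)))
      \<longlonglongrightarrow> a * (Re (A k 0) - Re (A k x)) + b * (Re (A k 0) + Im (A k x))"
      by (intro tendsto_intros)
    have "(\<Sum>n\<in>{-int K..int K}. e n * \<rho> k ^ (2 * nat \<bar>n\<bar>) * w n) \<le> a * (Re (s M 0) - Re (s M x)) + b * (Re (s M 0) + Im (s M x))"
      if "K \<le> M" for M
    proof -
      have "(\<Sum>n\<in>{-int K..int K}. e n * \<rho> k ^ (2 * nat \<bar>n\<bar>) * w n) \<le> (\<Sum>n\<in>{-int M..int M}. e n * \<rho> k ^ (2 * nat \<bar>n\<bar>) * w n)"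
        using that by (intro sum_mono2 mult_nonneg_nonneg e w zero_le_power \<rho>) auto
      also have "\<dots> = a * (Re (s M 0) - Re (s M x)) + b * (Re (s M 0) + Im (s M x))"
      proof -
        have re: "Re (s M y) = (\<Sum>n\<in>{-int M..int M}. e n * \<rho> k ^ (2 * nat \<bar>n\<bar>) * cos (n * y))"
          and im: "Im (s M y) = (\<Sum>n\<in>{-int M..int M}. e n * \<rho> k ^ (2 * nat \<bar>n\<bar>) * sin (n * y))" for y :: real
          by (simp_all add: s_def Re_sum Im_sum del: of_real_mult of_real_power)
        show ?thesis
          unfolding re im[of x] w_def
          by (simp only: sum_distrib_left sum_subtractf[symmetric] sum.distrib[symmetric])
            (simp add: algebra_simps)
      qed
      finally show ?thesis .
    qed
    then show "\<exists>N. \<forall>M\<ge>N. (\<Sum>n\<in>{-int K..int K}. e n * \<rho> k ^ (2 * nat \<bar>n\<bar>) * w n)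
       \<le> a * (Re (s M 0) - Re (s M x)) + b * (Re (s M 0) + Im (s M x))" by blast
  qed
  have A: "(\<lambda>k. A k y) \<longlonglongrightarrow> boundary_correlation y" for y
    unfolding A_def \<rho>_def by (rule correlation_limit)
  have "\<rho> \<longlonglongrightarrow> 1" unfolding \<rho>_def by real_asymp
  then have "(\<lambda>k. \<Sum>n\<in>{-int K..int K}. e n * \<rho> k ^ (2 * nat \<bar>n\<bar>) * w n)
      \<longlonglongrightarrow> (\<Sum>n\<in>{-int K..int K}. e n * 1 ^ (2 * nat \<bar>n\<bar>) * w n)"
    by (intro tendsto_intros)
  moreover have "(\<lambda>k. a * (Re (A k 0) - Re (A k x)) + b * (Re (A k 0) + Im (A k x)))
     \<longlonglongrightarrow> a * (Re (boundary_correlation 0) - Re (boundary_correlation x)) + b * (Re (boundary_correlation 0) + Im (boundary_correlation x))"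
    by (intro tendsto_intros A)
  ultimately have "(\<Sum>n\<in>{-int K..int K}. e n * 1 ^ (2 * nat \<bar>n\<bar>) * w n)
    \<le> a * (Re (boundary_correlation 0) - Re (boundary_correlation x)) + b * (Re (boundary_correlation 0) + Im (boundary_correlation x))"
    using step by (intro LIMSEQ_le) auto
  then show ?thesis by (simp add: w_def boundary_correlation_zero del: of_real_power)
qed

text \<open>The upper bound is \<open>spectral_test\<close> at x = 0 with a = 0 and b = 1. For the
  lower bound, the mean square on each inner circle is at most the limit of the partial sums, since
  the powers of the radius are at most 1, and these mean squares tend to r^2.\<close>

lemma parseval: "(\<lambda>K. \<Sum>n\<in>{-int K..int K}. e n) \<longlonglongrightarrow> r\<^sup>2"
proof -
  define S where "S K = (\<Sum>n\<in>{-int K..int K}. e n)" for K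
  have e: "0 \<le> e n" for n by (simp add: e_def)
  have up: "S K \<le> r\<^sup>2" for K
    using spectral_test[of 0 0 1 K] by (simp add: S_def boundary_correlation_zero del: of_real_power)
  have "incseq S" unfolding S_def by (intro monoI sum_mono2 e) auto
  then obtain L where L: "S \<longlonglongrightarrow> L" "\<And>K. S K \<le> L" using incseq_convergent[OF _ ] up by metis
  have "L \<le> r\<^sup>2" using L(1) up by (intro LIMSEQ_le_const2) auto
  moreover have "r\<^sup>2 \<le> L"
  proof -
    define \<rho> where "\<rho> k = 1 - 1 / real (k + 2)" for k
    have \<rho>: "0 \<le> \<rho> k" "\<rho> k < 1" for k by (auto simp: \<rho>_def)
    have "Re (circle_correlation F (\<rho> k) 0) \<le> L" for k
    proof (rule LIMSEQ_le_const2)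
      show "(\<lambda>K. Re (\<Sum>n\<in>{-int K..int K}. of_real (e n * \<rho> k ^ (2 * nat \<bar>n\<bar>)) * cis (n * (0::real))))
        \<longlonglongrightarrow> Re (circle_correlation F (\<rho> k) 0)"
        by (rule tendsto_Re[OF correlation_sums[OF \<rho>]])
      have "Re (\<Sum>n\<in>{-int K..int K}. of_real (e n * \<rho> k ^ (2 * nat \<bar>n\<bar>)) * cis (n * (0::real))) \<le> S K" for K
        unfolding S_def Re_sum using e \<rho>[of k]
        by (intro sum_mono) (auto intro!: mult_left_le power_le_one simp del: of_real_mult of_real_power)
      then show "\<exists>N. \<forall>K\<ge>N. Re (\<Sum>n\<in>{-int K..int K}. of_real (e n * \<rho> k ^ (2 * nat \<bar>n\<bar>)) * cis (n * (0::real))) \<le> L"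
        using L(2) order_trans by blast
    qed
    moreover have "(\<lambda>k. Re (circle_correlation F (\<rho> k) 0)) \<longlonglongrightarrow> Re (boundary_correlation 0)"
      unfolding \<rho>_def by (intro tendsto_Re correlation_limit)
    ultimately have "Re (boundary_correlation 0) \<le> L" by (intro LIMSEQ_le_const2) auto
    then show ?thesis by (simp add: boundary_correlation_zero del: of_real_power)
  qed
  ultimately show ?thesis using L(1) unfolding S_def by simp
qed

end

section \<open>Monotonicity of the boundary argument\<close>

text \<open>The logarithms of 1 lie 2 pi apart, so the range is discrete. This is how two branches
  of a logarithm are compared below.\<close>

lemma exp_eq_one_imp_constant:
  assumes "connected S" "continuous_on S d" "\<And>z. z \<in> S \<Longrightarrow> exp (d z) = (1::complex)" "x \<in> S" "y \<in> S"
  shows "d x = d y"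
proof -
  have "d constant_on S"
  proof (rule continuous_discrete_range_constant[OF assms(1,2)])
    fix x assume x: "x \<in> S"
    have "1 \<le> norm (d y - d x)" if y: "y \<in> S" "d y \<noteq> d x" for y
    proof -
      from assms(3)[OF x] obtain n :: int where n: "Re (d x) = 0" "Im (d x) = of_int (2 * n) * pi"
        by (auto simp: exp_eq_1)
      from assms(3)[OF y(1)] obtain m :: int where m: "Re (d y) = 0" "Im (d y) = of_int (2 * m) * pi"
        by (auto simp: exp_eq_1)
      have "m \<noteq> n" using n m y(2) by (metis complex_eqI)
      then have "1 \<le> \<bar>real_of_int (m - n)\<bar>" by linarith
      then have "1 * 1 \<le> \<bar>real_of_int (m - n)\<bar> * (2 * pi)" using pi_gt3 by (intro mult_mono) auto
      also have "\<dots> = \<bar>(real_of_int (m - n)) * (2 * pi)\<bar>" by (simp add: abs_mult)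
      also have "\<dots> = \<bar>Im (d y - d x)\<bar>" by (simp add: n m algebra_simps)
      also have "\<dots> \<le> norm (d y - d x)" by (rule abs_Im_le_cmod)
      finally show ?thesis by simp
    qed
    then show "\<exists>e>0. \<forall>y. y \<in> S \<and> d y \<noteq> d x \<longrightarrow> e \<le> norm (d y - d x)"
      by (intro exI[of _ 1]) auto
  qed
  then show ?thesis using assms(4,5) by (auto simp: constant_on_def)
qed

lemma exp_2_pi_i: "exp (2 * of_real pi * \<i>) = 1"
  by (simp add: exp_eq_1)

text \<open>The condition \<open>orient\<close> keeps F z / (a z) in the right half-plane near 0.
  This weak form of differentiability forces the winding number of \<open>F\<close> about 0 to be
  1.\<close>

locale disk_homeomorphism =
  fixes F :: "complex \<Rightarrow> complex" and r :: real
  assumes r: "0 < r" and cont: "continuous_on (ball 0 1) F" and inj: "inj_on F (ball 0 1)"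
    and image: "F ` ball 0 1 = ball 0 r" and F0: "F 0 = 0"
    and orient: "\<exists>a \<delta>. a \<noteq> 0 \<and> \<delta> > 0 \<and> (\<forall>z. z \<noteq> 0 \<longrightarrow> norm z < \<delta> \<longrightarrow> norm (F z / (a * z) - 1) < 1)"
begin

lemma inverse_map:
  obtains G where "\<And>z. z \<in> ball 0 1 \<Longrightarrow> G (F z) = z" "continuous_on (ball 0 r) G"
proof -
  obtain G where "homeomorphism (ball 0 1) (F ` ball 0 1) F G"
    by (rule invariance_of_domain_homeomorphism[OF open_ball cont _ inj]) simp
  then show thesis by (intro that[of G]) (auto simp: homeomorphism_def image simp del: mem_ball_0)
qed

text \<open>Away from 0 both \<open>F\<close> and its inverse have no zero, so after exp each has a
  logarithm on a half-plane. The two lifts are inverse up to a constant multiple of 2 pi i, absorbed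
  into \<open>M\<close>. Angles become ordinary coordinates, so that order between them makes
  sense.\<close>

lemma log_lift:
  "\<exists>L M. continuous_on {z. Re z < 0} L \<and> (\<forall>z. Re z < 0 \<longrightarrow> exp (L z) = F (exp z)) \<and>
    (\<forall>z. Re z < 0 \<longrightarrow> L (z + 2 * pi * \<i>) = L z + 2 * pi * \<i>) \<and>
    continuous_on {w. Re w < ln r} M \<and> (\<forall>z. Re z < 0 \<longrightarrow> M (L z) = z) \<and>
    (\<forall>w. Re w < ln r \<longrightarrow> L (M w) = w \<and> Re (M w) < 0)"
proof -
  define H where "H = {z::complex. Re z < 0}"
  define K where "K = {z::complex. Re z < ln r}"
  have conv: "convex {z::complex. Re z < c}" for c by (rule convex_halfspace_Re_lt)
  have conH: "connected H" "contractible H" and conK: "connected K" "contractible K"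
    unfolding H_def K_def by (intro convex_connected convex_imp_contractible conv)+
  have expH: "exp z \<in> ball 0 1" if "z \<in> H" for z using that by (simp add: H_def)
  have expK: "exp z \<in> ball 0 r" if "z \<in> K" for z
    using that r by (simp add: K_def) (metis exp_less_cancel_iff exp_ln)
  have Fb: "F z \<in> ball 0 r" if "z \<in> ball 0 1" for z using that image by blast
  have F_nz: "F z \<noteq> 0" if "z \<in> ball 0 1" "z \<noteq> 0" for z
    using inj_onD[OF inj, of z 0] that F0 by auto
  obtain G where G: "\<And>z. z \<in> ball 0 1 \<Longrightarrow> G (F z) = z" "continuous_on (ball 0 r) G"
    using inverse_map by metis
  have G': "G w \<in> ball 0 1" "F (G w) = w" if "w \<in> ball 0 r" for w
    using that G(1) image by (metis imageE)+
  have "continuous_on H (\<lambda>z. F (exp z))"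
    by (intro continuous_on_compose2[OF cont] continuous_intros) (use expH in auto)
  moreover have "F (exp z) \<noteq> 0" if "z \<in> H" for z
    using F_nz expH[OF that] by simp
  ultimately obtain L where L: "continuous_on H L" "\<And>z. z \<in> H \<Longrightarrow> F (exp z) = exp (L z)"
    using continuous_logarithm_on_contractible[OF _ conH(2), of "\<lambda>z. F (exp z)"] by metis
  have "continuous_on K (\<lambda>z. G (exp z))"
    by (intro continuous_on_compose2[OF G(2)] continuous_intros) (use expK in auto)
  moreover have "G (exp z) \<noteq> 0" if "z \<in> K" for z
    using G'(2)[OF expK[OF that]] F0 by auto
  ultimately obtain M0 where M0: "continuous_on K M0" "\<And>z. z \<in> K \<Longrightarrow> G (exp z) = exp (M0 z)"
    using continuous_logarithm_on_contractible[OF _ conK(2), of "\<lambda>z. G (exp z)"] by metis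
  have LK: "L z \<in> K" if "z \<in> H" for z
  proof -
    have "norm (exp (L z)) < r" using L(2)[OF that] Fb[OF expH[OF that]] by simp
    then have "exp (Re (L z)) < exp (ln r)" using r by simp
    then show ?thesis by (simp add: K_def)
  qed
  define c where "c = M0 (L (-1)) - (-1)"
  have mH: "(-1::complex) \<in> H" by (simp add: H_def)
  have c: "M0 (L z) - z = c" if "z \<in> H" for z
    unfolding c_def
  proof (rule exp_eq_one_imp_constant[OF conH(1) _ _ that mH, of "\<lambda>z. M0 (L z) - z"])
    show "continuous_on H (\<lambda>z. M0 (L z) - z)"
      by (intro continuous_intros continuous_on_compose2[OF M0(1) L(1)]) (use LK in auto)
    show "exp (M0 (L z) - z) = 1" if "z \<in> H" for z
      using M0(2)[OF LK[OF that]] L(2)[OF that] G(1)[OF expH[OF that]] by (simp add: exp_diff)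
  qed
  have c1: "exp c = 1"
    using M0(2)[OF LK[OF mH]] L(2)[OF mH] G(1)[OF expH[OF mH]] by (simp add: c_def exp_add exp_minus)
  define M where "M w = M0 w - c" for w
  have M: "continuous_on K M" unfolding M_def by (intro continuous_intros M0)
  have M_L: "M (L z) = z" if "z \<in> H" for z using c[OF that] by (simp add: M_def algebra_simps)
  have expM: "exp (M w) = G (exp w)" if "w \<in> K" for w
    using M0(2)[OF that] c1 by (simp add: M_def exp_diff)
  have MH: "M w \<in> H" if "w \<in> K" for w
    using G'(1)[OF expK[OF that]] expM[OF that] norm_exp_eq_Re[of "M w"] by (simp add: H_def)
  have L_M: "L (M w) = w" if "w \<in> K" for w
  proof -
    have "L (M w) - w = L (M (L (-1))) - L (-1)"
    proof (rule exp_eq_one_imp_constant[OF conK(1) _ _ that LK[OF mH], of "\<lambda>w. L (M w) - w"])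
      show "continuous_on K (\<lambda>w. L (M w) - w)"
        by (intro continuous_intros continuous_on_compose2[OF L(1) M]) (use MH in auto)
      show "exp (L (M w) - w) = 1" if "w \<in> K" for w
        using L(2)[OF MH[OF that]] expM[OF that] G'(2)[OF expK[OF that]] by (simp add: exp_diff)
    qed
    then show ?thesis by (simp add: M_L[OF mH])
  qed
  have per: "L (z + 2 * pi * \<i>) = L z + 2 * pi * \<i>" if "z \<in> H" for z
  proof -
    obtain a \<delta> where a: "a \<noteq> 0" and \<delta>: "\<delta> > 0" "\<And>z. z \<noteq> 0 \<Longrightarrow> norm z < \<delta> \<Longrightarrow> norm (F z / (a * z) - 1) < 1"
      using orient by metis
    define x0 where "x0 = min (ln \<delta>) (-1)"
    define S where "S = {z::complex. Re z < x0}"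
    define q where "q z = F (exp z) / (a * exp z)" for z
    have SH: "S \<subseteq> H" by (auto simp: S_def H_def x0_def)
    have q: "norm (q z - 1) < 1" if "z \<in> S" for z
      unfolding q_def
    proof (rule \<delta>(2))
      have "Re z < ln \<delta>" using that by (simp add: S_def x0_def)
      then show "norm (exp z) < \<delta>" using \<delta>(1) by simp (metis exp_less_cancel_iff exp_ln)
    qed simp
    have qpos: "0 < Re (q z)" if "z \<in> S" for z
      using q[OF that] abs_Re_le_cmod[of "q z - 1"] by simp
    have q_cont: "continuous_on S q"
      unfolding q_def
      by (intro continuous_intros continuous_on_compose2[OF cont]) (use a expH SH in auto)
    \<comment> \<open>Near the left end \<open>L z\<close> is z plus the principal logarithm of
      \<open>q z\<close> plus a constant, as \<open>q\<close> has positive real part. Since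
      \<open>q\<close> has period 2 pi i, the lift gains exactly 2 pi i.\<close>
    define d where "d z = L z - z - Ln (a * q z / a) - Ln a" for z
    have dconst: "d z = d w" if "z \<in> S" "w \<in> S" for z w
    proof (rule exp_eq_one_imp_constant[OF _ _ _ that])
      show "connected S" unfolding S_def by (intro convex_connected conv)
      show "continuous_on S d"
        unfolding d_def using a
        by (auto intro!: continuous_intros q_cont continuous_on_subset[OF L(1) SH] dest: qpos simp: complex_nonpos_Reals_iff)
      show "exp (d z) = 1" if z: "z \<in> S" for z
      proof -
        have "q z \<noteq> 0" using qpos[OF z] by auto
        then show ?thesis
          using a L(2)[of z] z SH by (simp add: d_def exp_diff q_def) (auto simp: field_simps)
      qed
    qed
    have H_shift: "z + 2 * pi * \<i> \<in> H" if "z \<in> H" for z using that by (simp add: H_def)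
    define z0 where "z0 = complex_of_real (x0 - 1)"
    have z0: "z0 \<in> S" "z0 + 2 * pi * \<i> \<in> S" "z0 \<in> H" using SH by (auto simp: z0_def S_def)
    have "q (z0 + 2 * pi * \<i>) = q z0" by (simp add: q_def exp_add exp_2_pi_i)
    then have e0: "L (z0 + 2 * pi * \<i>) - L z0 - 2 * pi * \<i> = 0"
      using dconst[OF z0(2,1)] by (simp add: d_def diff_eq_eq)
    have "L (z + 2 * pi * \<i>) - L z - 2 * pi * \<i> = L (z0 + 2 * pi * \<i>) - L z0 - 2 * pi * \<i>"
    proof (rule exp_eq_one_imp_constant[OF conH(1) _ _ that z0(3), of "\<lambda>z. L (z + 2 * pi * \<i>) - L z - 2 * pi * \<i>"])
      show "continuous_on H (\<lambda>z. L (z + 2 * pi * \<i>) - L z - 2 * pi * \<i>)"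
        by (intro continuous_intros L(1) continuous_on_compose2[OF L(1)]) (use H_shift in auto)
      show "exp (L (z + 2 * pi * \<i>) - L z - 2 * pi * \<i>) = 1" if z: "z \<in> H" for z
        using L(2)[OF z] L(2)[OF H_shift[OF z]] exp_2_pi_i by (simp add: exp_diff exp_add)
    qed
    then show ?thesis using e0 by (simp add: algebra_simps)
  qed
  show ?thesis
    by (intro exI[of _ L] exI[of _ M]) (use L M_L L_M MH per M in \<open>auto simp: H_def K_def\<close>)
qed

text \<open>Properness: the preimage of a closed disk of radius s < r is compact, hence stays away
  from the unit circle uniformly in the angle.\<close>

lemma eventually_norm_gt:
  assumes "s < r"
  shows "\<forall>\<^sub>F \<rho> in at_left 1. \<forall>t. s < norm (F (of_real \<rho> * cis t))"
proof (cases "0 \<le> s")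
  case False
  then have "s < norm z" for z :: complex using norm_ge_zero[of z] by linarith
  then show ?thesis by simp
next
  case True
  obtain G where G: "\<And>z. z \<in> ball 0 1 \<Longrightarrow> G (F z) = z" "continuous_on (ball 0 r) G"
    using inverse_map by metis
  have Gb: "G w \<in> ball 0 1" if "w \<in> ball 0 r" for w
    using that G(1) image by (metis imageE)
  have sub: "cball 0 s \<subseteq> ball (0::complex) r" using assms by auto
  have "compact (G ` cball 0 s)"
    by (intro compact_continuous_image continuous_on_subset[OF G(2) sub]) auto
  moreover have "G ` cball 0 s \<noteq> {}" using True by auto
  ultimately obtain z where z: "z \<in> G ` cball 0 s" "\<And>w. w \<in> G ` cball 0 s \<Longrightarrow> norm w \<le> norm z"
    using continuous_attains_sup[of "G ` cball 0 s" norm] by (metis continuous_on_norm_id)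
  have z1: "norm z < 1" using z(1) Gb sub by auto
  have "s < norm (F (of_real \<rho> * cis t))" if \<rho>: "norm z < \<rho>" "\<rho> < 1" for \<rho> t
  proof (rule ccontr)
    assume "\<not> ?thesis"
    then have "F (of_real \<rho> * cis t) \<in> cball 0 s" by simp
    moreover have "0 < \<rho>" using \<rho> norm_ge_zero[of z] by linarith
    ultimately have "norm (of_real \<rho> * cis t) \<le> norm z"
      using z(2)[of "of_real \<rho> * cis t"] G(1)[of "of_real \<rho> * cis t"] \<rho> by (force simp: norm_mult image_iff)
    then show False using \<rho> \<open>0 < \<rho>\<close> by (simp add: norm_mult)
  qed
  then show ?thesis using z1 unfolding eventually_at_left_field by blast
qed

definition radial_limit :: "real \<Rightarrow> complex \<Rightarrow> bool" where
  "radial_limit t l \<longleftrightarrow> ((\<lambda>\<rho>. F (of_real \<rho> * cis t)) \<longlongrightarrow> l) (at_left 1)"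

lemma norm_F_less: "norm (F (of_real \<rho> * cis t)) < r" if "0 \<le> \<rho>" "\<rho> < 1"
proof -
  have "of_real \<rho> * cis t \<in> ball 0 1" using that by (simp add: norm_mult)
  then have "F (of_real \<rho> * cis t) \<in> ball 0 r" using image by blast
  then show ?thesis by simp
qed

lemma norm_radial_limit: "norm l = r" if "radial_limit t l"
proof -
  have lim: "((\<lambda>\<rho>. norm (F (of_real \<rho> * cis t))) \<longlongrightarrow> norm l) (at_left 1)"
    using that unfolding radial_limit_def by (rule tendsto_norm)
  have ev: "\<forall>\<^sub>F \<rho> in at_left (1::real). 0 < \<rho> \<and> \<rho> < 1"
    unfolding eventually_at_left_field by (intro exI[of _ 0]) auto
  have "norm l \<le> r"
  proof (rule tendsto_upperbound[OF lim])
    show "\<forall>\<^sub>F \<rho> in at_left 1. norm (F (of_real \<rho> * cis t)) \<le> r"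
      using ev by (rule eventually_mono) (use norm_F_less in \<open>simp add: less_imp_le\<close>)
  qed simp
  moreover have "s \<le> norm l" if "s < r" for s
  proof (rule tendsto_lowerbound[OF lim])
    show "\<forall>\<^sub>F \<rho> in at_left 1. s \<le> norm (F (of_real \<rho> * cis t))"
      using eventually_norm_gt[OF that] by (rule eventually_mono) (simp add: less_imp_le)
  qed simp
  then have "r \<le> norm l" by (rule dense_le)
  ultimately show ?thesis by simp
qed

lemma radial_limit_periodic: "radial_limit (t + 2 * pi) l \<longleftrightarrow> radial_limit t l"
proof -
  have "cis (t + 2 * pi) = cis t" using cis_mult[of t "2*pi"] by simp
  then show ?thesis by (simp add: radial_limit_def)
qed

text \<open>In logarithmic coordinates the image of the ray at angle \<open>s\<close> cuts the half-plane in two. A thin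
  boundary strip below its end point avoids that image, and contains images of points of very negative
  angle, so it is never entered by the image of a ray at an angle \<open>t > s\<close>.\<close>

lemma monotone_argument:
  "\<exists>\<Theta>. (\<forall>t l. radial_limit t l \<longrightarrow> l = of_real r * cis (\<Theta> t) \<and> \<Theta> (t + 2 * pi) = \<Theta> t + 2 * pi) \<and>
    (\<forall>s t l m. radial_limit s l \<longrightarrow> radial_limit t m \<longrightarrow> s < t \<longrightarrow> \<Theta> s \<le> \<Theta> t)"
proof -
  obtain L M where L: "continuous_on {z. Re z < 0} L" "\<And>z. Re z < 0 \<Longrightarrow> exp (L z) = F (exp z)"
    "\<And>z. Re z < 0 \<Longrightarrow> L (z + 2 * pi * \<i>) = L z + 2 * pi * \<i>"
    and M: "continuous_on {w. Re w < ln r} M" "\<And>z. Re z < 0 \<Longrightarrow> M (L z) = z"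
    "\<And>w. Re w < ln r \<Longrightarrow> L (M w) = w" "\<And>w. Re w < ln r \<Longrightarrow> Re (M w) < 0"
    using log_lift by blast
  have exp_polar: "exp (Complex x t) = of_real (exp x) * cis t" for x t
    by (simp add: exp_eq_polar)
  have lim_exp: "filterlim (exp :: real \<Rightarrow> real) (at_left 1) (at_left 0)"
  proof (rule tendsto_imp_filterlim_at_left)
    show "((exp :: real \<Rightarrow> real) \<longlongrightarrow> 1) (at_left 0)"
      using tendsto_exp[of "\<lambda>x::real. x" 0 "at_left 0"] by simp
    show "\<forall>\<^sub>F x in at_left (0::real). exp x < 1"
      unfolding eventually_at_left_field by (intro exI[of _ "-1"]) auto
  qed
  have lift_lim: "\<exists>\<theta>. ((\<lambda>x. L (Complex x t)) \<longlongrightarrow> Complex (ln r) \<theta>) (at_left 0) \<and> l = of_real r * cis \<theta>"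
    if tl: "radial_limit t l" for t l
  proof -
    have nl: "norm l = r" by (rule norm_radial_limit[OF tl])
    then have l0: "l \<noteq> 0" using r by auto
    have lim: "((\<lambda>x. F (exp (Complex x t))) \<longlongrightarrow> l) (at_left 0)"
      unfolding exp_polar using tl lim_exp unfolding radial_limit_def by (rule filterlim_compose)
    then have lim1: "((\<lambda>x. F (exp (Complex x t)) / l) \<longlongrightarrow> 1) (at_left 0)"
      using tendsto_divide[OF lim tendsto_const[of l]] l0 by simp
    have "\<forall>\<^sub>F x in at_left 0. dist (F (exp (Complex x t)) / l) 1 < 1"
      using lim1 tendstoD by fastforce
    then obtain x0 where x0: "x0 < 0" "\<And>x. x0 < x \<Longrightarrow> x < 0 \<Longrightarrow> dist (F (exp (Complex x t)) / l) 1 < 1"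
      unfolding eventually_at_left_field by auto
    define q where "q x = F (exp (Complex x t)) / l" for x
    have qpos: "0 < Re (q x)" if "x \<in> {x0<..<0}" for x
    proof -
      have "norm (q x - 1) < 1" using x0(2) that by (simp add: q_def dist_norm)
      then show ?thesis using abs_Re_le_cmod[of "q x - 1"] by simp
    qed
    have q_nonpos: "q x \<notin> \<real>\<^sub>\<le>\<^sub>0" if "x \<in> {x0<..<0}" for x
      using qpos[OF that] by (simp add: complex_nonpos_Reals_iff)
    \<comment> \<open>\<open>L\<close> along the ray is a continuous logarithm of a convergent
      function, so it differs from the principal branch near the limit by a constant and converges
      too.\<close>
    define d where "d x = L (Complex x t) - Ln (q x) - Ln l" for x
    have cC: "continuous_on A (\<lambda>x. Complex x t)" for A
      by (simp add: Complex_eq) (intro continuous_intros)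
    have contd: "continuous_on {x0<..<0} d"
      unfolding d_def q_def
      by (intro continuous_intros continuous_on_compose2[OF L(1) cC] continuous_on_compose2[OF cont] continuous_on_compose2[OF continuous_on_exp[OF continuous_on_id] cC])
        (use q_nonpos l0 in \<open>auto simp: q_def[symmetric]\<close>)
    have expd: "exp (d x) = 1" if "x \<in> {x0<..<0}" for x
    proof -
      have "q x \<noteq> 0" using qpos[OF that] by auto
      then show ?thesis using l0 that L(2)[of "Complex x t"] by (simp add: d_def exp_diff q_def)
    qed
    define x1 where "x1 = x0 / 2"
    have x1: "x1 \<in> {x0<..<0}" using x0(1) by (auto simp: x1_def)
    have dc: "d x = d x1" if "x \<in> {x0<..<0}" for x
      by (rule exp_eq_one_imp_constant[OF _ contd expd that x1]) auto
    have "((\<lambda>x. Ln (q x) + Ln l + d x1) \<longlongrightarrow> Ln 1 + Ln l + d x1) (at_left 0)"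
      unfolding q_def by (intro tendsto_intros lim1) auto
    moreover have "\<forall>\<^sub>F x in at_left 0. Ln (q x) + Ln l + d x1 = L (Complex x t)"
    proof -
      have "Ln (q x) + Ln l + d x1 = L (Complex x t)" if "x \<in> {x0<..<0}" for x
        using dc[OF that] by (simp add: d_def algebra_simps)
      then show ?thesis unfolding eventually_at_left_field using x0(1) by (intro exI[of _ x0]) auto
    qed
    ultimately have lim2: "((\<lambda>x. L (Complex x t)) \<longlongrightarrow> Ln l + d x1) (at_left 0)"
      by (simp add: tendsto_cong)
    have ex: "exp (Ln l + d x1) = l" using expd[OF x1] l0 by (simp add: exp_add)
    then have re: "Re (Ln l + d x1) = ln r"
      using nl norm_exp_eq_Re[of "Ln l + d x1"] by (metis ln_exp)
    define \<theta> where "\<theta> = Im (Ln l + d x1)"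
    have eq: "Ln l + d x1 = Complex (ln r) \<theta>" using re by (simp add: complex_eq_iff \<theta>_def)
    have "l = of_real r * cis \<theta>" using ex r by (simp add: eq exp_polar)
    then show ?thesis using lim2 eq by auto
  qed
  \<comment> \<open>Where the lifted ray has no such limit this value is arbitrary; every later use
    supposes a radial limit.\<close>
  define \<Theta> where "\<Theta> t = (THE \<theta>. ((\<lambda>x. L (Complex x t)) \<longlongrightarrow> Complex (ln r) \<theta>) (at_left 0))" for t
  have uniq: "\<theta> = \<Theta> t" if "((\<lambda>x. L (Complex x t)) \<longlongrightarrow> Complex (ln r) \<theta>) (at_left 0)" for t \<theta>
    unfolding \<Theta>_def
  proof (rule the_equality[symmetric])
    fix \<theta>'
    assume "((\<lambda>x. L (Complex x t)) \<longlongrightarrow> Complex (ln r) \<theta>') (at_left 0)"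
    from tendsto_unique[OF _ this that] show "\<theta>' = \<theta>" by simp
  qed (rule that)
  have lim\<Theta>: "((\<lambda>x. L (Complex x t)) \<longlongrightarrow> Complex (ln r) (\<Theta> t)) (at_left 0)" "l = of_real r * cis (\<Theta> t)"
    if "radial_limit t l" for t l
    using lift_lim[OF that] uniq by metis+
  have per: "\<Theta> (t + 2 * pi) = \<Theta> t + 2 * pi" if "radial_limit t l" for t l
  proof -
    have "((\<lambda>x. L (Complex x t) + 2 * pi * \<i>) \<longlongrightarrow> Complex (ln r) (\<Theta> t) + 2 * pi * \<i>) (at_left 0)"
      by (intro tendsto_intros lim\<Theta>[OF that])
    moreover have "\<forall>\<^sub>F x in at_left 0. L (Complex x t) + 2 * pi * \<i> = L (Complex x (t + 2 * pi))"
    proof -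
      have "L (Complex x t) + 2 * pi * \<i> = L (Complex x (t + 2 * pi))" if "x < 0" for x
      proof -
        have "Complex x (t + 2 * pi) = Complex x t + 2 * pi * \<i>" by (simp add: complex_eq_iff)
        then show ?thesis using L(3)[of "Complex x t"] that by simp
      qed
      then show ?thesis unfolding eventually_at_left_field by (intro exI[of _ "-1"]) auto
    qed
    moreover have "Complex (ln r) (\<Theta> t) + 2 * pi * \<i> = Complex (ln r) (\<Theta> t + 2 * pi)"
      by (simp add: complex_eq_iff)
    ultimately have "((\<lambda>x. L (Complex x (t + 2 * pi))) \<longlongrightarrow> Complex (ln r) (\<Theta> t + 2 * pi)) (at_left 0)"
      by (simp add: tendsto_cong)
    from uniq[OF this] show ?thesis by simp
  qed
  have mono: "\<Theta> s \<le> \<Theta> t" if s: "radial_limit s l" and t: "radial_limit t m" and st: "s < t" for s t l m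
  proof (rule ccontr)
    assume "\<not> \<Theta> s \<le> \<Theta> t"
    define y where "y = (\<Theta> s + \<Theta> t) / 2"
    have y: "\<Theta> t < y" "y < \<Theta> s" using \<open>\<not> _\<close> by (auto simp: y_def)
    have ims: "((\<lambda>x. Im (L (Complex x s))) \<longlongrightarrow> \<Theta> s) (at_left 0)"
      using tendsto_Im[OF lim\<Theta>(1)[OF s]] by simp
    have imt: "((\<lambda>x. Im (L (Complex x t))) \<longlongrightarrow> \<Theta> t) (at_left 0)"
      using tendsto_Im[OF lim\<Theta>(1)[OF t]] by simp
    have ret: "((\<lambda>x. Re (L (Complex x t))) \<longlongrightarrow> ln r) (at_left 0)"
      using tendsto_Re[OF lim\<Theta>(1)[OF t]] by simp
    obtain x0 where x0: "x0 < 0" "\<And>x. x0 < x \<Longrightarrow> x < 0 \<Longrightarrow> y < Im (L (Complex x s))"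
      using order_tendstoD(1)[OF ims y(2)] unfolding eventually_at_left_field by auto
    have Lre: "Re (L z) < ln r" if "Re z < 0" for z
    proof -
      have "exp z \<in> ball 0 1" using that by simp
      then have "F (exp z) \<in> ball 0 r" using image by blast
      then have "norm (exp (L z)) < r" using L(2)[OF that] by simp
      then show ?thesis using r by (simp add: norm_exp_eq_Re) (metis exp_less_cancel_iff exp_ln)
    qed
    \<comment> \<open>Close to its end the lifted ray at angle \<open>s\<close> lies above height
      \<open>y\<close>; the remainder lies in a compact disk before lifting, hence to the left of
      some \<open>B\<close>. The region to the right of \<open>B\<close> and below \<open>y\<close>
      is therefore missed.\<close>
    obtain B where B: "B < ln r" "\<And>x. x \<le> x0 \<Longrightarrow> Re (L (Complex x s)) \<le> B"
    proof -
      have sub: "cball 0 (exp x0) \<subseteq> ball (0::complex) 1"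
      proof
        fix z :: complex assume "z \<in> cball 0 (exp x0)"
        then have "norm z \<le> exp x0" by simp
        also have "\<dots> < 1" using x0(1) by simp
        finally show "z \<in> ball 0 1" by simp
      qed
      have "compact (F ` cball 0 (exp x0))"
        by (intro compact_continuous_image continuous_on_subset[OF cont sub]) auto
      then obtain w where w: "w \<in> F ` cball 0 (exp x0)" "\<And>v. v \<in> F ` cball 0 (exp x0) \<Longrightarrow> norm v \<le> norm w"
        using continuous_attains_sup[of "F ` cball 0 (exp x0)" norm] 
        by (auto intro: continuous_on_norm_id)
      have "w \<in> ball 0 r" using w(1) image sub by blast
      then have wr: "norm w < r" by simp
      have bd: "exp (Re (L (Complex x s))) \<le> norm w" if "x \<le> x0" for x
      proof -
        have "exp (Complex x s) \<in> cball 0 (exp x0)" using that by simp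
        then have "norm (F (exp (Complex x s))) \<le> norm w" using w(2) by blast
        then show ?thesis using L(2)[of "Complex x s"] that x0(1) by (metis norm_exp_eq_Re complex.sel(1) order_le_less_trans)
      qed
      have wpos: "0 < norm w" using bd[of x0] by (metis exp_gt_zero less_le_trans order_refl)
      show thesis
      proof (rule that[of "ln (norm w)"])
        show "ln (norm w) < ln r" using wr wpos r by simp
        show "Re (L (Complex x s)) \<le> ln (norm w)" if "x \<le> x0" for x
          using bd[OF that] wpos by (simp add: ln_ge_iff)
      qed
    qed
    define R where "R = {w. B < Re w} \<inter> {w. Re w < ln r} \<inter> {w. Im w < y}"
    have "convex R"
      unfolding R_def by (intro convex_Int convex_halfspace_Re_lt convex_halfspace_Re_gt convex_halfspace_Im_lt)
    then have "connected R" by (rule convex_connected)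
    have RK: "R \<subseteq> {w. Re w < ln r}" by (auto simp: R_def)
    have "connected (M ` R)"
      by (intro connected_continuous_image continuous_on_subset[OF M(1) RK] \<open>connected R\<close>)
    then have conI: "connected (Im ` M ` R)"
      by (rule connected_continuous_image[rotated]) (intro continuous_intros)
    have avoid: "s \<notin> Im ` M ` R"
    proof
      assume "s \<in> Im ` M ` R"
      then obtain w where w: "w \<in> R" "Im (M w) = s" by auto
      define x where "x = Re (M w)"
      have Mw: "M w = Complex x s" using w(2) by (simp add: x_def complex_eq_iff)
      have x: "x < 0" using M(4)[of w] w(1) by (simp add: x_def R_def)
      have Lw: "L (Complex x s) = w" using M(3)[of w] w(1) Mw by (simp add: R_def)
      show False
      proof (cases "x \<le> x0")
        case True
        then show ?thesis using B(2)[of x] Lw w(1) by (simp add: R_def)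
      next
        case False
        then show ?thesis using x0(2)[of x] x Lw w(1) by (simp add: R_def)
      qed
    qed
    obtain w0 where w0: "w0 \<in> R"
    proof -
      have "Complex ((B + ln r) / 2) (y - 1) \<in> R" using B(1) by (simp add: R_def)
      then show thesis using that by blast
    qed
    \<comment> \<open>\<open>R\<close> is stable under downward shifts by 2 pi and \<open>M\<close>
      commutes with them, so the angles attained on \<open>R\<close> are unbounded below.\<close>
    have shift: "w0 - 2 * pi * of_nat n * \<i> \<in> R \<and> M (w0 - 2 * pi * of_nat n * \<i>) = M w0 - 2 * pi * of_nat n * \<i>" for n
    proof (induction n)
      case 0
      then show ?case using w0 by simp
    next
      case (Suc n)
      define w where "w = w0 - 2 * pi * of_nat n * \<i>"
      define w' where "w' = w - 2 * pi * \<i>"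
      have w: "w \<in> R" "M w = M w0 - 2 * pi * of_nat n * \<i>" using Suc by (auto simp: w_def)
      have "Im w - 2 * pi < y" using w(1) pi_gt_zero unfolding R_def by (simp, linarith)
      then have w': "w' \<in> R" using w(1) by (simp add: R_def w'_def)
      have rw: "Re w' < ln r" using w' by (simp add: R_def)
      have "L (M w' + 2 * pi * \<i>) = w" using L(3)[OF M(4)[OF rw]] M(3)[OF rw] by (simp add: w'_def)
      moreover have "M (L (M w' + 2 * pi * \<i>)) = M w' + 2 * pi * \<i>"
        using M(4)[OF rw] by (intro M(2)) simp
      ultimately have "M w' = M w - 2 * pi * \<i>" by simp
      moreover have "w' = w0 - 2 * pi * of_nat (Suc n) * \<i>" by (simp add: w'_def w_def algebra_simps)
      moreover have "M w - 2 * pi * \<i> = M w0 - 2 * pi * of_nat (Suc n) * \<i>"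
        using w(2) by (simp add: algebra_simps)
      ultimately show ?case using w' by simp
    qed
    obtain n :: nat where n: "Im (M w0) - s < real n" using reals_Archimedean2 by blast
    have "Im (M w0) - 2 * pi * real n < s"
    proof -
      have "1 * real n \<le> (2 * pi) * real n" using pi_gt3 by (intro mult_right_mono) auto
      then show ?thesis using n by linarith
    qed
    then have "Im (M (w0 - 2 * pi * of_nat n * \<i>)) < s" using shift[of n] by simp
    moreover have "Im (M (w0 - 2 * pi * of_nat n * \<i>)) \<in> Im ` M ` R" using shift[of n] by blast
    ultimately obtain a where a: "a \<in> Im ` M ` R" "a < s" by blast
    have "\<exists>x. x < 0 \<and> B < Re (L (Complex x t)) \<and> Im (L (Complex x t)) < y"
    proof -
      have "\<forall>\<^sub>F x in at_left 0. x < 0 \<and> B < Re (L (Complex x t)) \<and> Im (L (Complex x t)) < y"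
        using order_tendstoD(1)[OF ret B(1)] order_tendstoD(2)[OF imt y(1)]
        by (auto simp: eventually_conj_iff eventually_at_filter)
      then show ?thesis by (rule eventually_happens'[rotated]) simp
    qed
    then obtain x where x: "x < 0" "B < Re (L (Complex x t))" "Im (L (Complex x t)) < y" by blast
    have "L (Complex x t) \<in> R" using x Lre[of "Complex x t"] by (simp add: R_def)
    then have "t \<in> Im ` M ` R" using M(2)[of "Complex x t"] x(1) by force
    \<comment> \<open>The angles attained on \<open>R\<close> form an interval; it contains
      \<open>a\<close> below \<open>s\<close> and \<open>t\<close> above it, hence also
      \<open>s\<close>.\<close>
    then have "s \<in> Im ` M ` R"
      using conI a st unfolding connected_iff_interval by (meson less_imp_le)
    then show False using avoid by simp
  qed
  show ?thesis using lim\<Theta>(2) per mono by blast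
qed

text \<open>The argument is determined only at angles with a radial limit. These are dense, being
  the complement of a null set, and a supremum from the left extends the argument to a monotone
  function on the line without changing it there.\<close>

lemma boundary_function:
  assumes N: "negligible N" and lim: "\<And>t. t \<notin> N \<Longrightarrow> \<exists>l. radial_limit t l"
  shows "\<exists>\<theta>. mono \<theta> \<and> (\<forall>t. \<theta> (t + 2 * pi) = \<theta> t + 2 * pi) \<and>
    (\<forall>t. t \<notin> N \<longrightarrow> radial_limit t (of_real r * cis (\<theta> t)))"
proof -
  obtain \<Theta> where \<Theta>: "\<And>t l. radial_limit t l \<Longrightarrow> l = of_real r * cis (\<Theta> t)"
    "\<And>t l. radial_limit t l \<Longrightarrow> \<Theta> (t + 2 * pi) = \<Theta> t + 2 * pi"
    "\<And>s t l m. radial_limit s l \<Longrightarrow> radial_limit t m \<Longrightarrow> s < t \<Longrightarrow> \<Theta> s \<le> \<Theta> t"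
    using monotone_argument by blast
  define E where "E = {t. \<exists>l. radial_limit t l}"
  have Emono: "\<Theta> s \<le> \<Theta> t" if "s \<in> E" "t \<in> E" "s \<le> t" for s t
    using that \<Theta>(3)[of s _ t] by (cases "s = t") (auto simp: E_def)
  have Eper: "t + 2 * pi \<in> E \<longleftrightarrow> t \<in> E" for t 
    unfolding E_def mem_Collect_eq using radial_limit_periodic by metis
  have dense: "\<exists>s\<in>E. a < s \<and> s < b" if "a < b" for a b
  proof (rule ccontr)
    assume "\<not> ?thesis"
    then have "box a b \<subseteq> N" using lim by (force simp: E_def)
    then have "negligible (box a b)" using N negligible_subset by blast
    then show False using that negligible_interval(2)[of a b] by simp
  qed
  define \<theta> where "\<theta> t = Sup (\<Theta> ` {s\<in>E. s \<le> t})" for t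
  have ne: "\<Theta> ` {s\<in>E. s \<le> t} \<noteq> {}" for t using dense[of "t - 1" t] by force
  have bdd: "bdd_above (\<Theta> ` {s\<in>E. s \<le> t})" for t
  proof -
    obtain b where "b \<in> E" "t < b" using dense[of t "t + 1"] by auto
    then show ?thesis by (intro bdd_aboveI[of _ "\<Theta> b"]) (auto intro!: Emono)
  qed
  have eq: "\<theta> t = \<Theta> t" if "t \<in> E" for t
    unfolding \<theta>_def by (rule cSup_eq_maximum) (use that Emono in auto)
  have "mono \<theta>"
    unfolding \<theta>_def by (intro monoI cSup_subset_mono ne bdd) auto
  moreover have "\<theta> (t + 2 * pi) = \<theta> t + 2 * pi" for t
  proof -
    have "{s\<in>E. s \<le> t + 2 * pi} = (\<lambda>s. s + 2 * pi) ` {s\<in>E. s \<le> t}"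
    proof -
      have "s \<in> (\<lambda>s. s + 2 * pi) ` {s\<in>E. s \<le> t}" if "s \<in> E" "s \<le> t + 2 * pi" for s
        using that Eper[of "s - 2 * pi"] by (intro image_eqI[of _ _ "s - 2 * pi"]) auto
      then show ?thesis using Eper by auto
    qed
    then have "\<Theta> ` {s\<in>E. s \<le> t + 2 * pi} = (\<lambda>y. 2 * pi + y) ` \<Theta> ` {s\<in>E. s \<le> t}"
      using \<Theta>(2) by (auto simp: image_image E_def add.commute intro!: image_cong)
    then show ?thesis
      unfolding \<theta>_def
      using continuous_at_Sup_mono[of "\<lambda>y. 2 * pi + y", OF _ _ ne[of t] bdd[of t]]
      by (simp add: mono_def continuous_intros add.commute)
  qed
  moreover have "radial_limit t (of_real r * cis (\<theta> t))" if "t \<notin> N" for t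
  proof -
    from lim[OF \<open>t \<notin> N\<close>] obtain l where l: "radial_limit t l" ..
    then have "t \<in> E" by (auto simp: E_def)
    with \<Theta>(1)[OF l] l eq show ?thesis by simp
  qed
  ultimately show ?thesis by blast
qed

end

section \<open>Existence of radial limits\<close>

text \<open>The change of variables theorem is available for \<open>real^'n\<close>, Tonelli's theorem for pairs;
  \<open>vec2\<close> translates between the two.\<close>

definition vec2 :: "real \<times> real \<Rightarrow> real^2" where
  "vec2 p = (\<chi> i. if i = 1 then fst p else snd p)"

lemma vec2_nth [simp]: "vec2 p $ 1 = fst p" "vec2 p $ 2 = snd p"
  by (simp_all add: vec2_def)

lemma vec2_linear: "linear vec2"
  by (rule linearI) (auto simp: vec2_def vec_eq_iff)

lemma vec2_measurable: "vec2 \<in> borel_measurable borel"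
  using linear_continuous_on[OF linear_conv_bounded_linear[THEN iffD1, OF vec2_linear]]
  by (intro borel_measurable_continuous_onI)

lemma Basis_real2: "(Basis :: (real^2) set) = {axis 1 1, axis 2 1}"
  by (auto simp: Basis_vec_def UNIV_2)

lemma lborel_real2: "(lborel :: (real^2) measure) = distr (lborel \<Otimes>\<^sub>M lborel) borel vec2"
proof (rule lborel_eqI)
  fix l u :: "real^2"
  assume lu: "\<And>b. b \<in> Basis \<Longrightarrow> l \<bullet> b \<le> u \<bullet> b"
  have le: "l $ 1 \<le> u $ 1" "l $ 2 \<le> u $ 2"
    using lu[of "axis 1 1"] lu[of "axis 2 1"] by (auto simp: Basis_real2 inner_axis)
  have vim: "vec2 -` box l u = {l$1<..<u$1} \<times> {l$2<..<u$2}"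
    by (auto simp: mem_box_cart forall_2)
  have "emeasure (distr (lborel \<Otimes>\<^sub>M lborel) borel vec2) (box l u) = emeasure (lborel \<Otimes>\<^sub>M lborel) ({l$1<..<u$1} \<times> {l$2<..<u$2})"
    using vec2_measurable by (subst emeasure_distr) (auto simp: vim lborel_prod space_pair_measure)
  also have "\<dots> = ennreal (u$1 - l$1) * ennreal (u$2 - l$2)"
    using le by (subst lborel.emeasure_pair_measure_Times) auto
  also have "\<dots> = (\<Prod>b\<in>Basis. (u - l) \<bullet> b)"
    using le by (simp add: Basis_real2 axis_eq_axis inner_axis ennreal_mult)
  finally show "emeasure (distr (lborel \<Otimes>\<^sub>M lborel) borel vec2) (box l u) = (\<Prod>b\<in>Basis. (u - l) \<bullet> b)" .
qed simp

section \<open>Polar coordinates and finite area\<close>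

definition polar :: "real^2 \<Rightarrow> complex" where
  "polar x = of_real (x $ 1) * cis (x $ 2)"

text \<open>Radii above 1/2 keep the factor \<open>x $ 1\<close> of the area element away from 0;
  the open period of angles makes \<open>polar\<close> injective.\<close>

definition polar_strip :: "(real^2) set" where
  "polar_strip = box (vec2 (1/2, 0)) (vec2 (1, 2*pi))"

lemma polar_strip_iff: "x \<in> polar_strip \<longleftrightarrow> 1/2 < x $ 1 \<and> x $ 1 < 1 \<and> 0 < x $ 2 \<and> x $ 2 < 2 * pi"
  by (auto simp: polar_strip_def mem_box_cart forall_2)

lemma polar_in_ball: "x \<in> polar_strip \<Longrightarrow> polar x \<in> ball 0 1"
  by (simp add: polar_def polar_strip_iff norm_mult)

lemma inj_on_polar: "inj_on polar polar_strip"
proof (rule inj_onI)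
  fix x y assume x: "x \<in> polar_strip" and y: "y \<in> polar_strip" and eq: "polar x = polar y"
  have "norm (polar z) = z $ 1 \<and> Arg2pi (polar z) = z $ 2" if "z \<in> polar_strip" for z
  proof
    show "norm (polar z) = z $ 1" using that by (simp add: polar_def norm_mult polar_strip_iff)
    show "Arg2pi (polar z) = z $ 2"
      using that by (intro Arg2pi_unique[of "z $ 1"]) (auto simp: polar_def polar_strip_iff cis_conv_exp)
  qed
  from this[OF x] this[OF y] eq show "x = y" by (simp add: vec_eq_iff forall_2)
qed

lemma polar_has_derivative:
  "(polar has_derivative (\<lambda>v. of_real (v $ 1) * cis (x $ 2) + of_real (x $ 1 * v $ 2) * (\<i> * cis (x $ 2)))) (at x within S)"
proof -
  have n: "((\<lambda>x::real^2. x $ i) has_derivative (\<lambda>v. v $ i)) (at x within S)" for i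
    by (rule bounded_linear.has_derivative[OF bounded_linear_vec_nth has_derivative_ident])
  have c: "((\<lambda>x::real^2. cis (x $ 2)) has_derivative (\<lambda>v. of_real (v $ 2) * (\<i> * cis (x $ 2)))) (at x within S)"
  proof -
    have "((\<lambda>z. exp (\<i> * z)) has_field_derivative \<i> * cis (x $ 2)) (at (of_real (x $ 2)))"
      by (auto intro!: derivative_eq_intros simp: cis_conv_exp)
    then have "((\<lambda>z. exp (\<i> * z)) has_derivative (*) (\<i> * cis (x $ 2))) (at (of_real (x $ 2)))"
      by (simp add: has_field_derivative_def)
    from has_derivative_compose[OF has_derivative_of_real[OF n] this]
    show ?thesis by (simp add: cis_conv_exp mult_ac)
  qed
  have "(polar has_derivative (\<lambda>v. of_real (x $ 1) * (of_real (v $ 2) * (\<i> * cis (x $ 2))) + of_real (v $ 1) * cis (x $ 2))) (at x within S)"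
    unfolding polar_def
    by (intro has_derivative_mult c has_derivative_of_real n)
  then show ?thesis by (simp add: algebra_simps)
qed

definition complex_vec2 :: "complex \<Rightarrow> real^2" where
  "complex_vec2 z = vec2 (Re z, Im z)"

lemma complex_vec2_bounded_linear: "bounded_linear complex_vec2"
  unfolding linear_conv_bounded_linear[symmetric]
  by (rule linearI) (auto simp: complex_vec2_def vec2_def vec_eq_iff)

lemma det_polar_derivative:
  fixes d c :: complex and \<rho> :: real
  assumes "norm c = 1"
  shows "det (matrix (\<lambda>v::real^2. complex_vec2 (d * (of_real (v $ 1) * c + of_real (\<rho> * v $ 2) * (\<i> * c))))) = \<rho> * (norm d)\<^sup>2"
proof -
  define w where "w = d * c"
  have e: "d * (of_real a * c + of_real (\<rho> * b) * (\<i> * c)) = of_real a * w + of_real (\<rho> * b) * (\<i> * w)" for a b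
    by (simp add: w_def algebra_simps)
  have "(norm d)\<^sup>2 = (norm w)\<^sup>2" using assms by (simp add: w_def norm_mult)
  also have "\<dots> = (Re w)\<^sup>2 + (Im w)\<^sup>2" by (rule cmod_power2)
  finally have n: "(norm d)\<^sup>2 = (Re w)\<^sup>2 + (Im w)\<^sup>2" .
  show ?thesis
    unfolding det_2 matrix_def e n
    by (simp add: complex_vec2_def axis_def power2_eq_square algebra_simps)
qed

text \<open>The integrand is the Jacobian of \<open>h\<close> in polar coordinates. By injectivity
  its integral is the area of a bounded open set.\<close>

lemma area_integrand_integrable:
  assumes hol: "h holomorphic_on ball 0 1" and inj: "inj_on h (ball 0 1)" and bdd: "bounded (h ` ball 0 1)"
  shows "(\<lambda>x. x $ 1 * (norm (deriv h (polar x)))\<^sup>2) absolutely_integrable_on polar_strip"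
proof -
  define \<Phi> where "\<Phi> x = complex_vec2 (h (polar x))" for x
  define \<Phi>' where "\<Phi>' x v = complex_vec2 (deriv h (polar x) * (of_real (v $ 1) * cis (x $ 2) + of_real (x $ 1 * v $ 2) * (\<i> * cis (x $ 2))))"
    for x v :: "real^2"
  have der: "(\<Phi> has_derivative \<Phi>' x) (at x within polar_strip)" if x: "x \<in> polar_strip" for x
  proof -
    have "(h has_derivative (*) (deriv h (polar x))) (at (polar x))"
      using holomorphic_derivI[OF hol open_ball polar_in_ball[OF x]] by (simp add: has_field_derivative_def)
    from bounded_linear.has_derivative[OF complex_vec2_bounded_linear has_derivative_compose[OF polar_has_derivative this]]
    show ?thesis by (simp add: \<Phi>_def[abs_def] \<Phi>'_def[abs_def])
  qed
  have injv: "inj complex_vec2"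
    by (rule injI) (metis complex_vec2_def complex_eqI vec2_nth fst_conv snd_conv)
  have inj\<Phi>: "inj_on \<Phi> polar_strip"
    unfolding \<Phi>_def
    by (intro inj_onI) (metis inj inj_on_polar inj_onD injv injD polar_in_ball)
  have cont: "continuous_on polar_strip \<Phi>"
    using der has_derivative_continuous_on by blast
  have "open (\<Phi> ` polar_strip)"
    by (rule invariance_of_domain[OF cont _ inj\<Phi>]) (simp add: polar_strip_def open_box)
  moreover have "bounded (\<Phi> ` polar_strip)"
  proof (rule bounded_subset)
    show "bounded (complex_vec2 ` h ` ball 0 1)"
      by (rule bounded_linear_image[OF bdd complex_vec2_bounded_linear])
    show "\<Phi> ` polar_strip \<subseteq> complex_vec2 ` h ` ball 0 1"
      using polar_in_ball by (auto simp: \<Phi>_def simp del: mem_ball_0)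
  qed
  ultimately have "\<Phi> ` polar_strip \<in> lmeasurable" by (intro lmeasurable_open)
  then have "(\<lambda>x. \<bar>det (matrix (\<Phi>' x))\<bar>) absolutely_integrable_on polar_strip"
    using measurable_differentiable_image_alt[OF _ der inj\<Phi>] by (simp add: polar_strip_def)
  moreover have "\<bar>det (matrix (\<Phi>' x))\<bar> = x $ 1 * (norm (deriv h (polar x)))\<^sup>2" if "x \<in> polar_strip" for x
    using det_polar_derivative[of "cis (x $ 2)" "deriv h (polar x)" "x $ 1"] that
    by (simp add: \<Phi>'_def[abs_def] polar_strip_iff abs_mult)
  ultimately show ?thesis
    by (simp cong: set_integrable_cong)
qed

text \<open>Since |h'| \<le> 1 + |h'|^2 \<le> 1 + 2 \<rho> |h'|^2 for \<rho> > 1/2, finite area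
  makes the double integral of |h'| finite. By Tonelli almost every ray then has an image of finite
  length.\<close>

lemma radial_length_finite_AE:
  assumes hol: "h holomorphic_on ball 0 1" and inj: "inj_on h (ball 0 1)" and bdd: "bounded (h ` ball 0 1)"
  shows "AE t in lborel. t \<in> {0<..<2*pi} \<longrightarrow>
    (\<integral>\<^sup>+\<rho>. indicator {1/2<..<1} \<rho> * ennreal (norm (deriv h (of_real \<rho> * cis t))) \<partial>lborel) \<noteq> \<infinity>"
proof -
  define k where "k x = norm (deriv h (polar x))" for x
  define K where "K x = ennreal (indicator polar_strip x *\<^sub>R k x)" for x
  have os: "open polar_strip" by (simp add: polar_strip_def open_box)
  have contk: "continuous_on polar_strip k"
    unfolding k_def
    using has_derivative_continuous_on[OF polar_has_derivative, of polar_strip] polar_in_ball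
    by (intro continuous_intros continuous_on_compose2[OF holomorphic_on_imp_continuous_on[OF holomorphic_deriv[OF hol open_ball]]]) auto
  have meas: "(\<lambda>x. indicator polar_strip x *\<^sub>R k x) \<in> borel_measurable borel"
    using os by (intro borel_measurable_continuous_on_indicator contk) auto
  then have [measurable]: "K \<in> borel_measurable borel" unfolding K_def by simp
  have "set_integrable lebesgue polar_strip (\<lambda>x. 1 + 2 * (x $ 1 * (k x)\<^sup>2))"
  proof -
    have "(\<lambda>x. 1::real) absolutely_integrable_on polar_strip"
      unfolding polar_strip_def by (simp add: absolutely_integrable_on_const lmeasurable_box)
    moreover have "(\<lambda>x. 2 * (x $ 1 * (k x)\<^sup>2)) absolutely_integrable_on polar_strip"
      unfolding k_def by (intro set_integrable_mult_right area_integrand_integrable assms)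
    ultimately show ?thesis by (rule set_integral_add)
  qed
  then have "(\<integral>\<^sup>+x. ennreal (norm (indicator polar_strip x *\<^sub>R (1 + 2 * (x $ 1 * (k x)\<^sup>2)))) \<partial>lebesgue) < \<infinity>"
    unfolding set_integrable_def integrable_iff_bounded by blast
  moreover have "(\<integral>\<^sup>+x. K x \<partial>lborel) \<le> (\<integral>\<^sup>+x. ennreal (norm (indicator polar_strip x *\<^sub>R (1 + 2 * (x $ 1 * (k x)\<^sup>2)))) \<partial>lborel)"
  proof (rule nn_integral_mono)
    fix x :: "real^2"
    show "K x \<le> ennreal (norm (indicator polar_strip x *\<^sub>R (1 + 2 * (x $ 1 * (k x)\<^sup>2))))"
    proof (cases "x \<in> polar_strip")
      case True
      have "k x \<le> 1 + (k x)\<^sup>2"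
      proof -
        have "2 * k x \<le> (k x)\<^sup>2 + 1" using zero_le_power2[of "k x - 1"] unfolding power2_diff by simp
        then show ?thesis using zero_le_power2[of "k x"] by linarith
      qed
      also have "(k x)\<^sup>2 \<le> 2 * x $ 1 * (k x)\<^sup>2"
        using True mult_right_mono[of 1 "2 * x $ 1" "(k x)\<^sup>2"] by (simp add: polar_strip_iff)
      finally have "k x \<le> 1 + 2 * (x $ 1 * (k x)\<^sup>2)" by simp
      then show ?thesis using True by (auto simp: K_def intro!: ennreal_leI)
    qed (simp add: K_def)
  qed
  ultimately have "(\<integral>\<^sup>+x. K x \<partial>lborel) < \<infinity>"
    unfolding nn_integral_completion using le_less_trans by blast
  then have "(\<integral>\<^sup>+p. K (vec2 p) \<partial>(lborel \<Otimes>\<^sub>M lborel)) < \<infinity>"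
    unfolding lborel_real2 using vec2_measurable
    by (subst (asm) nn_integral_distr) (auto simp: lborel_prod)
  moreover have Km: "(\<lambda>p. K (vec2 p)) \<in> borel_measurable (lborel \<Otimes>\<^sub>M lborel)"
    using vec2_measurable by (auto simp: lborel_prod intro: measurable_compose[OF vec2_measurable])
  ultimately have "(\<integral>\<^sup>+t. (\<integral>\<^sup>+\<rho>. K (vec2 (\<rho>, t)) \<partial>lborel) \<partial>lborel) \<noteq> \<infinity>"
    using lborel_pair.nn_integral_snd[OF Km] by simp
  moreover have "(\<lambda>t. \<integral>\<^sup>+\<rho>. K (vec2 (\<rho>, t)) \<partial>lborel) \<in> borel_measurable lborel"
    using measurable_pair_swap[OF Km] by (intro lborel.borel_measurable_nn_integral) (simp add: split_def)
  ultimately have "AE t in lborel. (\<integral>\<^sup>+\<rho>. K (vec2 (\<rho>, t)) \<partial>lborel) \<noteq> \<infinity>"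
    by (intro nn_integral_PInf_AE)
  then show ?thesis
  proof (rule AE_mp[OF _ AE_I2], intro impI)
    fix t assume fin: "(\<integral>\<^sup>+\<rho>. K (vec2 (\<rho>, t)) \<partial>lborel) \<noteq> \<infinity>" and t: "t \<in> {0<..<2*pi}"
    have "K (vec2 (\<rho>, t)) = indicator {1/2<..<1} \<rho> * ennreal (norm (deriv h (of_real \<rho> * cis t)))" for \<rho>
      using t by (auto simp: K_def k_def polar_def polar_strip_iff indicator_def)
    then show "(\<integral>\<^sup>+\<rho>. indicator {1/2<..<1} \<rho> * ennreal (norm (deriv h (of_real \<rho> * cis t))) \<partial>lborel) \<noteq> \<infinity>"
      using fin by simp
  qed
qed

text \<open>The derivative along the ray is integrable up to the boundary, and an indefinite
  integral is continuous at its endpoint. With \<open>f\<close> separate from \<open>h\<close>, one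
  length bound serves both halves of the harmonic map.\<close>

lemma radial_limit_exists:
  assumes hol: "f holomorphic_on ball 0 1" "h holomorphic_on ball 0 1"
    and le: "\<And>z. norm z < 1 \<Longrightarrow> norm (deriv f z) \<le> norm (deriv h z)"
    and fin: "(\<integral>\<^sup>+\<rho>. indicator {1/2<..<1} \<rho> * ennreal (norm (deriv h (of_real \<rho> * cis t))) \<partial>lborel) \<noteq> \<infinity>"
  shows "\<exists>l. ((\<lambda>\<rho>. f (of_real \<rho> * cis t)) \<longlongrightarrow> l) (at_left 1)"
proof -
  define v where "v \<rho> = cis t * deriv f (of_real \<rho> * cis t)" for \<rho> :: real
  have inb: "of_real \<rho> * cis t \<in> ball 0 1" if "0 \<le> \<rho>" "\<rho> < 1" for \<rho> :: real
    using that by (simp add: norm_mult)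
  have contv: "continuous_on {1/2<..<1} v"
    unfolding v_def
    by (intro continuous_intros continuous_on_compose2[OF holomorphic_on_imp_continuous_on[OF holomorphic_deriv[OF hol(1) open_ball]]])
      (auto simp: norm_mult)
  have "integrable lborel (\<lambda>\<rho>. indicator {1/2<..<1} \<rho> *\<^sub>R v \<rho>)"
    unfolding integrable_iff_bounded
  proof
    show "(\<lambda>\<rho>. indicator {1/2<..<1} \<rho> *\<^sub>R v \<rho>) \<in> borel_measurable lborel"
      using borel_measurable_continuous_on_indicator[OF _ contv] by simp
    have "(\<integral>\<^sup>+\<rho>. ennreal (norm (indicator {1/2<..<1} \<rho> *\<^sub>R v \<rho>)) \<partial>lborel)
       \<le> (\<integral>\<^sup>+\<rho>. indicator {1/2<..<1} \<rho> * ennreal (norm (deriv h (of_real \<rho> * cis t))) \<partial>lborel)"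
      by (intro nn_integral_mono) (auto simp: indicator_def v_def norm_mult intro!: ennreal_leI le)
    also have "\<dots> < \<infinity>" using fin by (simp add: top.not_eq_extremum)
    finally show "(\<integral>\<^sup>+\<rho>. ennreal (norm (indicator {1/2<..<1} \<rho> *\<^sub>R v \<rho>)) \<partial>lborel) < \<infinity>" .
  qed
  then have "v integrable_on {1/2<..<1}"
    by (intro set_borel_integral_eq_integral(1)) (simp add: set_integrable_def)
  then have "v integrable_on {1/2..1}" by (simp add: integrable_on_open_interval_real)
  then have "continuous_on {1/2..1} (\<lambda>x. integral {1/2..x} v)"
    by (rule indefinite_integral_continuous_1)
  then have "((\<lambda>x. integral {1/2..x} v) \<longlongrightarrow> integral {1/2..1} v) (at 1 within {1/2..1})"
    by (simp add: continuous_on)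
  then have "((\<lambda>x. integral {1/2..x} v) \<longlongrightarrow> integral {1/2..1} v) (at_left 1)"
    by (simp add: at_within_Icc_at_left)
  then have "((\<lambda>x. f (of_real (1/2) * cis t) + integral {1/2..x} v) \<longlongrightarrow> f (of_real (1/2) * cis t) + integral {1/2..1} v) (at_left 1)"
    by (intro tendsto_intros)
  moreover have "\<forall>\<^sub>F x in at_left 1. f (of_real (1/2) * cis t) + integral {1/2..x} v = f (of_real x * cis t)"
  proof -
    have "f (of_real (1/2) * cis t) + integral {1/2..x} v = f (of_real x * cis t)" if x: "1/2 < x" "x < 1" for x :: real
    proof -
      have "(v has_integral (f (of_real x * cis t) - f (of_real (1/2) * cis t))) {1/2..x}"
      proof (rule fundamental_theorem_of_calculus)
        show "1/2 \<le> x" using x by simp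
        fix y assume "y \<in> {1/2..x}"
        then have "of_real y * cis t \<in> ball 0 1" using x by (intro inb) auto
        then have d: "(f has_field_derivative deriv f (of_real y * cis t)) (at (of_real y * cis t))"
          using holomorphic_derivI[OF hol(1) open_ball] by blast
        have "((\<lambda>y. of_real y * cis t) has_vector_derivative cis t) (at y within {1/2..x})"
          by (auto intro!: derivative_eq_intros simp: has_vector_derivative_def scaleR_conv_of_real)
        from field_vector_diff_chain_within[OF this DERIV_subset[OF d subset_UNIV]]
        show "((\<lambda>x. f (of_real x * cis t)) has_vector_derivative v y) (at y within {1/2..x})"
          by (simp add: o_def v_def)
      qed
      then show ?thesis by (simp add: integral_unique)
    qed
    then show ?thesis unfolding eventually_at_left_field by (intro exI[of _ "1/2"]) auto
  qed
  ultimately have "((\<lambda>\<rho>. f (of_real \<rho> * cis t)) \<longlongrightarrow> f (of_real (1/2) * cis t) + integral {1/2..1} v) (at_left 1)"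
    by (rule Lim_transform_eventually)
  then show ?thesis by blast
qed

lemma radial_limits_negligible:
  assumes hol: "h holomorphic_on ball 0 1" "g holomorphic_on ball 0 1"
    and inj: "inj_on h (ball 0 1)" and bdd: "bounded (h ` ball 0 1)"
    and le: "\<And>z. norm z < 1 \<Longrightarrow> norm (deriv g z) \<le> norm (deriv h z)"
  shows "negligible {t. \<not> (\<exists>l. ((\<lambda>\<rho>. h (of_real \<rho> * cis t) + cnj (g (of_real \<rho> * cis t))) \<longlongrightarrow> l) (at_left 1))}"
    (is "negligible ?B")
proof -
  define A where "A = ?B \<inter> {0<..<2*pi}"
  have "AE t in lborel. t \<notin> A"
  proof (rule AE_mp[OF radial_length_finite_AE[OF hol(1) inj bdd] AE_I2], intro impI notI)
    fix t
    assume fin: "t \<in> {0<..<2*pi} \<longrightarrow> (\<integral>\<^sup>+\<rho>. indicator {1/2<..<1} \<rho> * ennreal (norm (deriv h (of_real \<rho> * cis t))) \<partial>lborel) \<noteq> \<infinity>"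
      and t: "t \<in> A"
    obtain l where "((\<lambda>\<rho>. h (of_real \<rho> * cis t)) \<longlongrightarrow> l) (at_left 1)"
      using radial_limit_exists[OF hol(1) hol(1)] fin t by (auto simp: A_def)
    moreover obtain m where "((\<lambda>\<rho>. g (of_real \<rho> * cis t)) \<longlongrightarrow> m) (at_left 1)"
      using radial_limit_exists[OF hol(2) hol(1) le] fin t by (auto simp: A_def)
    ultimately have "((\<lambda>\<rho>. h (of_real \<rho> * cis t) + cnj (g (of_real \<rho> * cis t))) \<longlongrightarrow> l + cnj m) (at_left 1)"
      by (intro tendsto_intros)
    then show False using t by (auto simp: A_def)
  qed
  then obtain N where "N \<in> null_sets lborel" "A \<subseteq> N"
    by (auto simp: eventually_ae_filter)
  then have A: "negligible A"
    by (meson negligible_iff_null_sets negligible_subset null_sets_completionI)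
  have per: "t \<in> ?B \<longleftrightarrow> t + 2 * pi * of_int n \<in> ?B" for t n
  proof -
    have "cis (t + 2 * pi * of_int n) = cis t"
      using cis_mult[of t "2 * pi * of_int n"] cis_multiple_2pi[of "of_int n"] by simp
    then show ?thesis by simp
  qed
  \<comment> \<open>The bad set is 2 pi-periodic; the angle 0 is added because the previous argument
    covers only the open period.\<close>
  have "negligible (\<Union>n::int. ((+) (2 * pi * of_int n)) ` (A \<union> {0}))"
    by (intro negligible_countable_Union) (auto intro!: negligible_translation negligible_Un A)
  moreover have "?B \<subseteq> (\<Union>n::int. ((+) (2 * pi * of_int n)) ` (A \<union> {0}))"
  proof
    fix t assume t: "t \<in> ?B"
    define n where "n = \<lfloor>t / (2 * pi)\<rfloor>"
    define s where "s = t - 2 * pi * of_int n"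
    have "of_int n \<le> t / (2 * pi)" "t / (2 * pi) < of_int n + 1" by (auto simp: n_def)
    then have "0 \<le> s" "s < 2 * pi" using pi_gt_zero by (auto simp: s_def field_simps)
    moreover have "s \<in> ?B" using per[of t "- n"] t by (simp add: s_def)
    ultimately have "s \<in> A \<union> {0}" by (auto simp: A_def)
    moreover have "t = 2 * pi * of_int n + s" by (simp add: s_def)
    ultimately show "t \<in> (\<Union>n::int. ((+) (2 * pi * of_int n)) ` (A \<union> {0}))" by blast
  qed
  ultimately show ?thesis by (rule negligible_subset)
qed

section \<open>The coefficient estimate for harmonic maps onto a disk\<close>

text \<open>A Moebius map sending \<open>Q 0\<close> to 0 reduces this to the Schwarz lemma; its
  derivative at \<open>Q 0\<close> is 1 / (1 - |Q 0|^2).\<close>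

lemma Schwarz_Pick_at_zero:
  assumes hol: "Q holomorphic_on ball 0 1" and lt: "\<And>z. norm z < 1 \<Longrightarrow> norm (Q z) < 1"
  shows "norm (deriv Q 0) \<le> 1 - (norm (Q 0))\<^sup>2"
proof -
  define m where "m = Moebius_function 0 (Q 0)"
  have q: "norm (Q 0) < 1" using lt[of 0] by simp
  have q2: "(norm (Q 0))\<^sup>2 < 1" using q by (simp add: abs_square_less_1)
  have m_hol: "m holomorphic_on ball 0 1" unfolding m_def by (rule Moebius_function_holomorphic[OF q])
  have "(\<lambda>z. m (Q z)) holomorphic_on ball 0 1"
    using holomorphic_on_compose_gen[OF hol m_hol] lt by (auto simp: o_def image_subset_iff)
  moreover have "m (Q 0) = 0" by (simp add: m_def Moebius_function_def)
  moreover have "norm (m (Q z)) < 1" if "norm z < 1" for z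
    unfolding m_def by (rule Moebius_function_norm_lt_1[OF q lt[OF that]])
  ultimately have S: "norm (deriv (\<lambda>z. m (Q z)) 0) \<le> 1"
    using Schwarz_Lemma(2)[of "\<lambda>z. m (Q z)" 0] by simp
  have nz: "1 - cnj (Q 0) * Q 0 \<noteq> 0"
    using q2 by (metis complex_norm_square mult.commute norm_of_real norm_one right_minus_eq abs_power2 order_less_irrefl of_real_power)
  have dm: "(m has_field_derivative 1 / (1 - cnj (Q 0) * Q 0)) (at (Q 0))"
    unfolding m_def Moebius_function_def using nz
    by (auto intro!: derivative_eq_intros simp: power2_eq_square)
  have dQ: "(Q has_field_derivative deriv Q 0) (at 0)"
    using holomorphic_derivI[OF hol open_ball] by simp
  have "((\<lambda>z. m (Q z)) has_field_derivative 1 / (1 - cnj (Q 0) * Q 0) * deriv Q 0) (at 0)"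
    using DERIV_chain2[OF dm dQ] .
  then have "deriv (\<lambda>z. m (Q z)) 0 = deriv Q 0 / (1 - cnj (Q 0) * Q 0)"
    by (simp add: DERIV_imp_deriv)
  moreover have "1 - cnj (Q 0) * Q 0 = of_real (1 - (norm (Q 0))\<^sup>2)"
    by (simp only: of_real_diff of_real_1 complex_norm_square mult.commute)
  ultimately have "norm (deriv Q 0) / (1 - (norm (Q 0))\<^sup>2) \<le> 1"
    using S q2 by (simp add: norm_divide del: of_real_diff of_real_power)
  then show ?thesis using q2 by (simp add: divide_le_eq)
qed

text \<open>The linear part differs from a z by cnj (b z), which is smaller than a z; half of the
  gap |a| - |b| absorbs the remainder.\<close>

lemma harmonic_orientation:
  assumes h: "(h has_field_derivative a) (at 0)" and g: "(g has_field_derivative b) (at 0)"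
    and zero: "h 0 = 0" "g 0 = 0" and ab: "norm b < norm a"
  shows "\<exists>a \<delta>. a \<noteq> 0 \<and> \<delta> > 0 \<and> (\<forall>z. z \<noteq> 0 \<longrightarrow> norm z < \<delta> \<longrightarrow> norm ((h z + cnj (g z)) / (a * z) - 1) < 1)"
proof -
  define \<epsilon> where "\<epsilon> = (norm a - norm b) / 2"
  have \<epsilon>: "\<epsilon> > 0" using ab by (simp add: \<epsilon>_def)
  have "((\<lambda>z. h z + cnj (g z)) has_derivative (\<lambda>z. a * z + cnj (b * z))) (at 0)"
    using h g unfolding has_field_derivative_def
    by (intro has_derivative_add bounded_linear.has_derivative[OF bounded_linear_cnj])
  then have "\<forall>e>0. \<exists>d>0. \<forall>z. norm (z - 0) < d \<longrightarrow>
      norm (h z + cnj (g z) - (h 0 + cnj (g 0)) - (a * (z - 0) + cnj (b * (z - 0)))) \<le> e * norm (z - 0)"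
    unfolding has_derivative_at_alt by blast
  from this[rule_format, OF \<epsilon>]
  obtain \<delta> where \<delta>: "\<delta> > 0" "\<And>z. norm z < \<delta> \<Longrightarrow>
      norm ((h z + cnj (g z)) - (a * z + cnj (b * z))) \<le> \<epsilon> * norm z"
    by (auto simp: zero)
  have "norm ((h z + cnj (g z)) / (a * z) - 1) < 1" if z: "z \<noteq> 0" "norm z < \<delta>" for z
  proof -
    have a0: "a \<noteq> 0" using ab norm_ge_zero[of b] by auto
    have "norm ((h z + cnj (g z)) - a * z) \<le> norm ((h z + cnj (g z)) - (a * z + cnj (b * z))) + norm (cnj (b * z))"
      using norm_triangle_ineq[of "(h z + cnj (g z)) - (a * z + cnj (b * z))" "cnj (b * z)"] by (simp add: algebra_simps)
    also have "\<dots> \<le> \<epsilon> * norm z + norm b * norm z"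
      using \<delta>(2)[OF z(2)] by (simp only: complex_mod_cnj norm_mult)
    also have "\<dots> = (norm a + norm b) / 2 * norm z"
      by (simp add: \<epsilon>_def field_simps)
    also have "\<dots> < norm a * norm z"
      using z(1) ab by (intro mult_strict_right_mono) auto
    finally have "norm ((h z + cnj (g z)) - a * z) < norm (a * z)" by (simp add: norm_mult)
    moreover have "(h z + cnj (g z)) / (a * z) - 1 = ((h z + cnj (g z)) - a * z) / (a * z)"
      using a0 z(1) by (simp add: field_simps)
    ultimately show ?thesis using a0 z(1) by (simp add: norm_divide divide_less_eq)
  qed
  then show ?thesis using \<delta>(1) ab norm_ge_zero[of b] by (intro exI[of _ a] exI[of _ \<delta>]) auto
qed

lemma taylor_coeff_one: "taylor_coeff f 1 = deriv f 0"
  by (simp add: taylor_coeff_def)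

lemma taylor_coeff_two: "taylor_coeff f 2 = deriv (deriv f) 0 / 2"
  by (simp add: taylor_coeff_def numeral_2_eq_2)

text \<open>Univalence and boundedness are required of \<open>h\<close> as well as of the harmonic
  map, because radial limits come from the area of the image of \<open>h\<close>. In the application
  \<open>h\<close> is an affine image of a Riemann map.\<close>

theorem harmonic_disk_map_bound:
  fixes h g Q :: "complex \<Rightarrow> complex"
  assumes hol: "h holomorphic_on ball 0 1" "g holomorphic_on ball 0 1" "Q holomorphic_on ball 0 1"
    and zero: "h 0 = 0" "g 0 = 0" and inj: "inj_on h (ball 0 1)" and bdd: "bounded (h ` ball 0 1)"
    and Q: "\<And>z. norm z < 1 \<Longrightarrow> norm (Q z) < 1"
    and dil: "\<And>z. norm z < 1 \<Longrightarrow> deriv g z = (Q z)\<^sup>2 * deriv h z"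
    and injF: "inj_on (\<lambda>z. h z + cnj (g z)) (ball 0 1)"
    and image: "(\<lambda>z. h z + cnj (g z)) ` ball 0 1 = ball 0 r" and r: "0 < r"
  shows "73/100 * r\<^sup>2 \<le> (norm (deriv h 0))\<^sup>2 * (1 + (norm (Q 0))\<^sup>2)\<^sup>2"
proof -
  define F where "F = (\<lambda>z. h z + cnj (g z))"
  define s where "s = norm (Q 0)"
  define p where "p = norm (deriv h 0)"
  have s: "0 \<le> s" "s < 1" using Q[of 0] by (auto simp: s_def)
  have p: "0 < p" using holomorphic_injective_imp_regular[OF hol(1) open_ball inj, of 0] by (simp add: p_def)
  have dle: "norm (deriv g z) \<le> norm (deriv h z)" if "norm z < 1" for z
    using Q[OF that] by (simp add: dil[OF that] norm_mult norm_power mult_left_le_one_le power_le_one)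
  have dg0: "norm (deriv g 0) = s\<^sup>2 * p" using dil[of 0] by (simp add: norm_mult norm_power s_def p_def)
  have dh: "(h has_field_derivative deriv h z) (at z)" "(g has_field_derivative deriv g z) (at z)"
    "(Q has_field_derivative deriv Q z) (at z)" "(deriv h has_field_derivative deriv (deriv h) z) (at z)" if "norm z < 1" for z
    using that
    by (intro holomorphic_derivI[OF hol(1) open_ball] holomorphic_derivI[OF hol(2) open_ball]
        holomorphic_derivI[OF hol(3) open_ball] holomorphic_derivI[OF holomorphic_deriv[OF hol(1) open_ball] open_ball]; simp)+
  have "s\<^sup>2 < 1" using s by (simp add: abs_square_less_1)
  then have lt0: "norm (deriv g 0) < norm (deriv h 0)" unfolding dg0 using p by (simp add: p_def)
  interpret D: disk_homeomorphism F r
  proof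
    show "continuous_on (ball 0 1) F"
      unfolding F_def using hol(1,2) by (intro continuous_intros holomorphic_on_imp_continuous_on)
    show "\<exists>a \<delta>. a \<noteq> 0 \<and> \<delta> > 0 \<and> (\<forall>z. z \<noteq> 0 \<longrightarrow> norm z < \<delta> \<longrightarrow> norm (F z / (a * z) - 1) < 1)"
      unfolding F_def using dh(1,2)[of 0] zero lt0 by (intro harmonic_orientation) auto
  qed (use r injF image zero in \<open>auto simp: F_def\<close>)
  define N where "N = {t. \<not> (\<exists>l. ((\<lambda>\<rho>. h (of_real \<rho> * cis t) + cnj (g (of_real \<rho> * cis t))) \<longlongrightarrow> l) (at_left 1))}"
  have N: "negligible N" unfolding N_def by (rule radial_limits_negligible[OF hol(1,2) inj bdd dle])
  have Nlim: "\<exists>l. D.radial_limit t l" if "t \<notin> N" for t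
    using that unfolding N_def D.radial_limit_def by (simp add: F_def)
  obtain \<theta> where \<theta>: "mono \<theta>" "\<And>t. \<theta> (t + 2 * pi) = \<theta> t + 2 * pi"
    "\<And>t. t \<notin> N \<Longrightarrow> D.radial_limit t (of_real r * cis (\<theta> t))"
    using D.boundary_function[OF N Nlim] by blast
  interpret C: circle_boundary_map h g r \<theta> N
  proof
    show "norm (h z + cnj (g z)) \<le> r" if "norm z < 1" for z
    proof -
      have "h z + cnj (g z) \<in> ball 0 r" using that unfolding image[symmetric] by (intro imageI) simp
      then show ?thesis by simp
    qed
    show "((\<lambda>\<rho>. h (of_real \<rho> * cis t) + cnj (g (of_real \<rho> * cis t))) \<longlongrightarrow> of_real r * cis (\<theta> t)) (at_left 1)"
      if "t \<notin> N" for t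
      using \<theta>(3)[OF that] unfolding D.radial_limit_def by (simp add: F_def)
  qed (use hol zero r \<theta>(1,2) N in auto)
  define u where "u = norm (taylor_coeff h 2)"
  define v where "v = norm (taylor_coeff g 2)"
  have e: "C.e 1 = p\<^sup>2" "C.e (-1) = (s\<^sup>2 * p)\<^sup>2" "C.e 2 = u\<^sup>2" "C.e (-2) = v\<^sup>2" "C.e 0 = 0"
    using dg0 by (simp_all add: C.e_def fourier_coeff_def taylor_coeff_one[unfolded One_nat_def] p_def u_def v_def)
  \<comment> \<open>Differentiating g' = Q^2 h' once at 0 expresses the second coefficient of
    \<open>g\<close> by that of \<open>h\<close> and Q'(0); Schwarz-Pick bounds the latter.\<close>
  have v: "v \<le> s\<^sup>2 * u + s * (1 - s\<^sup>2) * p"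
  proof -
    have "((\<lambda>z. (Q z)\<^sup>2 * deriv h z) has_field_derivative
        (2 * Q 0 * deriv Q 0 * deriv h 0 + (Q 0)\<^sup>2 * deriv (deriv h) 0)) (at 0)"
      using dh[of 0] by (auto intro!: derivative_eq_intros)
    then have "(deriv g has_field_derivative (2 * Q 0 * deriv Q 0 * deriv h 0 + (Q 0)\<^sup>2 * deriv (deriv h) 0)) (at 0)"
      by (rule has_field_derivative_transform_within_open[where S = "ball 0 1"]) (auto simp: dil)
    then have "taylor_coeff g 2 = (Q 0)\<^sup>2 * taylor_coeff h 2 + Q 0 * deriv Q 0 * deriv h 0"
      by (simp add: taylor_coeff_two DERIV_imp_deriv)
    then have "v \<le> norm ((Q 0)\<^sup>2 * taylor_coeff h 2) + norm (Q 0 * deriv Q 0 * deriv h 0)"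
      unfolding v_def using norm_triangle_ineq by metis
    also have "\<dots> = s\<^sup>2 * u + s * norm (deriv Q 0) * p"
      by (simp add: norm_mult norm_power s_def u_def p_def)
    also have "\<dots> \<le> s\<^sup>2 * u + s * (1 - s\<^sup>2) * p"
      using Schwarz_Pick_at_zero[OF hol(3) Q] s p
      by (intro add_left_mono mult_right_mono mult_left_mono) (auto simp: s_def)
    finally show ?thesis .
  qed
  have "73/100 * r\<^sup>2 \<le> p\<^sup>2 * (1 + s\<^sup>2)\<^sup>2"
  proof (rule coefficient_bound[OF s _ _ _ v])
    fix a b :: real
    assume ab: "0 \<le> b" "b \<le> a" and le: "\<And>D. 0 \<le> D \<Longrightarrow> a * (1 - cos D) + b * sin D \<le> D"
    have "r\<^sup>2 * (a - pi/4) \<le> 2/3 * (a - b) * C.e 1 + 2/3 * (a + b) * C.e (-1) + b * pi/4 * (C.e (-2) - C.e 2)"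
    proof (rule spectral_inequality[OF _ e(5) ab _ C.parseval])
      fix K :: nat and x :: real
      assume x: "0 \<le> x" "x \<le> pi / 2"
      then have x2: "0 \<le> x" "x \<le> 2 * pi" using pi_gt_zero by linarith+
      have "(\<Sum>n\<in>{-int K..int K}. C.e n * (a * (1 - cos (n*x)) + b * (1 + sin (n*x))))
        \<le> a * (r\<^sup>2 - Re (C.boundary_correlation x)) + b * (r\<^sup>2 + Im (C.boundary_correlation x))"
        using C.spectral_test[OF x2, of a b K] ab by simp
      also have "\<dots> \<le> r\<^sup>2 * x + b * r\<^sup>2"
        using C.boundary_correlation_bound[OF x2 le] by (simp add: algebra_simps)
      finally show "(\<Sum>n\<in>{-int K..int K}. C.e n * (a * (1 - cos (n*x)) + b * (1 + sin (n*x)))) \<le> r\<^sup>2 * x + b * r\<^sup>2" .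
    qed (simp add: C.e_def)
    then show "r\<^sup>2 * (a - pi/4) \<le> 2/3 * (a - b) * p\<^sup>2 + 2/3 * (a + b) * (s\<^sup>2 * p)\<^sup>2 + b * pi/4 * (v\<^sup>2 - u\<^sup>2)"
      by (simp only: e)
  qed (use p in \<open>auto simp: u_def v_def\<close>)
  then show ?thesis by (simp add: s_def p_def)
qed

section \<open>Differentials and potentials in the plane\<close>

text \<open>Values in any normed space admit complex maps of the real plane. Conformality then says
  that two such pairs of derivatives are proportional over the complex numbers.\<close>

definition has_grad :: "(real \<times> real \<Rightarrow> 'b::real_normed_vector) \<Rightarrow> 'b \<Rightarrow> 'b \<Rightarrow> real \<times> real \<Rightarrow> bool" where
  "has_grad X xu xv p \<longleftrightarrow> (X has_derivative (\<lambda>d. fst d *\<^sub>R xu + snd d *\<^sub>R xv)) (at p)"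

lemma has_gradI:
  assumes "(X has_derivative D) (at p)" "\<And>d. D d = fst d *\<^sub>R xu + snd d *\<^sub>R xv"
  shows "has_grad X xu xv p"
proof -
  have "D = (\<lambda>d. fst d *\<^sub>R xu + snd d *\<^sub>R xv)"
    using assms(2) by (rule ext)
  with assms(1) show ?thesis unfolding has_grad_def by (rule subst[rotated])
qed

lemma has_grad_along:
  assumes "has_grad X xu xv (p + s *\<^sub>R d)"
  shows "((\<lambda>s. X (p + s *\<^sub>R d)) has_vector_derivative fst d *\<^sub>R xu + snd d *\<^sub>R xv) (at s within S)"
proof -
  have "((\<lambda>s. p + s *\<^sub>R d) has_derivative (\<lambda>t. t *\<^sub>R d)) (at s within S)"
    by (auto intro!: derivative_eq_intros)
  from has_derivative_compose[OF this assms[unfolded has_grad_def]]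
  show ?thesis by (simp add: has_vector_derivative_def scaleR_add_right)
qed

text \<open>The increment is split into a horizontal step through \<open>p\<close>, governed by the
  derivative there, and a vertical step at a nearby abscissa, governed by the continuity of
  \<open>xv\<close>.\<close>

lemma partials_has_grad:
  fixes X :: "real \<times> real \<Rightarrow> real"
  assumes S: "open S" "p \<in> S"
    and pu: "\<And>u v. (u, v) \<in> S \<Longrightarrow> ((\<lambda>t. X (t, v)) has_real_derivative xu (u, v)) (at u)"
    and pv: "\<And>u v. (u, v) \<in> S \<Longrightarrow> ((\<lambda>t. X (u, t)) has_real_derivative xv (u, v)) (at v)"
    and cont: "continuous_on S xv"
  shows "has_grad X (xu p) (xv p) p"
proof -
  obtain u v where p: "p = (u, v)" by (cases p)
  obtain A B where "open A" "open B" "p \<in> A \<times> B" "A \<times> B \<subseteq> S"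
    by (rule open_prod_elim[OF S])
  then have AB: "open A" "open B" "u \<in> A" "v \<in> B" "A \<times> B \<subseteq> S" using p by auto
  obtain \<delta> where \<delta>: "\<delta> > 0" "ball v \<delta> \<subseteq> B" using AB openE by blast
  define Y where "Y = ball v \<delta>"
  have sub: "A \<times> Y \<subseteq> S" using AB \<delta> by (auto simp: Y_def)
  have dxu: "((\<lambda>x. X (x, v)) has_derivative (\<lambda>tx. tx *\<^sub>R xu (u, v))) (at u within A)"
    using has_derivative_at_withinI[OF pu[of u v, unfolded has_real_derivative_iff_has_vector_derivative has_vector_derivative_def]]
      S(2) unfolding p by blast
  have dxv: "((\<lambda>y. X (x, y)) has_derivative blinfun_apply (blinfun_scaleR_left (xv (x, y)))) (at y within Y)"
    if "x \<in> A" "y \<in> Y" for x y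
  proof -
    have "(x, y) \<in> S" using that sub by auto
    from has_derivative_at_withinI[OF pv[OF this, unfolded has_real_derivative_iff_has_vector_derivative has_vector_derivative_def]]
    show ?thesis unfolding blinfun_scaleR_left.rep_eq .
  qed
  have "continuous_on (A \<times> Y) (\<lambda>z. blinfun_scaleR_left (xv z))"
    by (intro continuous_intros continuous_on_subset[OF cont sub])
  moreover have "(u, v) \<in> A \<times> Y" using AB \<delta> by (auto simp: Y_def)
  ultimately have "continuous (at (u, v) within A \<times> Y) (\<lambda>z. blinfun_scaleR_left (xv z))"
    unfolding continuous_on_eq_continuous_within by (rule bspec)
  then have cxv: "continuous (at (u, v) within A \<times> Y) (\<lambda>(x, y). blinfun_scaleR_left (xv (x, y)))"
    unfolding case_prod_beta' prod.collapse .
  have vY: "v \<in> Y" "convex Y" using \<delta> by (auto simp: Y_def)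
  have "((\<lambda>(x, y). X (x, y)) has_derivative (\<lambda>(tx, ty). tx *\<^sub>R xu (u, v) + blinfun_scaleR_left (xv (u, v)) ty)) (at (u, v) within A \<times> Y)"
    by (rule has_derivative_partialsI[OF dxu dxv cxv vY])
  moreover have "at (u, v) within A \<times> Y = at (u, v)"
    using at_within_open[of "(u, v)" "A \<times> Y"] AB \<delta> by (simp add: Y_def open_Times)
  ultimately show ?thesis
    unfolding p by (intro has_gradI[where D = "\<lambda>(tx, ty). tx *\<^sub>R xu (u, v) + blinfun_scaleR_left (xv (u, v)) ty"]) auto
qed

lemma has_grad_partials:
  fixes X :: "real \<times> real \<Rightarrow> real"
  assumes "has_grad X xu xv (u, v)"
  shows "((\<lambda>t. X (t, v)) has_real_derivative xu) (at u)" "((\<lambda>t. X (u, t)) has_real_derivative xv) (at v)"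
proof -
  have 1: "((\<lambda>t. (t, v)) has_derivative (\<lambda>t. (t, 0))) (at u)" and 2: "((\<lambda>t. (u, t)) has_derivative (\<lambda>t. (0, t))) (at v)"
    by (auto intro!: derivative_eq_intros)
  show "((\<lambda>t. X (t, v)) has_real_derivative xu) (at u)"
    using has_derivative_compose[OF 1 assms[unfolded has_grad_def]]
    by (simp add: has_real_derivative_iff_has_vector_derivative has_vector_derivative_def)
  show "((\<lambda>t. X (u, t)) has_real_derivative xv) (at v)"
    using has_derivative_compose[OF 2 assms[unfolded has_grad_def]]
    by (simp add: has_real_derivative_iff_has_vector_derivative has_vector_derivative_def)
qed

text \<open>Poincare lemma for P du + Q dv: the shared function \<open>Pv\<close> expresses
  closedness, and the potential is the line integral along the segment from 0.\<close>

lemma potential_exists: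
  fixes P Q Pu Pv Qv :: "real \<times> real \<Rightarrow> real"
  assumes P: "\<And>p. p \<in> ball 0 1 \<Longrightarrow> has_grad P (Pu p) (Pv p) p"
    and Q: "\<And>p. p \<in> ball 0 1 \<Longrightarrow> has_grad Q (Pv p) (Qv p) p"
    and cont: "continuous_on (ball 0 1) Pu" "continuous_on (ball 0 1) Pv" "continuous_on (ball 0 1) Qv"
  shows "\<exists>\<Phi>. \<forall>p\<in>ball 0 1. has_grad \<Phi> (P p) (Q p) p"
proof -
  have contP: "continuous_on (ball 0 1) P" and contQ: "continuous_on (ball 0 1) Q"
    using P Q unfolding has_grad_def
    by (meson continuous_at_imp_continuous_on has_derivative_continuous)+
  define \<Phi> where "\<Phi> x = integral {0..1} (\<lambda>t. fst x * P (t *\<^sub>R x) + snd x * Q (t *\<^sub>R x))" for x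
  have dir: "((\<lambda>h. \<Phi> (p + h *\<^sub>R e)) has_real_derivative fst e * P p + snd e * Q p) (at 0)"
    if p: "p \<in> ball 0 1" for p e :: "real \<times> real"
  proof -
    define X where "X h = p + h *\<^sub>R e" for h
    define U where "U = X -` ball 0 1"
    have contX: "continuous_on A X" for A unfolding X_def by (intro continuous_intros)
    have openU: "open U" unfolding U_def by (rule open_vimage[OF open_ball contX])
    have convU: "convex U"
    proof (rule convexI)
      fix x y u v :: real
      assume xy: "x \<in> U" "y \<in> U" and uv: "0 \<le> u" "0 \<le> v" "u + v = 1"
      have "X (u *\<^sub>R x + v *\<^sub>R y) = u *\<^sub>R X x + v *\<^sub>R X y"
        using uv(3) unfolding X_def by (simp add: algebra_simps flip: scaleR_add_left)
      then show "u *\<^sub>R x + v *\<^sub>R y \<in> U"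
        using convexD[OF convex_ball _ _ uv, of "X x" 0 1 "X y"] xy by (simp add: U_def)
    qed
    have U0: "0 \<in> U" using p by (simp add: U_def X_def)
    have in_ball: "t *\<^sub>R X h \<in> ball 0 1" if "h \<in> U" "t \<in> {0..1}" for h t
    proof -
      have "\<bar>t\<bar> * norm (X h) \<le> 1 * norm (X h)" using that by (intro mult_right_mono) auto
      then show ?thesis using that by (simp add: U_def)
    qed
    define f where "f h t = fst (X h) * P (t *\<^sub>R X h) + snd (X h) * Q (t *\<^sub>R X h)" for h t
    define f' where "f' h t = fst e * P (t *\<^sub>R X h) + fst (X h) * (t * (fst e * Pu (t *\<^sub>R X h) + snd e * Pv (t *\<^sub>R X h)))
      + (snd e * Q (t *\<^sub>R X h) + snd (X h) * (t * (fst e * Pv (t *\<^sub>R X h) + snd e * Qv (t *\<^sub>R X h))))" for h t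
    have dX: "(fst \<circ> X has_real_derivative fst e) (at h within U)" "(snd \<circ> X has_real_derivative snd e) (at h within U)" for h
      unfolding X_def o_def by (auto intro!: derivative_eq_intros)
    have chain: "((\<lambda>h. Z (t *\<^sub>R X h)) has_real_derivative t * (fst e * zu + snd e * zv)) (at h within U)"
      if "has_grad Z zu zv (t *\<^sub>R X h)" for Z zu zv t h
    proof -
      have eq: "t *\<^sub>R X h = t *\<^sub>R p + h *\<^sub>R (t *\<^sub>R e)" for h by (simp add: X_def algebra_simps)
      from has_grad_along[OF that[unfolded eq], of U]
      show ?thesis
        unfolding eq by (simp add: has_real_derivative_iff_has_vector_derivative algebra_simps)
    qed
    have "((\<lambda>h. integral (cbox 0 1) (f h)) has_real_derivative integral (cbox 0 1) (f' 0)) (at 0 within U)"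
    proof (rule leibniz_rule_field_derivative[OF _ _ _ U0 convU])
      show "((\<lambda>h. f h t) has_real_derivative f' h t) (at h within U)" if "h \<in> U" "t \<in> cbox 0 1" for h t
        unfolding f_def f'_def
        using chain[OF P[OF in_ball]] chain[OF Q[OF in_ball]] dX[unfolded o_def] that
        by (auto intro!: derivative_eq_intros)
      show "f h integrable_on cbox 0 1" if "h \<in> U" for h
        unfolding f_def
        by (intro integrable_continuous continuous_intros continuous_on_compose2[OF contP] continuous_on_compose2[OF contQ])
          (use in_ball that in auto)
      show "continuous_on (U \<times> cbox 0 1) (\<lambda>(h, t). f' h t)"
        unfolding f'_def split_beta
        by (intro continuous_intros continuous_on_compose2[OF contX] continuous_on_compose2[OF contP] continuous_on_compose2[OF contQ]
            continuous_on_compose2[OF cont(1)] continuous_on_compose2[OF cont(2)] continuous_on_compose2[OF cont(3)])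
          (use in_ball in auto)
    qed
    moreover have "integral (cbox 0 1) (f' 0) = fst e * P p + snd e * Q p"
    proof -
      \<comment> \<open>By closedness the differentiated integrand is the t-derivative of t (e . (P,
        Q)(t p)), so the integral telescopes.\<close>
      have "((f' 0) has_integral (1 * (fst e * P (1 *\<^sub>R p) + snd e * Q (1 *\<^sub>R p)) - 0 * (fst e * P (0 *\<^sub>R p) + snd e * Q (0 *\<^sub>R p)))) {0..1}"
      proof (rule fundamental_theorem_of_calculus)
        fix t :: real assume t: "t \<in> {0..1}"
        have tp: "t *\<^sub>R p \<in> ball 0 1" using in_ball[OF U0 t] by (simp add: X_def)
        have d: "((\<lambda>t. Z (t *\<^sub>R p)) has_real_derivative fst p * zu + snd p * zv) (at t within {0..1})"
          if "has_grad Z zu zv (t *\<^sub>R p)" for Z zu zv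
          using has_grad_along[of Z zu zv 0 t p] that by (simp add: has_real_derivative_iff_has_vector_derivative)
        have "((\<lambda>t. t * (fst e * P (t *\<^sub>R p) + snd e * Q (t *\<^sub>R p))) has_real_derivative f' 0 t) (at t within {0..1})"
          unfolding f'_def X_def
          by (rule derivative_eq_intros d[OF P[OF tp]] d[OF Q[OF tp]] refl)+ (simp add: algebra_simps)
        then show "((\<lambda>t. t * (fst e * P (t *\<^sub>R p) + snd e * Q (t *\<^sub>R p))) has_vector_derivative f' 0 t) (at t within {0..1})"
          by (simp add: has_real_derivative_iff_has_vector_derivative)
      qed simp
      then show ?thesis by (simp add: integral_unique)
    qed
    moreover have "(\<lambda>h. \<Phi> (p + h *\<^sub>R e)) = (\<lambda>h. integral (cbox 0 1) (f h))"
      unfolding \<Phi>_def f_def X_def interval_cbox[symmetric] by (rule refl)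
    ultimately show ?thesis using at_within_open[OF U0 openU] by metis
  qed
  have "has_grad \<Phi> (P p) (Q p) p" if "p \<in> ball 0 1" for p
  proof (rule partials_has_grad[OF open_ball that _ _ contQ])
    fix u v :: real assume uv: "(u, v) \<in> ball 0 1"
    have "((\<lambda>h. \<Phi> (u + h, v)) has_real_derivative P (u, v)) (at 0)"
      using dir[OF uv, of "(1, 0)"] by simp
    then show "((\<lambda>t. \<Phi> (t, v)) has_real_derivative P (u, v)) (at u)"
      using DERIV_shift[of "\<lambda>t. \<Phi> (t, v)" "P (u, v)" 0 u] by (simp add: add.commute)
    have "((\<lambda>h. \<Phi> (u, v + h)) has_real_derivative Q (u, v)) (at 0)"
      using dir[OF uv, of "(0, 1)"] by simp
    then show "((\<lambda>t. \<Phi> (u, t)) has_real_derivative Q (u, v)) (at v)"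
      using DERIV_shift[of "\<lambda>t. \<Phi> (u, t)" "Q (u, v)" 0 v] by (simp add: add.commute)
  qed
  then show ?thesis by blast
qed

lemma unit_disk_eq_ball: "unit_disk = ball 0 1"
  by (auto simp: unit_disk_def norm_Pair real_sqrt_less_iff)

lemma C1_on_has_grad:
  assumes "C1_on (ball 0 1) f" "p \<in> ball 0 1"
  shows "has_grad f (partial_u f p) (partial_v f p) p"
  using assms
  by (intro partials_has_grad[where S = "ball 0 1"])
    (auto simp: C1_on_def partial_u_def partial_v_def DERIV_deriv_iff_real_differentiable simp del: mem_ball_0 split: prod.splits)

text \<open>Along a vertical segment f is the integral of its v-derivative. Differentiating under
  the integral in u and then in the upper limit produces the two orders of differentiation.\<close>

lemma mixed_partials_eq:
  assumes f: "C1_on (ball 0 1) f" "C1_on (ball 0 1) (partial_u f)" "C1_on (ball 0 1) (partial_v f)"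
    and p: "p \<in> ball 0 1"
  shows "partial_u (partial_v f) p = partial_v (partial_u f) p"
proof -
  obtain u v where uv: "p = (u, v)" by (cases p)
  obtain A B where "open A" "open B" "p \<in> A \<times> B" "A \<times> B \<subseteq> ball 0 1"
    by (rule open_prod_elim[OF open_ball p])
  then have AB: "open A" "open B" "u \<in> A" "v \<in> B" "A \<times> B \<subseteq> ball 0 1" using uv by auto
  obtain \<delta> where \<delta>: "\<delta> > 0" "cball v \<delta> \<subseteq> B" using AB open_contains_cball by blast
  obtain \<eta> where \<eta>: "\<eta> > 0" "ball u \<eta> \<subseteq> A" using AB openE by blast
  define U where "U = ball u \<eta>"
  \<comment> \<open>The lower limit is strictly below \<open>v\<close>, so that \<open>v\<close> is
    interior and the derivative there is two-sided.\<close>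
  define c where "c = v - \<delta>"
  have inb: "(x, y) \<in> ball 0 1" if "x \<in> U" "y \<in> {c..v+\<delta>}" for x y
  proof -
    have "x \<in> A" using that \<eta>(2) by (auto simp: U_def)
    moreover have "y \<in> cball v \<delta>" using that by (auto simp: c_def dist_real_def)
    ultimately show ?thesis using AB(5) \<delta>(2) by blast
  qed
  note gf = has_grad_partials[OF C1_on_has_grad[OF f(1)]]
    and gu = has_grad_partials[OF C1_on_has_grad[OF f(2)]]
    and gv = has_grad_partials[OF C1_on_has_grad[OF f(3)]]
  have cont: "continuous_on (ball 0 1) (partial_v f)" "continuous_on (ball 0 1) (partial_u (partial_v f))"
    using f unfolding C1_on_def by blast+
  have FTC: "integral {c..y} (\<lambda>s. partial_v f (x, s)) = f (x, y) - f (x, c)" if "x \<in> U" "y \<in> {c..v+\<delta>}" for x y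
  proof (rule integral_unique, rule fundamental_theorem_of_calculus)
    show "((\<lambda>s. f (x, s)) has_vector_derivative partial_v f (x, s)) (at s within {c..y})" if "s \<in> {c..y}" for s
      using gf(2)[OF inb[of x s]] that \<open>x \<in> U\<close> \<open>y \<in> _\<close>
      by (auto simp: has_real_derivative_iff_has_vector_derivative intro: has_vector_derivative_at_within)
  qed (use that in auto)
  have eq: "integral {c..y} (\<lambda>s. partial_u (partial_v f) (u, s)) = partial_u f (u, y) - partial_u f (u, c)"
    if y: "y \<in> {c..v+\<delta>}" for y
  proof -
    have "((\<lambda>x. integral (cbox c y) (\<lambda>s. partial_v f (x, s))) has_real_derivative
       integral (cbox c y) (\<lambda>s. partial_u (partial_v f) (u, s))) (at u within U)"
    proof (rule leibniz_rule_field_derivative[where fx = "\<lambda>x s. partial_u (partial_v f) (x, s)"])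
      show "((\<lambda>x. partial_v f (x, s)) has_real_derivative partial_u (partial_v f) (x, s)) (at x within U)"
        if "x \<in> U" "s \<in> cbox c y" for x s
        using gv(1)[OF inb[of x s]] that y by (auto intro: has_field_derivative_at_within)
      show "(\<lambda>s. partial_v f (x, s)) integrable_on cbox c y" if "x \<in> U" for x
        by (intro integrable_continuous continuous_on_compose2[OF cont(1)] continuous_intros)
          (use inb that y in auto)
      show "continuous_on (U \<times> cbox c y) (\<lambda>(x, s). partial_u (partial_v f) (x, s))"
        unfolding split_beta
        by (intro continuous_on_compose2[OF cont(2)] continuous_intros) (use inb y in auto)
    qed (use \<eta> in \<open>auto simp: U_def\<close>)
    then have "((\<lambda>x. integral {c..y} (\<lambda>s. partial_v f (x, s))) has_real_derivative
       integral {c..y} (\<lambda>s. partial_u (partial_v f) (u, s))) (at u)"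
      using at_within_open[of u U] \<eta> by (simp add: U_def)
    then have "((\<lambda>x. f (x, y) - f (x, c)) has_real_derivative
       integral {c..y} (\<lambda>s. partial_u (partial_v f) (u, s))) (at u)"
      by (rule has_field_derivative_transform_within_open[where S = U]) (use FTC y \<eta> in \<open>auto simp: U_def\<close>)
    moreover have "((\<lambda>x. f (x, y) - f (x, c)) has_real_derivative partial_u f (u, y) - partial_u f (u, c)) (at u)"
      using inb[of u y] inb[of u c] y \<eta> \<delta> by (intro DERIV_diff gf(1)) (auto simp: U_def c_def)
    ultimately show ?thesis by (rule DERIV_unique)
  qed
  have "((\<lambda>y. integral {c..y} (\<lambda>s. partial_u (partial_v f) (u, s))) has_real_derivative partial_u (partial_v f) (u, v)) (at v within {c..v+\<delta>})"
    using \<delta> \<eta> by (intro integral_has_real_derivative continuous_on_compose2[OF cont(2)] continuous_intros)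
      (use inb \<eta> in \<open>auto simp: c_def U_def\<close>)
  moreover have "at v within {c..v+\<delta>} = at v"
    using \<delta> by (intro at_within_interior) (auto simp: c_def)
  ultimately have "((\<lambda>y. integral {c..y} (\<lambda>s. partial_u (partial_v f) (u, s))) has_real_derivative partial_u (partial_v f) (u, v)) (at v)"
    by simp
  then have "((\<lambda>y. partial_u f (u, y) - partial_u f (u, c)) has_real_derivative partial_u (partial_v f) (u, v)) (at v)"
    by (rule has_field_derivative_transform_within_open[where S = "{c<..<v+\<delta>}"]) (use eq \<delta> in \<open>auto simp: c_def\<close>)
  moreover have "((\<lambda>y. partial_u f (u, y) - partial_u f (u, c)) has_real_derivative partial_v (partial_u f) (u, v) - 0) (at v)"
    using p uv by (intro DERIV_diff gu(2)) auto
  ultimately show ?thesis unfolding uv by (metis DERIV_unique diff_zero)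
qed

section \<open>Isothermal coordinates for minimal graphs\<close>

lemma has_grad_add: "has_grad X xu xv p \<Longrightarrow> has_grad Y yu yv p \<Longrightarrow> has_grad (\<lambda>z. X z + Y z) (xu + yu) (xv + yv) p"
  unfolding has_grad_def
  by (erule has_derivative_eq_rhs[OF has_derivative_add], assumption) (simp add: algebra_simps fun_eq_iff)

lemma has_grad_diff: "has_grad X xu xv p \<Longrightarrow> has_grad Y yu yv p \<Longrightarrow> has_grad (\<lambda>z. X z - Y z) (xu - yu) (xv - yv) p"
  unfolding has_grad_def
  by (erule has_derivative_eq_rhs[OF has_derivative_diff], assumption) (simp add: algebra_simps fun_eq_iff)

lemma has_grad_mult:
  fixes X Y :: "real \<times> real \<Rightarrow> 'b::real_normed_field"
  shows "has_grad X xu xv p \<Longrightarrow> has_grad Y yu yv p \<Longrightarrow>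
    has_grad (\<lambda>z. X z * Y z) (xu * Y p + X p * yu) (xv * Y p + X p * yv) p"
  unfolding has_grad_def
  by (erule has_derivative_eq_rhs[OF has_derivative_mult], assumption) (simp add: algebra_simps fun_eq_iff)

lemma has_grad_fst: "has_grad (\<lambda>z. fst z) 1 0 p" and has_grad_snd: "has_grad (\<lambda>z. snd z) 0 1 p"
  unfolding has_grad_def by (auto intro!: derivative_eq_intros)

lemma has_grad_const: "has_grad (\<lambda>z. c) 0 0 p"
  unfolding has_grad_def by simp

lemma has_grad_compose:
  fixes X :: "real \<times> real \<Rightarrow> real"
  assumes "has_grad X xu xv p" "(\<phi> has_real_derivative d) (at (X p))"
  shows "has_grad (\<lambda>z. \<phi> (X z)) (d * xu) (d * xv) p"
  unfolding has_grad_def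
  by (rule has_derivative_eq_rhs[OF has_derivative_compose[OF assms(1)[unfolded has_grad_def] assms(2)[unfolded has_field_derivative_def]]])
    (simp add: algebra_simps fun_eq_iff)

lemma has_grad_of_real: "has_grad X xu xv p \<Longrightarrow> has_grad (\<lambda>z. complex_of_real (X z)) (of_real xu) (of_real xv) p"
  unfolding has_grad_def
  by (erule has_derivative_eq_rhs[OF has_derivative_of_real]) (simp add: scaleR_conv_of_real fun_eq_iff)

lemma has_grad_cong: "has_grad X xu xv p \<Longrightarrow> xu = xu' \<Longrightarrow> xv = xv' \<Longrightarrow> has_grad X xu' xv' p"
  by simp

text \<open>If \<open>dX = \<kappa> d\<tau>\<close> then \<open>X - \<kappa> \<tau>\<close> has vanishing differential, and this survives
  composition with the Lipschitz inverse of \<open>\<tau>\<close>; so the inverse need not be differentiated.\<close>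

lemma conformal_quotient:
  fixes X \<tau> :: "real \<times> real \<Rightarrow> complex"
  assumes X: "has_grad X (\<kappa> * zu) (\<kappa> * zv) p" and \<tau>: "has_grad \<tau> zu zv p"
    and \<Omega>: "open \<Omega>" "\<tau> p \<in> \<Omega>"
    and inv: "\<And>\<zeta>. \<zeta> \<in> \<Omega> \<Longrightarrow> \<tau> (\<omega> \<zeta>) = \<zeta>" "\<omega> (\<tau> p) = p"
    and lip: "\<And>\<zeta>. \<zeta> \<in> \<Omega> \<Longrightarrow> norm (\<omega> \<zeta> - p) \<le> norm (\<zeta> - \<tau> p)"
  shows "((\<lambda>\<zeta>. X (\<omega> \<zeta>)) has_field_derivative \<kappa>) (at (\<tau> p))"
proof -
  define Y where "Y z = X z - \<kappa> * \<tau> z" for z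
  have "has_grad Y 0 0 p"
    unfolding Y_def
    by (rule has_grad_cong[OF has_grad_diff[OF X has_grad_mult[OF has_grad_const \<tau>]]]) auto
  then have Y: "(Y has_derivative (\<lambda>d. 0)) (at p)" by (simp add: has_grad_def)
  have "((\<lambda>\<zeta>. X (\<omega> \<zeta>)) has_derivative (\<lambda>h. \<kappa> * h)) (at (\<tau> p))"
    unfolding has_derivative_at_alt
  proof (intro conjI allI impI)
    show "bounded_linear ((*) \<kappa>)" by (rule bounded_linear_mult_right)
    fix \<epsilon> :: real assume "\<epsilon> > 0"
    then obtain d where d: "d > 0" "\<And>y. norm (y - p) < d \<Longrightarrow> norm (Y y - Y p) \<le> \<epsilon> * norm (y - p)"
      using Y unfolding has_derivative_at_alt by fastforce
    obtain d' where d': "d' > 0" "ball (\<tau> p) d' \<subseteq> \<Omega>" using \<Omega> openE by blast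
    have "norm (X (\<omega> \<zeta>) - X (\<omega> (\<tau> p)) - \<kappa> * (\<zeta> - \<tau> p)) \<le> \<epsilon> * norm (\<zeta> - \<tau> p)"
      if "norm (\<zeta> - \<tau> p) < min d d'" for \<zeta>
    proof -
      have \<zeta>: "\<zeta> \<in> \<Omega>" using that d'(2) by (auto simp: dist_norm norm_minus_commute)
      have "X (\<omega> \<zeta>) - X (\<omega> (\<tau> p)) - \<kappa> * (\<zeta> - \<tau> p) = Y (\<omega> \<zeta>) - Y p"
        by (simp add: Y_def inv(1)[OF \<zeta>] inv(2) algebra_simps)
      also have "norm \<dots> \<le> \<epsilon> * norm (\<omega> \<zeta> - p)"
        using lip[OF \<zeta>] that by (intro d(2)) simp
      also have "\<dots> \<le> \<epsilon> * norm (\<zeta> - \<tau> p)" using lip[OF \<zeta>] \<open>\<epsilon> > 0\<close> by simp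
      finally show ?thesis .
    qed
    then show "\<exists>d>0. \<forall>y. norm (y - \<tau> p) < d \<longrightarrow>
        norm (X (\<omega> y) - X (\<omega> (\<tau> p)) - \<kappa> * (y - \<tau> p)) \<le> \<epsilon> * norm (y - \<tau> p)"
      using d(1) d'(1) by (intro exI[of _ "min d d'"]) auto
  qed
  then show ?thesis by (simp add: has_field_derivative_def)
qed

section \<open>Polynomial identities behind the isothermal coordinates\<close>

lemma hopf_algebra_psi:
  fixes a b W :: real
  assumes W: "W\<^sup>2 = 1 + a\<^sup>2 + b\<^sup>2" "W > 0"
  shows "Complex (1 - (1 + a\<^sup>2) / W) (a * b / W) = (Complex (b / (1 + W)) (a / (1 + W)))\<^sup>2 * Complex (1 + (1 + a\<^sup>2) / W) (a * b / W)"
    and "Complex (- (a * b / W)) ((1 + b\<^sup>2) / W - 1) = (Complex (b / (1 + W)) (a / (1 + W)))\<^sup>2 * Complex (a * b / W) (1 + (1 + b\<^sup>2) / W)"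
proof -
  have nz: "W \<noteq> 0" "1 + W \<noteq> 0" using W(2) by auto
  \<comment> \<open>With the reciprocals as variables subject to i W = 1 and j (1 + W) = 1, the
    claims become polynomial consequences of the hypotheses.\<close>
  define i where "i = 1 / W"
  define j where "j = 1 / (1 + W)"
  have i: "i * W = 1" and j: "j * (1 + W) = 1" using nz by (auto simp: i_def j_def)
  have d: "x / W = x * i" "x / (1 + W) = x * j" for x by (auto simp: i_def j_def)
  show "Complex (1 - (1 + a\<^sup>2) / W) (a * b / W) = (Complex (b / (1 + W)) (a / (1 + W)))\<^sup>2 * Complex (1 + (1 + a\<^sup>2) / W) (a * b / W)"
    unfolding d complex_eq_iff power2_eq_square[of "Complex _ _"] times_complex.sel complex.sel
    using W(1) i j by (intro conjI; algebra)
  show "Complex (- (a * b / W)) ((1 + b\<^sup>2) / W - 1) = (Complex (b / (1 + W)) (a / (1 + W)))\<^sup>2 * Complex (a * b / W) (1 + (1 + b\<^sup>2) / W)"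
    unfolding d complex_eq_iff power2_eq_square[of "Complex _ _"] times_complex.sel complex.sel
    using W(1) i j by (intro conjI; algebra)
qed

text \<open>The first identity is conformality of the Gauss map in the isothermal coordinate and
  uses the minimal surface equation. The second is the Jacobian determinant of the Gauss map, which
  brings in the determinant of the Hessian.\<close>

lemma hopf_algebra_q:
  fixes a b W A B C :: real
  assumes W: "W\<^sup>2 = 1 + a\<^sup>2 + b\<^sup>2" "W > 0" and mse: "(1 + b\<^sup>2) * A - 2 * a * b * B + (1 + a\<^sup>2) * C = 0"
  defines "Wu \<equiv> (a * A + b * B) / W" and "Wv \<equiv> (a * B + b * C) / W"
  defines "qu \<equiv> Complex ((B * (1 + W) - b * Wu) / (1 + W)\<^sup>2) ((A * (1 + W) - a * Wu) / (1 + W)\<^sup>2)"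
    and "qv \<equiv> Complex ((C * (1 + W) - b * Wv) / (1 + W)\<^sup>2) ((B * (1 + W) - a * Wv) / (1 + W)\<^sup>2)"
  shows "qu * Complex (a * b / W) (1 + (1 + b\<^sup>2) / W) = qv * Complex (1 + (1 + a\<^sup>2) / W) (a * b / W)"
    and "Re qu * Im qv - Im qu * Re qv = - (A * C - B\<^sup>2) / (W * (1 + W)\<^sup>2)"
proof -
  have nz: "W \<noteq> 0" "1 + W \<noteq> 0" using W(2) by auto
  define i where "i = 1 / W"
  define j where "j = 1 / (1 + W)"
  have i: "i * W = 1" and j: "j * (1 + W) = 1" using nz by (auto simp: i_def j_def)
  have d: "x / W = x * i" "x / (1 + W)\<^sup>2 = x * j\<^sup>2" "x / (W * (1 + W)\<^sup>2) = x * i * j\<^sup>2" for x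
    by (auto simp: i_def j_def power_divide)
  show "qu * Complex (a * b / W) (1 + (1 + b\<^sup>2) / W) = qv * Complex (1 + (1 + a\<^sup>2) / W) (a * b / W)"
    unfolding qu_def qv_def Wu_def Wv_def d complex_eq_iff times_complex.sel complex.sel
    using W(1) i j mse by (intro conjI; algebra)
  show "Re qu * Im qv - Im qu * Re qv = - (A * C - B\<^sup>2) / (W * (1 + W)\<^sup>2)"
    unfolding qu_def qv_def Wu_def Wv_def d complex.sel
    using W(1) i j by algebra
qed

text \<open>The minimal surface equation in divergence form: these are the cross-derivative
  conditions for the two forms whose coefficients are 1 + a^2, a b and a b, 1 + b^2, all divided by
  W.\<close>

lemma hopf_algebra_closed:
  fixes a b W A B C :: real
  assumes W: "W\<^sup>2 = 1 + a\<^sup>2 + b\<^sup>2" "W > 0" and mse: "(1 + b\<^sup>2) * A - 2 * a * b * B + (1 + a\<^sup>2) * C = 0"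
  defines "Wu \<equiv> (a * A + b * B) / W" and "Wv \<equiv> (a * B + b * C) / W"
  shows "(2 * a * B * W - (1 + a\<^sup>2) * Wv) / W\<^sup>2 = ((A * b + a * B) * W - a * b * Wu) / W\<^sup>2"
    and "((B * b + a * C) * W - a * b * Wv) / W\<^sup>2 = (2 * b * B * W - (1 + b\<^sup>2) * Wu) / W\<^sup>2"
proof -
  define i where "i = 1 / W"
  have i: "i * W = 1" using W(2) by (auto simp: i_def)
  have d: "x / W = x * i" "x / W\<^sup>2 = x * i\<^sup>2" for x by (auto simp: i_def power_divide)
  show "(2 * a * B * W - (1 + a\<^sup>2) * Wv) / W\<^sup>2 = ((A * b + a * B) * W - a * b * Wu) / W\<^sup>2"
    unfolding Wu_def Wv_def d using W(1) i mse by algebra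
  show "((B * b + a * C) * W - a * b * Wv) / W\<^sup>2 = (2 * b * B * W - (1 + b\<^sup>2) * Wu) / W\<^sup>2"
    unfolding Wu_def Wv_def d using W(1) i mse by algebra
qed

lemma hopf_algebra_jacobian:
  fixes a b W :: real
  assumes W: "W\<^sup>2 = 1 + a\<^sup>2 + b\<^sup>2" "W > 0"
  shows "(1 + (1 + a\<^sup>2) / W) * (1 + (1 + b\<^sup>2) / W) - (a * b / W) * (a * b / W) = (1 + W)\<^sup>2 / W"
proof -
  define i where "i = 1 / W"
  have i: "i * W = 1" using W(2) by (auto simp: i_def)
  have d: "x / W = x * i" for x by (auto simp: i_def)
  show ?thesis unfolding d using W(1) i by algebra
qed

lemma has_grad_divide:
  fixes X Y :: "real \<times> real \<Rightarrow> real"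
  assumes "has_grad X xu xv p" "has_grad Y yu yv p" "Y p \<noteq> 0"
  shows "has_grad (\<lambda>z. X z / Y z) ((xu * Y p - X p * yu) / (Y p)\<^sup>2) ((xv * Y p - X p * yv) / (Y p)\<^sup>2) p"
  unfolding has_grad_def
  by (rule has_derivative_eq_rhs[OF has_derivative_divide[OF assms(1,2)[unfolded has_grad_def] assms(3)]])
    (use assms(3) in \<open>simp add: fun_eq_iff field_simps power2_eq_square\<close>)

lemma has_grad_Complex:
  assumes "has_grad X xu xv p" "has_grad Y yu yv p"
  shows "has_grad (\<lambda>z. Complex (X z) (Y z)) (Complex xu yu) (Complex xv yv) p"
  unfolding Complex_eq
  by (rule has_grad_cong[OF has_grad_add[OF has_grad_of_real[OF assms(1)] has_grad_mult[OF has_grad_const has_grad_of_real[OF assms(2)]]]])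
    auto

text \<open>An automorphism of the disk, applied before the inverse Riemann map, moves the base
  point.\<close>

lemma pointed_Riemann_map:
  assumes "open \<Omega>" "simply_connected \<Omega>" "\<Omega> \<noteq> UNIV" "w \<in> \<Omega>"
  shows "\<exists>R. R holomorphic_on ball 0 1 \<and> inj_on R (ball 0 1) \<and> R ` ball 0 1 = \<Omega> \<and> R 0 = w"
proof -
  have "\<exists>f g. f holomorphic_on \<Omega> \<and> g holomorphic_on ball 0 1 \<and>
      (\<forall>z\<in>\<Omega>. f z \<in> ball 0 1 \<and> g (f z) = z) \<and> (\<forall>z\<in>ball 0 1. g z \<in> \<Omega> \<and> f (g z) = z)"
    using Riemann_mapping_theorem[THEN iffD1, OF conjI[OF assms(1,2)]] assms(3,4) by (elim disjE) simp_all
  then obtain f0 g0 where g0_hol: "g0 holomorphic_on ball 0 1"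
    and fg0: "\<forall>z\<in>\<Omega>. f0 z \<in> ball 0 1 \<and> g0 (f0 z) = z" "\<forall>z\<in>ball 0 1. g0 z \<in> \<Omega> \<and> f0 (g0 z) = z"
    by (elim exE conjE)
  have f0: "f0 z \<in> ball 0 1" "g0 (f0 z) = z" if "z \<in> \<Omega>" for z using fg0(1) that by blast+
  have g0: "g0 z \<in> \<Omega>" "f0 (g0 z) = z" if "z \<in> ball 0 1" for z using fg0(2) that by blast+
  obtain f1 g1 where fg1: "f1 (f0 w) = 0" "f1 holomorphic_on ball 0 1" "f1 ` ball 0 1 \<subseteq> ball 0 1"
    "g1 holomorphic_on ball 0 1" "g1 ` ball 0 1 \<subseteq> ball 0 1"
    "\<And>z. z \<in> ball 0 1 \<Longrightarrow> f1 (g1 z) = z" "\<And>z. z \<in> ball 0 1 \<Longrightarrow> g1 (f1 z) = z"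
    using ball_biholomorphism_exists[OF f0(1)[OF assms(4)]] by blast
  have f1: "f1 z \<in> ball 0 1" and g1: "g1 z \<in> ball 0 1" if "z \<in> ball 0 1" for z
    using subsetD[OF fg1(3) imageI[OF that]] subsetD[OF fg1(5) imageI[OF that]] by auto
  have "(\<lambda>z. g0 (g1 z)) holomorphic_on ball 0 1"
    using holomorphic_on_compose_gen[OF fg1(4) g0_hol fg1(5)] by (simp add: o_def)
  moreover have "inj_on (\<lambda>z. g0 (g1 z)) (ball 0 1)"
    by (rule inj_on_inverseI[of _ "\<lambda>z. f1 (f0 z)"]) (simp only: g0(2)[OF g1] fg1(6))
  moreover have "(\<lambda>z. g0 (g1 z)) ` ball 0 1 = \<Omega>"
  proof
    show "\<Omega> \<subseteq> (\<lambda>z. g0 (g1 z)) ` ball 0 1"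
    proof
      fix x assume x: "x \<in> \<Omega>"
      have "x = g0 (g1 (f1 (f0 x)))" using fg1(7)[OF f0(1)[OF x]] f0(2)[OF x] by simp
      then show "x \<in> (\<lambda>z. g0 (g1 z)) ` ball 0 1" using f1[OF f0(1)[OF x]] by (rule image_eqI)
    qed
    show "(\<lambda>z. g0 (g1 z)) ` ball 0 1 \<subseteq> \<Omega>"
      by (rule image_subsetI) (rule g0(1)[OF g1])
  qed
  moreover have "g0 (g1 0) = w"
    using fg1(1) fg1(7)[OF f0(1)[OF assms(4)]] f0(2)[OF assms(4)] by simp
  ultimately show ?thesis by (intro exI[of _ "\<lambda>z. g0 (g1 z)"] conjI)
qed

section \<open>The isothermal coordinate of a minimal graph\<close>

locale minimal_graph_disk =
  fixes f :: "real \<times> real \<Rightarrow> real"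
  assumes minimal: "minimal_graph_over unit_disk f"
begin

definition a where "a = partial_u f"
definition b where "b = partial_v f"
definition A where "A = partial_uu f"
definition B where "B = partial_uv f"
definition C where "C = partial_vv f"
definition W where "W p = sqrt (1 + (a p)\<^sup>2 + (b p)\<^sup>2)"
definition Wu where "Wu p = (a p * A p + b p * B p) / W p"
definition Wv where "Wv p = (a p * B p + b p * C p) / W p"

lemma C1: "C1_on (ball 0 1) f" "C1_on (ball 0 1) a" "C1_on (ball 0 1) b"
  using minimal unfolding minimal_graph_over_def C2_on_def unit_disk_eq_ball a_def b_def by blast+

lemma mse: "(1 + (b p)\<^sup>2) * A p - 2 * a p * b p * B p + (1 + (a p)\<^sup>2) * C p = 0" if "p \<in> ball 0 1"
  using minimal that unfolding minimal_graph_over_def unit_disk_eq_ball a_def b_def A_def B_def C_def by blast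

lemma grad_a: "has_grad a (A p) (B p) p" if "p \<in> ball 0 1"
  using C1_on_has_grad[OF C1(2) that] by (simp add: A_def B_def a_def)

lemma grad_b: "has_grad b (B p) (C p) p" if "p \<in> ball 0 1"
  using C1_on_has_grad[OF C1(3) that] mixed_partials_eq[OF C1(1) C1(2)[unfolded a_def] C1(3)[unfolded b_def] that]
  by (simp add: B_def C_def b_def)

lemma cont: "continuous_on (ball 0 1) a" "continuous_on (ball 0 1) b" "continuous_on (ball 0 1) A"
  "continuous_on (ball 0 1) B" "continuous_on (ball 0 1) C"
  using C1 unfolding C1_on_def a_def b_def A_def B_def C_def by blast+

lemma W: "(W p)\<^sup>2 = 1 + (a p)\<^sup>2 + (b p)\<^sup>2" "W p > 0" "W p \<ge> 1"
proof -
  have "1 \<le> 1 + (a p)\<^sup>2 + (b p)\<^sup>2" by (simp add: add_nonneg_nonneg)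
  then have "(W p)\<^sup>2 = 1 + (a p)\<^sup>2 + (b p)\<^sup>2 \<and> W p \<ge> 1" unfolding W_def by simp
  then show "(W p)\<^sup>2 = 1 + (a p)\<^sup>2 + (b p)\<^sup>2" "W p > 0" "W p \<ge> 1" by auto
qed

lemma contW: "continuous_on (ball 0 1) W"
  unfolding W_def by (intro continuous_intros cont)

lemma W_nz: "W p \<noteq> 0"
  using W(2)[of p] by simp

lemma cont_Wu: "continuous_on (ball 0 1) Wu"
  unfolding Wu_def by (intro continuous_intros cont contW) (simp add: W_nz)

lemma cont_Wv: "continuous_on (ball 0 1) Wv"
  unfolding Wv_def by (intro continuous_intros cont contW) (simp add: W_nz)

lemma grad_square: "has_grad X xu xv p \<Longrightarrow> has_grad (\<lambda>z. (X z)\<^sup>2) (2 * X p * xu) (2 * X p * xv) p"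
  for X :: "real \<times> real \<Rightarrow> real"
  unfolding power2_eq_square by (rule has_grad_cong[OF has_grad_mult]) auto

lemma grad_one_plus: "has_grad X xu xv p \<Longrightarrow> has_grad (\<lambda>z. 1 + X z) xu xv p"
  for X :: "real \<times> real \<Rightarrow> real"
  by (rule has_grad_cong[OF has_grad_add[OF has_grad_const]]) auto

lemma grad_W: "has_grad W (Wu p) (Wv p) p" if p: "p \<in> ball 0 1"
proof -
  have pos: "0 < 1 + (a p)\<^sup>2 + (b p)\<^sup>2" by (simp add: add_pos_nonneg)
  have "has_grad (\<lambda>z. sqrt (1 + (a z)\<^sup>2 + (b z)\<^sup>2)) (inverse (sqrt (1 + (a p)\<^sup>2 + (b p)\<^sup>2)) / 2 * (2 * a p * A p + 2 * b p * B p))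
     (inverse (sqrt (1 + (a p)\<^sup>2 + (b p)\<^sup>2)) / 2 * (2 * a p * B p + 2 * b p * C p)) p"
    by (intro has_grad_compose[of "\<lambda>z. 1 + (a z)\<^sup>2 + (b z)\<^sup>2"] has_grad_add grad_one_plus grad_square grad_a grad_b p DERIV_real_sqrt pos)
  then show ?thesis
    unfolding W_def[abs_def, symmetric] W_def[symmetric]
  proof (rule has_grad_cong)
    have "inverse w / 2 * (2 * x + 2 * y) = (x + y) / w" for w x y :: real
    proof -
      have "2 * x + 2 * y = 2 * (x + y)" by simp
      then show ?thesis by (simp only: divide_inverse) simp
    qed
    from this[of "W p" "a p * A p" "b p * B p"] this[of "W p" "a p * B p" "b p * C p"]
    show "inverse (W p) / 2 * (2 * a p * A p + 2 * b p * B p) = Wu p"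
      "inverse (W p) / 2 * (2 * a p * B p + 2 * b p * C p) = Wv p"
      by (simp_all only: Wu_def Wv_def mult.assoc)
  qed
qed

text \<open>\<open>P1\<close>, \<open>P2\<close>, \<open>P3\<close> are the coefficients of the
  first fundamental form of the graph, divided by the area element \<open>W\<close>.\<close>

definition P1 where "P1 p = (1 + (a p)\<^sup>2) / W p"
definition P2 where "P2 p = a p * b p / W p"
definition P3 where "P3 p = (1 + (b p)\<^sup>2) / W p"

lemma potentials:
  obtains F G where "\<And>p. p \<in> ball 0 1 \<Longrightarrow> has_grad F (P1 p) (P2 p) p"
    "\<And>p. p \<in> ball 0 1 \<Longrightarrow> has_grad G (P2 p) (P3 p) p"
proof -
  define P1u where "P1u p = (2 * a p * A p * W p - (1 + (a p)\<^sup>2) * Wu p) / (W p)\<^sup>2" for p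
  define P2u where "P2u p = ((A p * b p + a p * B p) * W p - a p * b p * Wu p) / (W p)\<^sup>2" for p
  define P2v where "P2v p = ((B p * b p + a p * C p) * W p - a p * b p * Wv p) / (W p)\<^sup>2" for p
  define P3v where "P3v p = (2 * b p * C p * W p - (1 + (b p)\<^sup>2) * Wv p) / (W p)\<^sup>2" for p
  have nz: "W p \<noteq> 0" for p using W(2)[of p] by simp
  note closed = hopf_algebra_closed[OF W(1,2) mse, folded Wu_def Wv_def]
  have g1: "has_grad P1 (P1u p) (P2u p) p" if p: "p \<in> ball 0 1" for p
    unfolding P1_def
    by (rule has_grad_cong[OF has_grad_divide[OF grad_one_plus[OF grad_square[OF grad_a[OF p]]] grad_W[OF p] nz]])
      (simp_all only: P1u_def P2u_def closed(1)[OF p])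
  have g2: "has_grad P2 (P2u p) (P2v p) p" if p: "p \<in> ball 0 1" for p
    unfolding P2_def P2u_def P2v_def by (rule has_grad_divide[OF has_grad_mult[OF grad_a[OF p] grad_b[OF p]] grad_W[OF p] nz])
  have g3: "has_grad P3 (P2v p) (P3v p) p" if p: "p \<in> ball 0 1" for p
    unfolding P3_def
    by (rule has_grad_cong[OF has_grad_divide[OF grad_one_plus[OF grad_square[OF grad_b[OF p]]] grad_W[OF p] nz]])
      (simp_all only: P3v_def P2v_def closed(2)[OF p])
  have c: "continuous_on (ball 0 1) P1u" "continuous_on (ball 0 1) P2u" "continuous_on (ball 0 1) P2v" "continuous_on (ball 0 1) P3v"
    unfolding P1u_def P2u_def P2v_def P3v_def
    by (intro continuous_intros cont contW cont_Wu cont_Wv; simp add: nz)+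
  show thesis
    using potential_exists[OF g1 g2 c(1-3)] potential_exists[OF g2 g3 c(2-4)] that by blast
qed

text \<open>\<open>zu\<close> and \<open>zv\<close> are the partial derivatives of \<tau> = (u + F)
  + i (v + G), with F and G from \<open>potentials\<close>. Its pulled-back Euclidean metric is ((1
  + W) / W)^2 times the metric of the graph, so \<tau> is isothermal.\<close>

definition zu where "zu p = Complex (1 + P1 p) (P2 p)"
definition zv where "zv p = Complex (P2 p) (1 + P3 p)"
text \<open>Up to the factor -i this is the complex conjugate of the stereographic projection of the
  upward unit normal.\<close>

definition q where "q p = Complex (b p / (1 + W p)) (a p / (1 + W p))"
definition qu where "qu p = Complex ((B p * (1 + W p) - b p * Wu p) / (1 + W p)\<^sup>2) ((A p * (1 + W p) - a p * Wu p) / (1 + W p)\<^sup>2)"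
definition qv where "qv p = Complex ((C p * (1 + W p) - b p * Wv p) / (1 + W p)\<^sup>2) ((B p * (1 + W p) - a p * Wv p) / (1 + W p)\<^sup>2)"

lemma grad_q: "has_grad q (qu p) (qv p) p" if p: "p \<in> ball 0 1"
proof -
  have nz: "1 + W p \<noteq> 0" using W(2)[of p] by simp
  show ?thesis
    unfolding q_def qu_def qv_def
    by (intro has_grad_Complex has_grad_divide grad_one_plus grad_a grad_b grad_W p nz)
qed

lemma zu_nz: "zu p \<noteq> 0"
proof -
  have "0 < 1 + P1 p" using W(2)[of p] by (simp add: P1_def add_pos_nonneg)
  then show ?thesis by (auto simp: zu_def complex_eq_iff)
qed

lemma q_conformal: "qu p = qu p / zu p * zu p" "qv p = qu p / zu p * zv p" if "p \<in> ball 0 1"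
  using hopf_algebra_q(1)[OF W(1,2) mse[OF that], folded Wu_def Wv_def] zu_nz[of p]
  by (simp_all add: zu_def zv_def qu_def qv_def P1_def P2_def P3_def field_simps)

text \<open>The left sides are the partial derivatives of \<Psi> = (u - F) - i (v - G). In the
  coordinate \<tau> this becomes the relation g' = Q^2 h'.\<close>

lemma psi_conformal: "Complex (1 - P1 p) (P2 p) = (q p)\<^sup>2 * zu p" "Complex (- P2 p) (P3 p - 1) = (q p)\<^sup>2 * zv p"
  unfolding P1_def P2_def P3_def zu_def zv_def q_def by (rule hopf_algebra_psi[OF W(1,2)])+

lemma norm_q: "(norm (q p))\<^sup>2 = (W p - 1) / (W p + 1)"
proof -
  have "(norm (q p))\<^sup>2 = ((b p)\<^sup>2 + (a p)\<^sup>2) / (1 + W p)\<^sup>2"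
    by (simp add: q_def cmod_power2 power_divide add_divide_distrib)
  also have "(b p)\<^sup>2 + (a p)\<^sup>2 = (W p - 1) * (1 + W p)"
    using W(1)[of p] by (simp add: power2_eq_square algebra_simps)
  finally show ?thesis using W(2)[of p] by (simp add: power2_eq_square add.commute)
qed

lemma norm_q_less: "norm (q p) < 1"
proof -
  have "(norm (q p))\<^sup>2 < 1" using W(2)[of p] by (simp add: norm_q field_simps)
  then show ?thesis by (simp add: abs_square_less_1)
qed

text \<open>As dq = k d\<tau>, the Jacobian of \<open>q\<close> is |k|^2 times that of \<tau>; both
  determinants are known explicitly. The Hessian determinant comes out nonpositive, which settles
  the absolute value.\<close>

lemma curvature_eq:
  assumes "p \<in> ball 0 1"
  shows "\<bar>A p * C p - (B p)\<^sup>2\<bar> = (norm (qu p / zu p))\<^sup>2 * (1 + W p) ^ 4"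
proof -
  define k where "k = qu p / zu p"
  have qk: "qu p = k * zu p" "qv p = k * zv p" using q_conformal[OF assms] by (simp_all add: k_def)
  have j: "Re (k * x) * Im (k * y) - Im (k * x) * Re (k * y) = (norm k)\<^sup>2 * (Re x * Im y - Im x * Re y)" for x y
    unfolding cmod_power2 times_complex.sel by (simp add: power2_eq_square algebra_simps)
  have "- (A p * C p - (B p)\<^sup>2) / (W p * (1 + W p)\<^sup>2) = Re (qu p) * Im (qv p) - Im (qu p) * Re (qv p)"
    using hopf_algebra_q(2)[OF W(1,2) mse[OF assms], folded Wu_def Wv_def] by (simp add: qu_def qv_def)
  also have "\<dots> = (norm k)\<^sup>2 * (Re (zu p) * Im (zv p) - Im (zu p) * Re (zv p))" unfolding qk by (rule j)
  also have "Re (zu p) * Im (zv p) - Im (zu p) * Re (zv p) = (1 + W p)\<^sup>2 / W p"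
    using hopf_algebra_jacobian[OF W(1,2)] by (simp add: zu_def zv_def P1_def P2_def P3_def)
  finally have "- (A p * C p - (B p)\<^sup>2) / (W p * (1 + W p)\<^sup>2) = (norm k)\<^sup>2 * ((1 + W p)\<^sup>2 / W p)" .
  then have "- (A p * C p - (B p)\<^sup>2) = (norm k)\<^sup>2 * ((1 + W p)\<^sup>2 / W p) * (W p * (1 + W p)\<^sup>2)"
    using W(2)[of p] by (subst (asm) divide_eq_eq) auto
  also have "\<dots> = (norm k)\<^sup>2 * (1 + W p) ^ 4"
    using W(2)[of p] by (simp add: power4_eq_xxxx power2_eq_square)
  finally have eq: "- (A p * C p - (B p)\<^sup>2) = (norm k)\<^sup>2 * (1 + W p) ^ 4" .
  moreover have "0 \<le> (norm k)\<^sup>2 * (1 + W p) ^ 4" by simp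
  ultimately show ?thesis unfolding k_def[symmetric] by linarith
qed

text \<open>The differential of \<tau> is the identity plus a positive symmetric matrix, so the
  increment of \<tau> paired with x - y is at least |x - y|^2. This yields both injectivity and the
  Lipschitz inverse needed by \<open>conformal_quotient\<close>.\<close>

lemma expansive:
  assumes \<tau>: "\<And>p. p \<in> ball 0 1 \<Longrightarrow> has_grad \<tau> (zu p) (zv p) p" and x: "x \<in> ball 0 1" and y: "y \<in> ball 0 1"
  shows "norm (x - y) \<le> norm (\<tau> x - \<tau> y)"
proof -
  define d where "d = x - y"
  define N where "N = (fst d)\<^sup>2 + (snd d)\<^sup>2"
  have N: "N = (norm d)\<^sup>2" by (simp add: N_def norm_prod_def)
  define \<phi> where "\<phi> s = Re (\<tau> (y + s *\<^sub>R d)) * fst d + Im (\<tau> (y + s *\<^sub>R d)) * snd d - s * N" for s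
  have seg: "y + s *\<^sub>R d \<in> ball 0 1" if "0 \<le> s" "s \<le> 1" for s
  proof -
    have "y + s *\<^sub>R d = (1 - s) *\<^sub>R y + s *\<^sub>R x" by (simp add: d_def algebra_simps)
    then show ?thesis using convexD[OF convex_ball y x, of "1 - s" s] that by simp
  qed
  have "\<phi> 0 \<le> \<phi> 1"
  proof (rule DERIV_nonneg_imp_nondecreasing[of 0 1 \<phi>])
    fix s :: real assume s: "0 \<le> s" "s \<le> 1"
    define p where "p = y + s *\<^sub>R d"
    define Z where "Z = fst d *\<^sub>R zu p + snd d *\<^sub>R zv p"
    have Z: "((\<lambda>s. \<tau> (y + s *\<^sub>R d)) has_vector_derivative Z) (at s)"
      unfolding Z_def by (rule has_grad_along) (use \<tau>[OF seg[OF s]] in \<open>simp add: p_def\<close>)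
    have "((\<lambda>s. Re (\<tau> (y + s *\<^sub>R d))) has_real_derivative Re Z) (at s)"
      "((\<lambda>s. Im (\<tau> (y + s *\<^sub>R d))) has_real_derivative Im Z) (at s)"
      unfolding has_real_derivative_iff_has_vector_derivative
      using bounded_linear.has_vector_derivative[OF bounded_linear_Re Z] bounded_linear.has_vector_derivative[OF bounded_linear_Im Z] by auto
    then have "(\<phi> has_real_derivative Re Z * fst d + Im Z * snd d - 1 * N) (at s)"
      unfolding \<phi>_def by (intro DERIV_diff DERIV_add DERIV_cmult_right DERIV_ident)
    then have "(\<phi> has_real_derivative Re Z * fst d + Im Z * snd d - N) (at s)" by simp
    \<comment> \<open>The excess over \<open>N\<close> is the first fundamental form evaluated on
      \<open>d\<close>, divided by \<open>W\<close>.\<close>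
    moreover have "Re Z * fst d + Im Z * snd d - N = (N + (a p * fst d + b p * snd d)\<^sup>2) / W p"
      using W(2)[of p]
      by (simp add: Z_def zu_def zv_def P1_def P2_def P3_def N_def field_simps power2_eq_square)
    moreover have "0 \<le> (N + (a p * fst d + b p * snd d)\<^sup>2) / W p"
      using W(2)[of p] by (simp add: N_def)
    ultimately show "\<exists>z. DERIV \<phi> s :> z \<and> z \<ge> 0" by auto
  qed simp
  then have "N \<le> Re (\<tau> x - \<tau> y) * fst d + Im (\<tau> x - \<tau> y) * snd d"
    by (simp add: \<phi>_def d_def algebra_simps)
  also have "\<dots> = (\<tau> x - \<tau> y) \<bullet> Complex (fst d) (snd d)" by (simp add: inner_complex_def)
  also have "\<dots> \<le> norm (\<tau> x - \<tau> y) * norm (Complex (fst d) (snd d))" by (rule norm_cauchy_schwarz)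
  also have "norm (Complex (fst d) (snd d)) = norm d" by (simp add: complex_norm norm_prod_def)
  finally have "norm d * norm d \<le> norm (\<tau> x - \<tau> y) * norm d" by (simp add: N power2_eq_square)
  then show ?thesis
    by (cases "norm d = 0") (auto simp: d_def mult_le_cancel_right)
qed


text \<open>For r < 1 the map \<tau> is continuous on the closed disk of radius r. Its image is
  therefore bounded, as both the Riemann map and the area argument demand.\<close>

theorem curvature_bound_on_disk:
  assumes r: "0 < r" "r < 1"
  shows "73/100 * r\<^sup>2 * (\<bar>A 0 * C 0 - (B 0)\<^sup>2\<bar> / (W 0)\<^sup>2) \<le> 4"
proof -
  have O: "(0 :: real \<times> real) \<in> ball 0 1" "(0 :: real \<times> real) \<in> ball 0 r" using r by auto
  have sub: "ball 0 r \<subseteq> ball (0 :: real \<times> real) 1" using r by auto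
  obtain F G where FG: "\<And>p. p \<in> ball 0 1 \<Longrightarrow> has_grad F (P1 p) (P2 p) p"
    "\<And>p. p \<in> ball 0 1 \<Longrightarrow> has_grad G (P2 p) (P3 p) p"
    using potentials by blast
  define \<tau> where "\<tau> p = Complex (fst p + F p) (snd p + G p)" for p
  \<comment> \<open>The signs make the potentials cancel in \<tau> + cnj \<Psi>, leaving 2 (u + i
    v): the projection of the graph becomes a harmonic map.\<close>
  define \<Psi> where "\<Psi> p = Complex (fst p - F p) (- (snd p - G p))" for p
  have grad_\<tau>: "has_grad \<tau> (zu p) (zv p) p" if p: "p \<in> ball 0 1" for p
    unfolding \<tau>_def
    by (rule has_grad_cong[OF has_grad_Complex[OF has_grad_add[OF has_grad_fst FG(1)[OF p]] has_grad_add[OF has_grad_snd FG(2)[OF p]]]])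
      (auto simp: zu_def zv_def)
  have grad_\<Psi>: "has_grad \<Psi> ((q p)\<^sup>2 * zu p) ((q p)\<^sup>2 * zv p) p" if p: "p \<in> ball 0 1" for p
    unfolding psi_conformal[symmetric] \<Psi>_def
    by (rule has_grad_cong[OF has_grad_Complex[OF has_grad_diff[OF has_grad_fst FG(1)[OF p]]
        has_grad_diff[OF has_grad_const[of 0] has_grad_diff[OF has_grad_snd FG(2)[OF p]], unfolded diff_0]]]) auto
  have exp\<tau>: "norm (x - y) \<le> norm (\<tau> x - \<tau> y)" if "x \<in> ball 0 1" "y \<in> ball 0 1" for x y
    by (rule expansive[OF _ that]) (rule grad_\<tau>)
  have inj\<tau>: "inj_on \<tau> (ball 0 1)"
  proof (rule inj_onI)
    fix x y assume xy: "x \<in> ball 0 1" "y \<in> ball 0 1" "\<tau> x = \<tau> y"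
    from exp\<tau>[OF xy(1,2)] xy(3) show "x = y" by simp
  qed
  have cont\<tau>: "continuous_on (ball 0 1) \<tau>"
    using grad_\<tau> unfolding has_grad_def by (meson continuous_at_imp_continuous_on has_derivative_continuous)
  define \<Omega> where "\<Omega> = \<tau> ` ball 0 r"
  have inj_r: "inj_on \<tau> (ball 0 r)" and cont_r: "continuous_on (ball 0 r) \<tau>"
    using inj_on_subset[OF inj\<tau> sub] continuous_on_subset[OF cont\<tau> sub] by auto
  have open\<Omega>: "open \<Omega>"
    unfolding \<Omega>_def by (rule invariance_of_domain_gen[OF open_ball cont_r inj_r]) simp
  have sc\<Omega>: "simply_connected \<Omega>"
  proof -
    have "ball (0 :: real \<times> real) r homeomorphic \<Omega>"
      unfolding \<Omega>_def by (rule invariance_of_domain_homeomorphic[OF open_ball cont_r _ inj_r]) simp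
    then show ?thesis
      using homeomorphic_simply_connected convex_imp_simply_connected[OF convex_ball, of "0 :: real \<times> real" r] by blast
  qed
  have bdd\<Omega>: "bounded \<Omega>"
  proof -
    have "compact (\<tau> ` cball 0 r)"
      by (intro compact_continuous_image continuous_on_subset[OF cont\<tau>]) (use r in auto)
    then have "bounded (\<tau> ` cball 0 r)" by (rule compact_imp_bounded)
    then show ?thesis by (rule bounded_subset) (auto simp: \<Omega>_def)
  qed
  define \<omega> where "\<omega> = inv_into (ball 0 r) \<tau>"
  have \<omega>: "\<omega> \<zeta> \<in> ball 0 r" "\<tau> (\<omega> \<zeta>) = \<zeta>" if "\<zeta> \<in> \<Omega>" for \<zeta>
    using that inv_into_into[of \<zeta> \<tau> "ball 0 r"] f_inv_into_f[of \<zeta> \<tau> "ball 0 r"] by (auto simp: \<omega>_def \<Omega>_def)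
  have \<omega>\<tau>: "\<omega> (\<tau> p) = p" if "p \<in> ball 0 r" for p
    unfolding \<omega>_def by (rule inv_into_f_f[OF inj_r that])
  have holo: "((\<lambda>\<zeta>. X (\<omega> \<zeta>)) has_field_derivative k) (at \<zeta>)"
    if \<zeta>: "\<zeta> \<in> \<Omega>" and X: "has_grad X (k * zu (\<omega> \<zeta>)) (k * zv (\<omega> \<zeta>)) (\<omega> \<zeta>)" for X k \<zeta>
  proof -
    define p where "p = \<omega> \<zeta>"
    have p: "p \<in> ball 0 r" "\<tau> p = \<zeta>" using \<omega>[OF \<zeta>] by (auto simp: p_def)
    have p1: "p \<in> ball 0 1" using p(1) sub by blast
    have "((\<lambda>\<zeta>. X (\<omega> \<zeta>)) has_field_derivative k) (at (\<tau> p))"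
    proof (rule conformal_quotient[OF X[folded p_def] grad_\<tau>[OF p1] open\<Omega>])
      show "norm (\<omega> \<xi> - p) \<le> norm (\<xi> - \<tau> p)" if "\<xi> \<in> \<Omega>" for \<xi>
        using exp\<tau>[of "\<omega> \<xi>" p] \<omega>[OF that] sub p1 by auto
    qed (use p \<zeta> \<omega>(2) \<omega>\<tau>[OF p(1)] in auto)
    then show ?thesis by (simp add: p)
  qed
  have in1: "\<omega> \<zeta> \<in> ball 0 1" if "\<zeta> \<in> \<Omega>" for \<zeta> using \<omega>(1)[OF that] sub by blast
  have d\<Psi>: "((\<lambda>\<zeta>. \<Psi> (\<omega> \<zeta>)) has_field_derivative (q (\<omega> \<zeta>))\<^sup>2) (at \<zeta>)" if "\<zeta> \<in> \<Omega>" for \<zeta>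
    by (rule holo[OF that grad_\<Psi>[OF in1[OF that]]])
  define k where "k p = qu p / zu p" for p
  have dq: "((\<lambda>\<zeta>. q (\<omega> \<zeta>)) has_field_derivative k (\<omega> \<zeta>)) (at \<zeta>)" if "\<zeta> \<in> \<Omega>" for \<zeta>
    using grad_q[OF in1[OF that]] q_conformal[OF in1[OF that]] by (intro holo[OF that]) (simp add: k_def)
  have \<tau>0: "\<tau> 0 \<in> \<Omega>" using O by (auto simp: \<Omega>_def)
  have "\<Omega> \<noteq> UNIV" using bdd\<Omega> not_bounded_UNIV by auto
  then obtain R where R: "R holomorphic_on ball 0 1" "inj_on R (ball 0 1)" "R ` ball 0 1 = \<Omega>" "R 0 = \<tau> 0"
    using pointed_Riemann_map[OF open\<Omega> sc\<Omega> _ \<tau>0] by blast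
  have R\<Omega>: "R z \<in> \<Omega>" if "norm z < 1" for z using R(3) that by auto
  have dR: "(R has_field_derivative deriv R z) (at z)" if "norm z < 1" for z
    using holomorphic_derivI[OF R(1) open_ball] that by simp
  define h where "h z = (R z - R 0) / 2" for z
  define g where "g z = (\<Psi> (\<omega> (R z)) - \<Psi> 0) / 2" for z
  define Q where "Q z = q (\<omega> (R z))" for z
  have dh: "(h has_field_derivative deriv R z / 2) (at z)" if "norm z < 1" for z
    unfolding h_def using dR[OF that] by (auto intro!: derivative_eq_intros)
  have dg: "(g has_field_derivative (Q z)\<^sup>2 * deriv R z / 2) (at z)" if "norm z < 1" for z
    unfolding g_def Q_def using DERIV_chain2[OF d\<Psi>[OF R\<Omega>[OF that]] dR[OF that]]
    by (auto intro!: derivative_eq_intros)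
  have dQ: "(Q has_field_derivative k (\<omega> (R z)) * deriv R z) (at z)" if "norm z < 1" for z
    unfolding Q_def using DERIV_chain2[OF dq[OF R\<Omega>[OF that]] dR[OF that]] .
  have hol: "h holomorphic_on ball 0 1" "g holomorphic_on ball 0 1" "Q holomorphic_on ball 0 1"
    unfolding holomorphic_on_open[OF open_ball] using dh dg dQ by (metis mem_ball_0)+
  have \<omega>R0: "\<omega> (R 0) = 0" by (simp add: R(4) \<omega>\<tau>[OF O(2)])
  have Ftau: "\<tau> p + cnj (\<Psi> p) = 2 * Complex (fst p) (snd p)" for p
    by (simp add: \<tau>_def \<Psi>_def complex_eq_iff)
  have Fz: "h z + cnj (g z) = Complex (fst (\<omega> (R z))) (snd (\<omega> (R z)))" if "norm z < 1" for z
  proof -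
    have "2 * (h z + cnj (g z)) = (\<tau> (\<omega> (R z)) + cnj (\<Psi> (\<omega> (R z)))) - (\<tau> 0 + cnj (\<Psi> 0))"
      by (simp add: h_def g_def \<omega>(2)[OF R\<Omega>[OF that]] R(4) field_simps)
    also have "\<dots> = 2 * Complex (fst (\<omega> (R z))) (snd (\<omega> (R z)))"
      unfolding Ftau by (simp add: complex_eq_iff)
    finally show ?thesis by (simp only: mult_cancel_left) simp
  qed
  define \<iota> where "\<iota> p = Complex (fst p) (snd p)" for p
  have \<iota>: "inj \<iota>" "norm (\<iota> p) = norm p" for p
    by (auto simp: inj_def \<iota>_def complex_norm norm_prod_def prod_eq_iff)
  have \<iota>ball: "\<iota> ` ball 0 r = ball 0 r"
  proof
    show "ball 0 r \<subseteq> \<iota> ` ball 0 r"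
    proof
      fix z assume "z \<in> ball (0::complex) r"
      then show "z \<in> \<iota> ` ball 0 r"
        using \<iota>(2)[of "(Re z, Im z)"] by (intro image_eqI[of _ _ "(Re z, Im z)"]) (auto simp: \<iota>_def)
    qed
  qed (auto simp: \<iota>)
  have \<omega>img: "\<omega> ` \<Omega> = ball 0 r"
    unfolding \<omega>_def \<Omega>_def by (rule inv_into_image_cancel[OF inj_r subset_refl])
  have Fimg: "(\<lambda>z. h z + cnj (g z)) ` ball 0 1 = ball 0 r"
  proof -
    have "(\<lambda>z. h z + cnj (g z)) ` ball 0 1 = \<iota> ` \<omega> ` R ` ball 0 1"
      unfolding image_image \<iota>_def by (intro image_cong refl Fz) simp
    then show ?thesis by (simp add: R(3) \<omega>img \<iota>ball)
  qed
  have Finj: "inj_on (\<lambda>z. h z + cnj (g z)) (ball 0 1)"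
  proof (rule inj_onI)
    fix x y assume x: "x \<in> ball 0 1" and y: "y \<in> ball 0 1" and "h x + cnj (g x) = h y + cnj (g y)"
    then have "\<iota> (\<omega> (R x)) = \<iota> (\<omega> (R y))" using Fz[of x] Fz[of y] by (simp add: \<iota>_def)
    then have "\<omega> (R x) = \<omega> (R y)" using \<iota>(1) by (simp add: inj_eq)
    then have "R x = R y" using \<omega>(2)[OF R\<Omega>] x y by (metis mem_ball_0)
    then show "x = y" using R(2) x y by (simp add: inj_on_eq_iff)
  qed
  have bddh: "bounded (h ` ball 0 1)"
  proof -
    have "h ` ball 0 1 = (\<lambda>\<zeta>. (1/2) *\<^sub>R \<zeta>) ` (\<lambda>\<zeta>. \<zeta> - R 0) ` \<Omega>"
      unfolding R(3)[symmetric] image_image h_def by (intro image_cong refl) (simp add: scaleR_conv_of_real)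
    then show ?thesis using bounded_scaling[OF bounded_translation_minus[OF bdd\<Omega>]] by simp
  qed
  have injh: "inj_on h (ball 0 1)" using R(2) by (simp add: inj_on_def h_def)
  have main: "73/100 * r\<^sup>2 \<le> (norm (deriv h 0))\<^sup>2 * (1 + (norm (Q 0))\<^sup>2)\<^sup>2"
  proof (rule harmonic_disk_map_bound[OF hol _ _ injh bddh _ _ Finj Fimg r(1)])
    show "h 0 = 0" "g 0 = 0" by (simp_all add: h_def g_def \<omega>R0)
    show "norm (Q z) < 1" for z by (simp add: Q_def norm_q_less)
    show "deriv g z = (Q z)\<^sup>2 * deriv h z" if "norm z < 1" for z
      unfolding DERIV_imp_deriv[OF dh[OF that]] DERIV_imp_deriv[OF dg[OF that]] by simp
  qed
  define w where "w = W 0"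
  have w: "w \<ge> 1" using W(3)[of 0] by (simp add: w_def)
  define \<rho> where "\<rho> = norm (deriv R 0)"
  define K where "K = norm (k 0)"
  have Q0: "(norm (Q 0))\<^sup>2 = (w - 1) / (w + 1)" by (simp add: Q_def \<omega>R0 norm_q w_def)
  have "norm (deriv Q 0) \<le> 1 - (norm (Q 0))\<^sup>2"
    by (rule Schwarz_Pick_at_zero[OF hol(3)]) (simp add: Q_def norm_q_less)
  then have "K * \<rho> \<le> 1 - (w - 1) / (w + 1)"
    using DERIV_imp_deriv[OF dQ[of 0]] by (simp add: Q0 \<omega>R0 norm_mult K_def \<rho>_def)
  also have "\<dots> = 2 / (w + 1)" using w by (simp add: field_simps)
  finally have "K * \<rho> * (w + 1) \<le> 2" using w by (simp add: pos_le_divide_eq)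
  then have sp: "(K * \<rho> * (w + 1))\<^sup>2 \<le> 2\<^sup>2"
    using w by (intro power_mono) (auto simp: K_def \<rho>_def)
  have "norm (deriv h 0) = \<rho> / 2"
    unfolding DERIV_imp_deriv[OF dh[of 0, simplified]] \<rho>_def by (simp add: norm_divide)
  then have "73/100 * r\<^sup>2 \<le> (\<rho> / 2)\<^sup>2 * (1 + (w - 1) / (w + 1))\<^sup>2"
    using main by (simp only: Q0)
  also have "1 + (w - 1) / (w + 1) = 2 * w / (w + 1)" using w by (simp add: field_simps)
  also have "(\<rho> / 2)\<^sup>2 * (2 * w / (w + 1))\<^sup>2 = \<rho>\<^sup>2 * w\<^sup>2 / (w + 1)\<^sup>2"
    by (simp add: power_mult_distrib power_divide)
  finally have m2: "73/100 * r\<^sup>2 \<le> \<rho>\<^sup>2 * w\<^sup>2 / (w + 1)\<^sup>2" .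
  have curv: "\<bar>A 0 * C 0 - (B 0)\<^sup>2\<bar> / w\<^sup>2 = K\<^sup>2 * (w + 1) ^ 4 / w\<^sup>2"
    using curvature_eq[OF O(1)] by (simp add: K_def k_def w_def add.commute)
  \<comment> \<open>The unknown |R'(0)| cancels: it enters the lower bound for |h'(0)| and the
    Schwarz-Pick bound for |Q'(0)| = K |R'(0)| to the same power.\<close>
  have "73/100 * r\<^sup>2 * (\<bar>A 0 * C 0 - (B 0)\<^sup>2\<bar> / w\<^sup>2) \<le> \<rho>\<^sup>2 * w\<^sup>2 / (w + 1)\<^sup>2 * (K\<^sup>2 * (w + 1) ^ 4 / w\<^sup>2)"
    unfolding curv by (intro mult_right_mono m2) simp
  also have "\<dots> = (K * \<rho> * (w + 1))\<^sup>2"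
  proof -
    have "\<rho>\<^sup>2 * w\<^sup>2 / u\<^sup>2 * (K\<^sup>2 * u ^ 4 / w\<^sup>2) = (K * \<rho> * u)\<^sup>2" if "u \<noteq> 0" for u
      using w that by (simp add: power4_eq_xxxx power2_eq_square)
    then show ?thesis using w by simp
  qed
  also have "\<dots> \<le> 4" using sp by simp
  finally show ?thesis by (simp add: w_def)
qed

end

theorem hopf_constant_le: "hopf_constant \<le> ereal (400 / 73)"
  unfolding hopf_constant_def
proof (rule SUP_least)
  fix f assume "f \<in> {f. minimal_graph_over unit_disk f}"
  then interpret minimal_graph_disk f by unfold_locales simp
  define H where "H = \<bar>A 0 * C 0 - (B 0)\<^sup>2\<bar> / (W 0)\<^sup>2"
  \<comment> \<open>Here z = r^2; the number \<open>H\<close> does not depend on r, so z can tend to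
    1.\<close>
  have "z * H \<le> 400 / 73" if z: "0 < z" "z < 1" for z
  proof -
    have "73/100 * z * H \<le> 4"
      using curvature_bound_on_disk[of "sqrt z", folded H_def] z by simp
    then show ?thesis by simp
  qed
  then have H: "H \<le> 400 / 73" by (rule field_le_mult_one_interval)
  have "(graph_W f (0, 0))\<^sup>2 * \<bar>gauss_curvature f (0, 0)\<bar> = H"
  proof -
    have W0: "graph_W f (0, 0) = W 0" by (simp add: graph_W_def W_def a_def b_def zero_prod_def)
    have "gauss_curvature f (0, 0) = (A 0 * C 0 - (B 0)\<^sup>2) / (W 0) ^ 4"
      by (simp add: gauss_curvature_def W0 A_def B_def C_def zero_prod_def)
    then have "\<bar>gauss_curvature f (0, 0)\<bar> = \<bar>A 0 * C 0 - (B 0)\<^sup>2\<bar> / (W 0) ^ 4"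
      using W(2)[of 0] by simp
    then show ?thesis
      using W(2)[of 0] by (simp add: W0 H_def power4_eq_xxxx power2_eq_square)
  qed
  then show "ereal ((graph_W f (0, 0))\<^sup>2 * \<bar>gauss_curvature f (0, 0)\<bar>) \<le> ereal (400 / 73)"
    using H by simp
qed

theorem theorem2p3:
  shows "hopf_constant < ereal (2 * pi\<^sup>2 / 27 * (2 + sqrt 31))
       \<and> \<bar>2 * pi\<^sup>2 / 27 * (2 + sqrt 31) - 5.53265\<bar> < 0.000005"
proof
  define c where "c = 2 * pi\<^sup>2 / 27 * (2 + sqrt 31)"
  have pi: "31415926535/10000000000 \<le> pi" "pi \<le> 31415926536/10000000000"
    using pi_approx by simp_all
  \<comment> \<open>The constant is about 5.53265485, within 2/10^7 of the upper end of the allowed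
    interval, so \<open>sqrt 31\<close> has to be enclosed to seven decimals.\<close>
  have s: "55677643/10000000 \<le> sqrt 31" "sqrt 31 \<le> 55677644/10000000"
    by (rule real_le_rsqrt, simp add: power2_eq_square) (rule real_le_lsqrt, simp_all add: power2_eq_square)
  have "2 * (31415926535/10000000000)\<^sup>2 / 27 * (2 + 55677643/10000000) \<le> c"
    unfolding c_def using pi s by (intro mult_mono divide_right_mono mult_left_mono power_mono add_mono) auto
  then have lo: "553265/100000 < c + 5/1000000 - 1/100000000" by (simp add: power2_eq_square)
  have "c \<le> 2 * (31415926536/10000000000)\<^sup>2 / 27 * (2 + 55677644/10000000)"
    unfolding c_def using pi s by (intro mult_mono divide_right_mono mult_left_mono power_mono add_mono) auto
  then have hi: "c < 553265/100000 + 5/1000000" by (simp add: power2_eq_square)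
  show "\<bar>2 * pi\<^sup>2 / 27 * (2 + sqrt 31) - 5.53265\<bar> < 0.000005"
    using lo hi unfolding c_def[symmetric] abs_less_iff by (intro conjI) simp_all
  have "ereal (400 / 73) < ereal c" using lo by simp
  then show "hopf_constant < ereal (2 * pi\<^sup>2 / 27 * (2 + sqrt 31))"
    using hopf_constant_le unfolding c_def by (rule le_less_trans[rotated])
qed

end
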